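(* Assume that $\xi\in L^2$, that there is a constant $C_f$ such that, $\mathbb{P}$-a.s., for all $t\in[0,T]$, $y,y'\in\mathbb{R}^m$, $z,z',\tilde z,\tilde z'\in\mathbb{R}^{m\times d}$ and $\mu,\nu\in\mathcal{P}_2(\mathbb{R}^m)$, $$|f(t,y,z,\tilde z,\mu)-f(t,y',z',\tilde z',\nu)|\le C_f\big(|y-y'|+|z-z'|+|\tilde z-\tilde z'|+W_2(\mu,\nu)\big),$$ and that $\mathbb{E}[\int_0^T|f(s,0,0,0,\delta_0)|^2ds]<\infty$. Let $\mu_s=\mathcal{L}^1(Y_s)$ and $\mu^n_s=\frac1n\sum_{i=1}^n\delta_{Y^{i,n}_s}$. Then there exists $C_T>0$, not depending on $n$, such that for all $n\ge1$ $$\mathbb{E}\Big[\sup_{t\le T}\frac1n\sum_{i=1}^n\Big(|Y^{i,n}_t-\tilde Y^i_t|^2+\int_t^T|Z^{0,i,n}_s-\tilde Z^{0,i}_s|^2ds+\int_t^T\sum_{k=1}^n|Z^{i,k,n}_s-\tilde Z^i_s\delta_{i,k}|^2ds\Big)\Big]\le C_T\,\mathbb{E}\Big[\sup_{s\le T}W_2^2(\mu^n_s,\mu_s)\Big],$$ and, for every $i\in\{1,\dots,n\}$, $$\mathbb{E}\Big[\sup_{t\le T}\Big\{|Y^{i,n}_t-\tilde Y^i_t|^2+\int_t^T|Z^{0,i,n}_s-\tilde Z^{0,i}_s|^2ds+\int_t^T\sum_{k=1}^n|Z^{i,k,n}_s-\tilde Z^i_s\delta_{i,k}|^2ds\Big\}\Big]\le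 C_T\,\mathbb{E}\Big[\sup_{s\le T}W_2^2(\mu^n_s,\mu_s)\Big].$$
   Context: Fix a finite horizon $T>0$ and integers $m,d\ge1$; $|\cdot|$ denotes Euclidean norms; $\delta_{i,k}$ is the Kronecker symbol. Let $(\Omega^0,\mathcal{F}^0,\mathbb{P}^0)$ and $(\Omega^1,\mathcal{F}^1,\mathbb{P}^1)$ be complete probability spaces; $\Omega^0$ carries a $d$-dimensional Brownian motion $W^0$ (the common noise) and $\Omega^1$ carries independent $d$-dimensional Brownian motions $W,W^1,W^2,\dots$. On $\Omega=\Omega^0\times\Omega^1$ let $(\mathcal{F},\mathbb{P})$ be the completion of $(\mathcal{F}^0\otimes\mathcal{F}^1,\mathbb{P}^0\otimes\mathbb{P}^1)$; all Brownian motions are extended to $\Omega$. Filtrations are the right-continuous complete augmentations of those generated by the relevant Brownian motions: $(W^0,W)$ for the limit equation, $(W^0,W^i)$ for the $i$-th coupled equation, $(W^0,W^1,\dots,W^n)$ for the $n$-particle system. For a random variable $X$ on $\Omega$, $\mathcal{L}^1(X)$ is the random measure $\omega^0\mapsto$ law of $X(\omega^0,\cdot)$ under $\mathbb{P}^1$ (the conditional law given the common noise). $\mathcal{P}_2(\mathbb{R}^m)$ is the set of probability measures on $\mathbb{R}^m$ with finite second moment and $W_2$ is the 2-Wasserstein distance. $L^2$ denotes square-integrable terminal random variables; $\mathcal{S}^2$ denotes progressively measurable processes $y$ with $\mathbb{E}[\sup_{t\le T}|y_t|^2]<\infty$; $\mathcal{H}^2$ denotes progressively measurable processes $z$ with $\mathbb{E}[\int_0^T|z_s|^2ds]<\infty$.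 The driver $f:\Omega\times[0,T]\times\mathbb{R}^m\times\mathbb{R}^{m\times d}\times\mathbb{R}^{m\times d}\times\mathcal{P}_2(\mathbb{R}^m)\to\mathbb{R}^m$ is progressively measurable and depends on $\omega$ only through $\omega^0$. The terminal conditions are $\xi=\Psi(W^0,W)$ and $\xi^i=\Psi(W^0,W^i)$ for a common measurable map $\Psi$ of the paths on $[0,T]$, so that the $\xi^i$ are i.i.d. copies of $\xi$ conditionally on the common noise. Limit equation: $(Y,Z,Z^0)\in\mathcal{S}^2\times\mathcal{H}^2\times\mathcal{H}^2$ is the unique solution of $$Y_t=\xi+\int_t^Tf(s,Y_s,Z_s,Z^0_s,\mathcal{L}^1(Y_s))\,ds-\int_t^TZ_s\,dW_s-\int_t^TZ^0_s\,dW^0_s.$$ Particle system: for $i=1,\dots,n$, with $\mu^n_s=\frac1n\sum_{j=1}^n\delta_{Y^{j,n}_s}$, the processes $Y^{i,n}\in\mathcal{S}^2$, $Z^{i,k,n},Z^{0,i,n}\in\mathcal{H}^2$ form the unique solution of $$Y^{i,n}_t=\xi^i+\int_t^Tf(s,Y^{i,n}_s,Z^{i,i,n}_s,Z^{0,i,n}_s,\mu^n_s)\,ds-\int_t^T\sum_{k=1}^nZ^{i,k,n}_s\,dW^k_s-\int_t^TZ^{0,i,n}_s\,dW^0_s.$$ Coupled system: for $i\ge1$, $(\tilde Y^i,\tilde Z^i,\tilde Z^{0,i})\in\mathcal{S}^2\times\mathcal{H}^2\times\mathcal{H}^2$ is the unique solution of $$\tilde Y^i_t=\xi^i+\int_t^Tf(s,\tilde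 Y^i_s,\tilde Z^i_s,\tilde Z^{0,i}_s,\mathcal{L}^1(Y_s))\,ds-\int_t^T\tilde Z^i_s\,dW^i_s-\int_t^T\tilde Z^{0,i}_s\,dW^0_s;$$ the $\tilde Y^i$ are i.i.d. conditionally on the common noise. *)

theory Defs
  imports "HOL-Probability.Probability"
begin

definition product_space :: "'a measure \<Rightarrow> 'b measure \<Rightarrow> ('a \<times> 'b) measure" where
  "product_space M0 M1 = completion (M0 \<Otimes>\<^sub>M M1)"

text \<open>The trajectory on the horizon, as a point of the product space \<open>PiM {0..T} (\<lambda>_. borel)\<close>;
  on continuous paths the product sigma-algebra is the Borel one of the uniform topology.\<close>

definition trajectory :: "real \<Rightarrow> (real \<Rightarrow> 'w \<Rightarrow> 'x) \<Rightarrow> 'w \<Rightarrow> real \<Rightarrow> 'x" where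
  "trajectory T X \<omega> = restrict (\<lambda>t. X t \<omega>) {0..T}"

definition brownian_motion :: "'w measure \<Rightarrow> real \<Rightarrow> (real \<Rightarrow> 'w \<Rightarrow> real^'d) \<Rightarrow> bool" where
  "brownian_motion M T B \<longleftrightarrow>
     (\<forall>t\<in>{0..T}. B t \<in> borel_measurable M) \<and>
     (AE \<omega> in M. B 0 \<omega> = 0) \<and>
     (AE \<omega> in M. continuous_on {0..T} (\<lambda>t. B t \<omega>)) \<and>
     (\<forall>s t. 0 \<le> s \<and> s < t \<and> t \<le> T \<longrightarrow>
        distributed M lborel (\<lambda>\<omega>. B t \<omega> - B s \<omega>)
          (\<lambda>x. ennreal (\<Prod>j\<in>UNIV. normal_density 0 (sqrt (t - s)) (x $ j)))) \<and>
     (\<forall>(N::nat) (\<tau>::nat \<Rightarrow> real). 0 \<le> \<tau> 0 \<and> (\<forall>j<N. \<tau> j \<le> \<tau> (Suc j)) \<and> \<tau> N \<le> T \<longrightarrow>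
        prob_space.indep_vars M (\<lambda>_. borel) (\<lambda>j \<omega>. B (\<tau> (Suc j)) \<omega> - B (\<tau> j) \<omega>) {..<N})"

text \<open>Right-continuous augmentation, by the null sets of \<open>M\<close>, of the filtration generated on
  \<open>[0, T]\<close> by the processes in \<open>\<X>\<close>. It is constant in \<open>t\<close> on \<open>[T, \<infinity>)\<close>, so that at \<open>t = T\<close> the
  intersection is the completed sigma-algebra generated by the whole paths.\<close>

definition augmented_filtration ::
  "'w measure \<Rightarrow> real \<Rightarrow> (real \<Rightarrow> 'w \<Rightarrow> 'x::topological_space) set \<Rightarrow> real \<Rightarrow> 'w measure" where
  "augmented_filtration M T \<X> t =
     sigma (space M)
       (\<Inter>u\<in>{t<..}. sigma_sets (space M)
          (null_sets M \<union>
           {X s -` A \<inter> space M | X s A. X \<in> \<X> \<and> 0 \<le> s \<and> s \<le> T \<and> s \<le> u \<and> A \<in> sets borel}))"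

definition progressive ::
  "real \<Rightarrow> (real \<Rightarrow> 'w measure) \<Rightarrow> (real \<Rightarrow> 'w \<Rightarrow> 'x::topological_space) \<Rightarrow> bool" where
  "progressive T F X \<longleftrightarrow>
     (\<forall>t\<in>{0..T}. (\<lambda>(s, \<omega>). X s \<omega>) \<in> borel_measurable (restrict_space borel {0..t} \<Otimes>\<^sub>M F t))"

definition in_L2 :: "'w measure \<Rightarrow> ('w \<Rightarrow> 'x::real_normed_vector) \<Rightarrow> bool" where
  "in_L2 M X \<longleftrightarrow>
     X \<in> borel_measurable M \<and> (\<integral>\<^sup>+\<omega>. ennreal ((norm (X \<omega>))\<^sup>2) \<partial>M) < \<infinity>"

definition in_S2 ::
  "'w measure \<Rightarrow> real \<Rightarrow> (real \<Rightarrow> 'w measure) \<Rightarrow> (real \<Rightarrow> 'w \<Rightarrow> 'x::real_normed_vector) \<Rightarrow> bool" where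
  "in_S2 M T F Y \<longleftrightarrow>
     progressive T F Y \<and>
     (\<integral>\<^sup>+\<omega>. (SUP t\<in>{0..T}. ennreal ((norm (Y t \<omega>))\<^sup>2)) \<partial>M) < \<infinity>"

definition in_H2 ::
  "'w measure \<Rightarrow> real \<Rightarrow> (real \<Rightarrow> 'w measure) \<Rightarrow> (real \<Rightarrow> 'w \<Rightarrow> 'x::real_normed_vector) \<Rightarrow> bool" where
  "in_H2 M T F Z \<longleftrightarrow>
     progressive T F Z \<and>
     (\<integral>\<^sup>+\<omega>. (\<integral>\<^sup>+s\<in>{0..T}. ennreal ((norm (Z s \<omega>))\<^sup>2) \<partial>lborel) \<partial>M) < \<infinity>"

text \<open>A simple process takes the value \<open>H j\<close> on the interval \<open>]\<tau> j, \<tau> (j + 1)]\<close>, for \<open>j < N\<close>.\<close>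

definition simple_process ::
  "'w measure \<Rightarrow> real \<Rightarrow> (real \<Rightarrow> 'w measure) \<Rightarrow> nat \<Rightarrow> (nat \<Rightarrow> real) \<Rightarrow>
   (nat \<Rightarrow> 'w \<Rightarrow> 'x::real_normed_vector) \<Rightarrow> bool" where
  "simple_process M T F N \<tau> H \<longleftrightarrow>
     \<tau> 0 = 0 \<and> \<tau> N = T \<and> (\<forall>j<N. \<tau> j \<le> \<tau> (Suc j)) \<and>
     (\<forall>j<N. H j \<in> borel_measurable (F (\<tau> j)) \<and> (\<exists>K. \<forall>\<omega>\<in>space M. norm (H j \<omega>) \<le> K))"

definition simple_value ::
  "nat \<Rightarrow> (nat \<Rightarrow> real) \<Rightarrow> (nat \<Rightarrow> 'w \<Rightarrow> 'x::real_vector) \<Rightarrow> real \<Rightarrow> 'w \<Rightarrow> 'x" where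
  "simple_value N \<tau> H s \<omega> = (\<Sum>j<N. indicator {\<tau> j<..\<tau> (Suc j)} s *\<^sub>R H j \<omega>)"

definition simple_ito_integral ::
  "(real \<Rightarrow> 'w \<Rightarrow> real^'d) \<Rightarrow> nat \<Rightarrow> (nat \<Rightarrow> real) \<Rightarrow> (nat \<Rightarrow> 'w \<Rightarrow> real^'d^'m) \<Rightarrow>
   real \<Rightarrow> 'w \<Rightarrow> real^'m" where
  "simple_ito_integral B N \<tau> H t \<omega> =
     (\<Sum>j<N. H j \<omega> *v (B (min (\<tau> (Suc j)) t) \<omega> - B (min (\<tau> j) t) \<omega>))"

text \<open>\<open>J\<close> is a continuous adapted version of the process \<open>t \<mapsto> \<integral>\<^sub>0\<^sup>t Z dB\<close> on \<open>[0, T]\<close>: the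
  \<open>L\<^sup>2\<close>-extension of the integral of simple processes. By the Ito isometry such a \<open>J\<close> exists for every
  \<open>Z\<close> in \<open>in_H2\<close> when \<open>B\<close> is a Brownian motion relative to \<open>F\<close>, and it is unique up to
  indistinguishability.\<close>

definition has_ito_integral ::
  "'w measure \<Rightarrow> real \<Rightarrow> (real \<Rightarrow> 'w measure) \<Rightarrow> (real \<Rightarrow> 'w \<Rightarrow> real^'d) \<Rightarrow>
   (real \<Rightarrow> 'w \<Rightarrow> real^'d^'m) \<Rightarrow> (real \<Rightarrow> 'w \<Rightarrow> real^'m) \<Rightarrow> bool" where
  "has_ito_integral M T F B Z J \<longleftrightarrow>
     (\<forall>t\<in>{0..T}. J t \<in> borel_measurable (F t)) \<and>
     (AE \<omega> in M. continuous_on {0..T} (\<lambda>t. J t \<omega>)) \<and>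
     (\<exists>N \<tau> H. (\<forall>l::nat. simple_process M T F (N l) (\<tau> l) (H l)) \<and>
        (\<lambda>l. \<integral>\<^sup>+\<omega>. (\<integral>\<^sup>+s\<in>{0..T}.
             ennreal ((norm (simple_value (N l) (\<tau> l) (H l) s \<omega> - Z s \<omega>))\<^sup>2) \<partial>lborel) \<partial>M)
          \<longlonglongrightarrow> 0 \<and>
        (\<forall>t\<in>{0..T}. (\<lambda>l. \<integral>\<^sup>+\<omega>.
             ennreal ((norm (simple_ito_integral B (N l) (\<tau> l) (H l) t \<omega> - J t \<omega>))\<^sup>2) \<partial>M)
          \<longlonglongrightarrow> 0))"

text \<open>The backward equation on \<open>[0, T]\<close>
    \<open>Y\<^sub>t = \<xi> + \<integral>\<^sub>t\<^sup>T g\<^sub>s ds - \<Sum>k\<in>K. \<integral>\<^sub>t\<^sup>T Z\<^sup>k dB\<^sup>k - \<integral>\<^sub>t\<^sup>T Z\<^sup>0 dB\<^sup>0\<close>,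
  where \<open>g\<close> is the driver already evaluated along the solution.\<close>

definition bsde_solution ::
  "'w measure \<Rightarrow> real \<Rightarrow> (real \<Rightarrow> 'w measure) \<Rightarrow> ('w \<Rightarrow> real^'m) \<Rightarrow> (real \<Rightarrow> 'w \<Rightarrow> real^'m) \<Rightarrow>
   'k set \<Rightarrow> ('k \<Rightarrow> real \<Rightarrow> 'w \<Rightarrow> real^'d) \<Rightarrow> (real \<Rightarrow> 'w \<Rightarrow> real^'d) \<Rightarrow>
   (real \<Rightarrow> 'w \<Rightarrow> real^'m) \<Rightarrow> ('k \<Rightarrow> real \<Rightarrow> 'w \<Rightarrow> real^'d^'m) \<Rightarrow> (real \<Rightarrow> 'w \<Rightarrow> real^'d^'m) \<Rightarrow> bool" where
  "bsde_solution M T F \<xi> g K B B0 Y Z Z0 \<longleftrightarrow>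
     in_S2 M T F Y \<and> (\<forall>k\<in>K. in_H2 M T F (Z k)) \<and> in_H2 M T F Z0 \<and>
     (\<exists>J J0. (\<forall>k\<in>K. has_ito_integral M T F (B k) (Z k) (J k)) \<and>
        has_ito_integral M T F B0 Z0 J0 \<and>
        (AE \<omega> in M. set_integrable lborel {0..T} (\<lambda>s. g s \<omega>) \<and>
           (\<forall>t\<in>{0..T}. Y t \<omega> = \<xi> \<omega> + (LINT s:{t..T}|lborel. g s \<omega>)
              - (\<Sum>k\<in>K. J k T \<omega> - J k t \<omega>) - (J0 T \<omega> - J0 t \<omega>))))"

text \<open>For \<open>X\<close> measurable on \<open>product_space M0 M1\<close> with complete factors, the section of \<open>X\<close> at \<open>\<omega>0\<close> is
  measurable for almost every \<open>\<omega>0\<close>; elsewhere the value of \<open>distr\<close> is irrelevant.\<close>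

definition conditional_law ::
  "'b measure \<Rightarrow> ('a \<times> 'b \<Rightarrow> 'x::topological_space) \<Rightarrow> 'a \<Rightarrow> 'x measure" where
  "conditional_law M1 X \<omega>0 = distr M1 borel (\<lambda>\<omega>1. X (\<omega>0, \<omega>1))"

definition empirical_measure :: "nat \<Rightarrow> (nat \<Rightarrow> 'x::topological_space) \<Rightarrow> 'x measure" where
  "empirical_measure n x =
     measure_of UNIV (sets borel) (\<lambda>A. (\<Sum>j=1..n. emeasure (return borel (x j)) A) / of_nat n)"

definition P2 :: "('x::real_normed_vector) measure set" where
  "P2 = {\<mu> \<in> space (prob_algebra borel). (\<integral>\<^sup>+x. ennreal ((norm x)\<^sup>2) \<partial>\<mu>) < \<infinity>}"

definition couplings ::
  "'x::topological_space measure \<Rightarrow> 'x measure \<Rightarrow> ('x \<times> 'x) measure set" where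
  "couplings \<mu> \<nu> =
     {\<pi>. prob_space \<pi> \<and> sets \<pi> = sets (borel \<Otimes>\<^sub>M borel) \<and>
         distr \<pi> borel fst = \<mu> \<and> distr \<pi> borel snd = \<nu>}"

definition W2 :: "('x::real_normed_vector) measure \<Rightarrow> 'x measure \<Rightarrow> real" where
  "W2 \<mu> \<nu> =
     sqrt (enn2real (INF \<pi>\<in>couplings \<mu> \<nu>. \<integral>\<^sup>+p. ennreal ((norm (fst p - snd p))\<^sup>2) \<partial>\<pi>))"

text \<open>\<open>prob_algebra\<close> carries the sigma-algebra generated by the evaluations \<open>\<mu> \<mapsto> \<mu>(A)\<close>; on \<open>P2\<close> over a
  Euclidean space its trace is the Borel sigma-algebra of the \<open>W2\<close>-topology.\<close>

definition progressive_driver ::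
  "real \<Rightarrow> (real \<Rightarrow> 'w measure) \<Rightarrow>
   ('w \<Rightarrow> real \<Rightarrow> real^'m \<Rightarrow> real^'d^'m \<Rightarrow> real^'d^'m \<Rightarrow> (real^'m) measure \<Rightarrow> real^'m) \<Rightarrow> bool" where
  "progressive_driver T F f \<longleftrightarrow>
     (\<forall>t\<in>{0..T}. (\<lambda>((s, \<omega>), y, z, z0, \<mu>). f \<omega> s y z z0 \<mu>) \<in> borel_measurable
        ((restrict_space borel {0..t} \<Otimes>\<^sub>M F t) \<Otimes>\<^sub>M
           (borel \<Otimes>\<^sub>M (borel \<Otimes>\<^sub>M (borel \<Otimes>\<^sub>M restrict_space (prob_algebra borel) P2)))))"

end

theory Submission
  imports Defs
begin

text \<open>
  Fix a particle \<open>i \<le> n\<close>. The difference \<open>U = Y\<^sup>i\<^sup>,\<^sup>n - Y\<^sup>~\<^sup>i\<close> of the particle and its coupled copy solves a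
  backward equation in the filtration of all \<open>n + 1\<close> noises. Its terminal value is \<open>0\<close>, since both
  equations have the terminal value \<open>\<xi>\<^sup>i\<close>. Its martingale part \<open>M\<close> has the integrands
  \<open>V\<^sup>k = Z\<^sup>i\<^sup>,\<^sup>k\<^sup>,\<^sup>n - \<delta>\<^sub>i\<^sub>k Z\<^sup>~\<^sup>i\<close> and \<open>V\<^sup>0 = Z\<^sup>0\<^sup>,\<^sup>i\<^sup>,\<^sup>n - Z\<^sup>~\<^sup>0\<^sup>,\<^sup>i\<close>. Its driver \<open>G\<close> satisfies
  \<open>|G\<^sub>s| \<le> C (|U\<^sub>s| + |V\<^sup>i\<^sub>s| + |V\<^sup>0\<^sub>s| + w\<^sub>s)\<close> with the forcing \<open>w\<^sub>s = W\<^sub>2(\<mu>\<^sup>n\<^sub>s, \<mu>\<^sub>s)\<close>. Both estimates are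
  therefore consequences of one stability estimate for backward equations (\<open>bsde_stability\<close>), whose
  constant depends on \<open>C\<close> and \<open>T\<close> alone: the driver involves only two of the integrands, whatever \<open>n\<close>
  is. The estimate for one particle is \<open>coupled_bsde_estimate\<close>; the one for the average over the particles
  follows by averaging the pathwise bounds.

  The stability estimate is a Hilbert space argument. For \<open>t \<le> u\<close> the equation reads
  \<open>U\<^sub>t + (M\<^sub>u - M\<^sub>t) = U\<^sub>u + \<integral>\<^sub>t\<^sup>u G\<^sub>s ds\<close>. As \<open>U\<^sub>t\<close> is known at time \<open>t\<close>, it is orthogonal in \<open>L\<^sup>2\<close> to the
  martingale increment (\<open>ito_orthogonality\<close>), whose second moment is given by the Ito isometry
  (\<open>ito_isometry\<close>). Hence
  \<open>E|U\<^sub>t|\<^sup>2 + E \<Sum>k. \<integral>\<^sub>t\<^sup>u |V\<^sup>k\<^sub>s|\<^sup>2 ds \<le> 2 E|U\<^sub>u|\<^sup>2 + 2 E|\<integral>\<^sub>t\<^sup>u G\<^sub>s ds|\<^sup>2\<close>.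
  By the Cauchy-Schwarz inequality the last term carries the factor \<open>u - t\<close> in front of the quantities on
  the left. On short intervals it is absorbed, and finitely many steps lead from \<open>T\<close> back to \<open>0\<close>
  (\<open>backward_iteration\<close>). The supremum over \<open>t\<close> is then taken inside the expectation by means of Doob's
  maximal inequality for \<open>M\<close> (\<open>doob_maximal\<close>).

  Isometry and orthogonality pass to \<open>L\<^sup>2\<close>-limits, so that they have to be shown for elementary
  integrands. There they reduce to the statement that the increments of the noises after a time \<open>a\<close> are
  centred and have the identity covariance (times the length of the interval) on every event of the augmented
  filtration at \<open>a\<close> (\<open>filtration_increment_moments\<close>). For cylinder events this is the independence of the
  increments of each motion together with the independence of the motions
  (\<open>cylinder_uncorrelated\<close>); a Dynkin argument extends it to generated sigma-algebras, and letting
  \<open>u\<close> decrease to \<open>a\<close> to the right-continuous filtration.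

  The Lipschitz condition compares measures in \<open>P2\<close> only, and it has to be applied at all times of one path.
  This is possible because, outside one null set, \<open>\<mu>\<^sub>s\<close> belongs to \<open>P2\<close> for all \<open>s\<close>
  (\<open>conditional_law_in_P2\<close>).

  The function \<open>S = sup\<^sub>s W\<^sub>2(\<mu>\<^sup>n\<^sub>s, \<mu>\<^sub>s)\<^sup>2\<close> is an uncountable supremum of infima over couplings, and it is
  treated as an arbitrary function, whose \<open>nn_integral\<close> is a lower integral. Lower integrals are subadditive
  if one of the two summands is measurable (\<open>nn_integral_le_add_arbitrary\<close>). All pathwise bounds are therefore
  kept in the form \<open>g + c S\<close> with a measurable function \<open>g\<close> and a constant \<open>c\<close>.
\<close>

abbreviation sqnorm :: "'a measure \<Rightarrow> ('a \<Rightarrow> 'x::real_normed_vector) \<Rightarrow> ennreal" where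
  "sqnorm M f \<equiv> \<integral>\<^sup>+x. ennreal ((norm (f x))\<^sup>2) \<partial>M"

abbreviation energy :: "real \<Rightarrow> real \<Rightarrow> (real \<Rightarrow> 'x::real_normed_vector) \<Rightarrow> ennreal" where
  "energy t u f \<equiv> \<integral>\<^sup>+s\<in>{t..u}. ennreal ((norm (f s))\<^sup>2) \<partial>lborel"

section \<open>Lower integrals and square-integrable functions\<close>

text \<open>For a function that is not measurable, \<open>nn_integral\<close> is a lower integral: the supremum of the integrals
  of the simple functions below it. If a simple function \<open>u\<close> lies below \<open>g + h\<close> and \<open>g\<close> is measurable, then
  the positive part of \<open>u - g\<close> is a measurable function below \<open>h\<close>.\<close>

lemma nn_integral_le_add_arbitrary:
  fixes g h f :: "'a \<Rightarrow> ennreal"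
  assumes g: "g \<in> borel_measurable M" and le: "AE x in M. f x \<le> g x + h x"
  shows "(\<integral>\<^sup>+x. f x \<partial>M) \<le> (\<integral>\<^sup>+x. g x \<partial>M) + (\<integral>\<^sup>+x. h x \<partial>M)"
proof -
  have "(\<integral>\<^sup>+x. f x \<partial>M) \<le> (\<integral>\<^sup>+x. g x + h x \<partial>M)"
    by (rule nn_integral_mono_AE[OF le])
  also have "\<dots> \<le> (\<integral>\<^sup>+x. g x \<partial>M) + (\<integral>\<^sup>+x. h x \<partial>M)"
    unfolding nn_integral_def[of M "\<lambda>x. g x + h x"]
  proof (rule SUP_least, clarify)
    fix u assume u: "simple_function M u" "u \<le> (\<lambda>x. g x + h x)"
    have um[measurable]: "u \<in> borel_measurable M" using u(1) by (rule borel_measurable_simple_function)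
    define d where "d x = (if g x < u x then u x - g x else 0)" for x
    have dm: "d \<in> borel_measurable M" unfolding d_def using g by measurable
    have "integral\<^sup>S M u = (\<integral>\<^sup>+x. u x \<partial>M)" using u(1) by (simp add: nn_integral_eq_simple_integral)
    also have "\<dots> \<le> (\<integral>\<^sup>+x. g x + d x \<partial>M)"
      by (rule nn_integral_mono) (auto simp: d_def add_diff_inverse_ennreal less_imp_le not_less)
    also have "\<dots> = (\<integral>\<^sup>+x. g x \<partial>M) + (\<integral>\<^sup>+x. d x \<partial>M)"
      by (rule nn_integral_add[OF g dm])
    also have "(\<integral>\<^sup>+x. d x \<partial>M) \<le> (\<integral>\<^sup>+x. h x \<partial>M)"
    proof (rule nn_integral_mono)
      fix x show "d x \<le> h x"
      proof (cases "g x < u x")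
        case True
        have "u x \<le> g x + h x" using u(2) by (simp add: le_fun_def)
        then show ?thesis using True by (auto simp: d_def ennreal_minus_le_iff)
      qed (simp add: d_def)
    qed
    finally show "integral\<^sup>S M u \<le> (\<integral>\<^sup>+x. g x \<partial>M) + (\<integral>\<^sup>+x. h x \<partial>M)"
      by (simp add: add_left_mono)
  qed
  finally show ?thesis .
qed

text \<open>Dividing by \<open>c\<close> maps the simple functions below \<open>c h\<close> to simple functions below \<open>h\<close>.\<close>

lemma nn_integral_cmult_le_arbitrary:
  fixes h :: "'a \<Rightarrow> ennreal"
  assumes c: "c > 0"
  shows "(\<integral>\<^sup>+x. ennreal c * h x \<partial>M) \<le> ennreal c * (\<integral>\<^sup>+x. h x \<partial>M)"
  unfolding nn_integral_def[of M "\<lambda>x. ennreal c * h x"]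
proof (rule SUP_least, clarify)
  fix u assume u: "simple_function M u" "u \<le> (\<lambda>x. ennreal c * h x)"
  have um[measurable]: "u \<in> borel_measurable M" using u(1) by (rule borel_measurable_simple_function)
  have inv: "ennreal c * ennreal (1/c) = 1"
    using c by (simp add: ennreal_mult[symmetric])
  have "integral\<^sup>S M u = (\<integral>\<^sup>+x. u x \<partial>M)" using u(1) by (simp add: nn_integral_eq_simple_integral)
  also have "\<dots> = (\<integral>\<^sup>+x. ennreal c * (ennreal (1/c) * u x) \<partial>M)"
    by (simp add: mult.assoc[symmetric] inv)
  also have "\<dots> = ennreal c * (\<integral>\<^sup>+x. ennreal (1/c) * u x \<partial>M)"
    by (intro nn_integral_cmult) measurable
  also have "(\<integral>\<^sup>+x. ennreal (1/c) * u x \<partial>M) \<le> (\<integral>\<^sup>+x. h x \<partial>M)"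
  proof (rule nn_integral_mono)
    fix x
    have "ennreal (1/c) * u x \<le> ennreal (1/c) * (ennreal c * h x)"
      using u(2) by (intro mult_left_mono) (auto simp: le_fun_def)
    also have "\<dots> = (ennreal c * ennreal (1/c)) * h x" by (simp only: mult_ac)
    also have "\<dots> = h x" by (simp only: inv mult_1)
    finally show "ennreal (1/c) * u x \<le> h x" .
  qed
  finally show "integral\<^sup>S M u \<le> ennreal c * (\<integral>\<^sup>+x. h x \<partial>M)" by (simp add: mult_left_mono)
qed

definition square_integrable :: "'a measure \<Rightarrow> ('a \<Rightarrow> 'x::euclidean_space) \<Rightarrow> bool" where
  "square_integrable M f \<longleftrightarrow> f \<in> borel_measurable M \<and> (sqnorm M f) < \<infinity>"

lemma square_integrable_measurable[measurable_dest]: "square_integrable M f \<Longrightarrow> f \<in> borel_measurable M"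
  unfolding square_integrable_def by (rule conjunct1)

lemma square_integrable_iff:
  "square_integrable M f \<longleftrightarrow> f \<in> borel_measurable M \<and> integrable M (\<lambda>x. (norm (f x))\<^sup>2)"
proof -
  have "integrable M (\<lambda>x. (norm (f x))\<^sup>2) \<longleftrightarrow> (sqnorm M f) < \<infinity>"
    if [measurable]: "f \<in> borel_measurable M"
    unfolding integrable_iff_bounded by simp
  then show ?thesis unfolding square_integrable_def by blast
qed

lemma square_integrable_nn_integral:
  assumes "square_integrable M f"
  shows "(sqnorm M f) = ennreal (\<integral>x. (norm (f x))\<^sup>2 \<partial>M)"
  using assms by (intro nn_integral_eq_integral) (auto simp: square_integrable_iff)

lemma norm_add_square_le:
  fixes x y :: "'x::real_normed_vector"
  shows "(norm (x + y))\<^sup>2 \<le> 2 * (norm x)\<^sup>2 + 2 * (norm y)\<^sup>2"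
proof -
  have "(norm (x + y))\<^sup>2 \<le> (norm x + norm y)\<^sup>2" by (intro power_mono norm_triangle_ineq) auto
  also have "\<dots> \<le> 2 * (norm x)\<^sup>2 + 2 * (norm y)\<^sup>2"
    using zero_le_power2[of "norm x - norm y"] by (simp add: power2_eq_square algebra_simps)
  finally show ?thesis .
qed

lemma norm_diff_square_le:
  fixes x y :: "'x::real_normed_vector"
  shows "(norm (x - y))\<^sup>2 \<le> 2 * (norm x)\<^sup>2 + 2 * (norm y)\<^sup>2"
  using norm_add_square_le[of x "-y"] by simp

lemma ennreal_norm_add_square_le:
  fixes x y :: "'x::real_normed_vector"
  shows "ennreal ((norm (x + y))\<^sup>2) \<le> 2 * ennreal ((norm x)\<^sup>2) + 2 * ennreal ((norm y)\<^sup>2)"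
proof -
  have "ennreal ((norm (x + y))\<^sup>2) \<le> ennreal (2 * (norm x)\<^sup>2 + 2 * (norm y)\<^sup>2)"
    by (intro ennreal_leI norm_add_square_le)
  also have "\<dots> = 2 * ennreal ((norm x)\<^sup>2) + 2 * ennreal ((norm y)\<^sup>2)"
    by (simp add: ennreal_mult ennreal_plus)
  finally show ?thesis .
qed

lemma nn_integral_norm_add_square_le:
  fixes f g :: "'a \<Rightarrow> 'x::euclidean_space"
  assumes [measurable]: "f \<in> borel_measurable M" "g \<in> borel_measurable M"
  shows "(sqnorm M (\<lambda>x. f x + g x)) \<le>
     2 * (sqnorm M f) + 2 * (sqnorm M g)"
proof -
  have "(sqnorm M (\<lambda>x. f x + g x)) \<le>
      (\<integral>\<^sup>+x. 2 * ennreal ((norm (f x))\<^sup>2) + 2 * ennreal ((norm (g x))\<^sup>2) \<partial>M)"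
    by (intro nn_integral_mono ennreal_norm_add_square_le)
  also have "\<dots> = 2 * (sqnorm M f) + 2 * (sqnorm M g)"
    by (subst nn_integral_add) (auto simp: nn_integral_cmult)
  finally show ?thesis .
qed

lemma square_integrable_add:
  assumes "square_integrable M f" "square_integrable M g"
  shows "square_integrable M (\<lambda>x. f x + g x)"
  unfolding square_integrable_def
proof
  have m[measurable]: "f \<in> borel_measurable M" "g \<in> borel_measurable M" using assms by (auto simp: square_integrable_def)
  show "(\<lambda>x. f x + g x) \<in> borel_measurable M" by measurable
  show "(sqnorm M (\<lambda>x. f x + g x)) < \<infinity>"
    using assms
    by (intro order.strict_trans1[OF nn_integral_norm_add_square_le[OF m]])
      (auto simp: square_integrable_def ennreal_mult_less_top)
qed

lemma square_integrable_uminus: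
  assumes "square_integrable M f"
  shows "square_integrable M (\<lambda>x. - f x)"
  using assms by (auto simp: square_integrable_def)

lemma square_integrable_diff:
  assumes "square_integrable M f" "square_integrable M g"
  shows "square_integrable M (\<lambda>x. f x - g x)"
  using square_integrable_add[OF assms(1) square_integrable_uminus[OF assms(2)]] by simp

lemma integrable_norm_mult:
  assumes "square_integrable M f" "square_integrable M g"
  shows "integrable M (\<lambda>x. norm (f x) * norm (g x))"
proof (rule Bochner_Integration.integrable_bound[where f="\<lambda>x. (norm (f x))\<^sup>2 + (norm (g x))\<^sup>2"])
  show "integrable M (\<lambda>x. (norm (f x))\<^sup>2 + (norm (g x))\<^sup>2)"
    using assms by (auto simp: square_integrable_iff)
  have [measurable]: "f \<in> borel_measurable M" "g \<in> borel_measurable M" using assms by auto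
  show "(\<lambda>x. norm (f x) * norm (g x)) \<in> borel_measurable M" by measurable
  have "\<bar>a * b\<bar> \<le> a\<^sup>2 + b\<^sup>2" if "a \<ge> 0" "b \<ge> 0" for a b :: real
    proof -
    have "0 \<le> a * b" using that by simp
    then show ?thesis using sum_squares_bound[of a b] by linarith
  qed
  then show "AE x in M. norm (norm (f x) * norm (g x)) \<le> norm ((norm (f x))\<^sup>2 + (norm (g x))\<^sup>2)"
    by auto
qed

lemma square_integrable_inner_integrable:
  assumes "square_integrable M f" "square_integrable M g"
  shows "integrable M (\<lambda>x. f x \<bullet> g x)"
proof (rule Bochner_Integration.integrable_bound[OF integrable_norm_mult[OF assms]])
  have [measurable]: "f \<in> borel_measurable M" "g \<in> borel_measurable M" using assms by auto
  show "(\<lambda>x. f x \<bullet> g x) \<in> borel_measurable M" by measurable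
  show "AE x in M. norm (f x \<bullet> g x) \<le> norm (norm (f x) * norm (g x))"
    by (auto simp: Cauchy_Schwarz_ineq2)
qed

text \<open>The Cauchy-Schwarz inequality, from the sign of the discriminant of the nonnegative polynomial
  \<open>t \<mapsto> \<integral> (t |f| - |g|)\<^sup>2\<close>.\<close>

lemma integral_norm_mult_le:
  assumes f: "square_integrable M f" and g: "square_integrable M g"
  shows "(\<integral>x. norm (f x) * norm (g x) \<partial>M) \<le> sqrt (\<integral>x. (norm (f x))\<^sup>2 \<partial>M) * sqrt (\<integral>x. (norm (g x))\<^sup>2 \<partial>M)"
proof -
  define a b c where "a = (\<integral>x. (norm (f x))\<^sup>2 \<partial>M)" and "b = (\<integral>x. (norm (g x))\<^sup>2 \<partial>M)"
    and "c = (\<integral>x. norm (f x) * norm (g x) \<partial>M)"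
  have nn: "a \<ge> 0" "b \<ge> 0" "c \<ge> 0" by (auto simp: a_def b_def c_def)
  have q: "0 \<le> t\<^sup>2 * a - 2 * t * c + b" for t
  proof -
    have i: "integrable M (\<lambda>x. (norm (f x))\<^sup>2)" "integrable M (\<lambda>x. (norm (g x))\<^sup>2)"
      using f g by (auto simp: square_integrable_iff)
    have "0 \<le> (\<integral>x. (t * norm (f x) - norm (g x))\<^sup>2 \<partial>M)" by simp
    also have "\<dots> = (\<integral>x. t\<^sup>2 * (norm (f x))\<^sup>2 - 2 * t * (norm (f x) * norm (g x)) + (norm (g x))\<^sup>2 \<partial>M)"
      by (intro Bochner_Integration.integral_cong) (auto simp: power2_eq_square algebra_simps)
    also have "\<dots> = t\<^sup>2 * a - 2 * t * c + b"
      unfolding a_def b_def c_def using i integrable_norm_mult[OF f g] by simp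
    finally show ?thesis .
  qed
  have "c\<^sup>2 \<le> a * b"
  proof (cases "a = 0")
    case True
    have "c = 0"
    proof (rule ccontr)
      assume "c \<noteq> 0"
      (* The polynomial is affine in t here, and at t = (b + 1) / c it would be negative. *)
      then have "0 \<le> b - 2 * ((b + 1) / c) * c" using q[of "(b+1)/c"] True by simp
      then show False using \<open>c \<noteq> 0\<close> nn by simp
    qed
    then show ?thesis using True by simp
  next
    case False
    then have "a > 0" using nn by simp
    (* The polynomial attains its minimum at t = c / a. *)
    have "0 \<le> (c/a)\<^sup>2 * a - 2 * (c/a) * c + b" by (rule q)
    also have "\<dots> = b - c\<^sup>2 / a" using \<open>a > 0\<close> by (simp add: power2_eq_square field_simps)
    finally show ?thesis using \<open>a > 0\<close> by (simp add: field_simps)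
  qed
  then have "c \<le> sqrt (a * b)" by (simp add: real_le_rsqrt)
  then show ?thesis by (simp add: a_def b_def c_def real_sqrt_mult)
qed

definition l2_tendsto :: "'a measure \<Rightarrow> (nat \<Rightarrow> 'a \<Rightarrow> 'x::euclidean_space) \<Rightarrow> ('a \<Rightarrow> 'x) \<Rightarrow> bool" where
  "l2_tendsto M f g \<longleftrightarrow> (\<lambda>l. \<integral>\<^sup>+x. ennreal ((norm (f l x - g x))\<^sup>2) \<partial>M) \<longlonglongrightarrow> 0"

lemma l2_tendsto_integral:
  assumes "l2_tendsto M f g" and "\<And>l. square_integrable M (f l)" "square_integrable M g"
  shows "(\<lambda>l. \<integral>x. (norm (f l x - g x))\<^sup>2 \<partial>M) \<longlonglongrightarrow> 0"
proof -
  have "square_integrable M (\<lambda>x. f l x - g x)" for l using assms by (intro square_integrable_diff)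
  from square_integrable_nn_integral[OF this]
  have "(\<lambda>l. ennreal (\<integral>x. (norm (f l x - g x))\<^sup>2 \<partial>M)) \<longlonglongrightarrow> ennreal 0"
    using assms(1) by (simp add: l2_tendsto_def)
  then show ?thesis by (rule tendsto_ennrealD) (auto)
qed

text \<open>Expanding around the limits leaves three products, each with a factor tending to \<open>0\<close> in \<open>L\<^sup>2\<close>. This is
  the continuity that carries isometries and orthogonality relations over to limits.\<close>

lemma l2_tendsto_inner:
  assumes f: "l2_tendsto M f f'" "\<And>l. square_integrable M (f l)" "square_integrable M f'"
    and g: "l2_tendsto M g g'" "\<And>l. square_integrable M (g l)" "square_integrable M g'"
  shows "(\<lambda>l. \<integral>x. f l x \<bullet> g l x \<partial>M) \<longlonglongrightarrow> (\<integral>x. f' x \<bullet> g' x \<partial>M)"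
proof -
  define n where "n h = sqrt (\<integral>x. (norm (h x))\<^sup>2 \<partial>M)" for h :: "'a \<Rightarrow> 'b"
  let ?df = "\<lambda>l x. f l x - f' x" and ?dg = "\<lambda>l x. g l x - g' x"
  have df: "square_integrable M (?df l)" and dg: "square_integrable M (?dg l)" for l
    using f g by (auto intro: square_integrable_diff)
  have nf: "(\<lambda>l. n (?df l)) \<longlonglongrightarrow> 0"
    unfolding n_def using tendsto_real_sqrt[OF l2_tendsto_integral[OF f]] by simp
  have ng: "(\<lambda>l. n (?dg l)) \<longlonglongrightarrow> 0"
    unfolding n_def using tendsto_real_sqrt[OF l2_tendsto_integral[OF g]] by simp
  have b: "\<bar>\<integral>x. u x \<bullet> v x \<partial>M\<bar> \<le> n u * n v" if "square_integrable M u" "square_integrable M v" for u v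
  proof -
    have "\<bar>\<integral>x. u x \<bullet> v x \<partial>M\<bar> \<le> (\<integral>x. \<bar>u x \<bullet> v x\<bar> \<partial>M)" by (rule integral_abs_bound)
    also have "\<dots> \<le> (\<integral>x. norm (u x) * norm (v x) \<partial>M)"
      using that by (intro integral_mono integrable_abs square_integrable_inner_integrable integrable_norm_mult Cauchy_Schwarz_ineq2)
    also have "\<dots> \<le> n u * n v" unfolding n_def by (rule integral_norm_mult_le[OF that])
    finally show ?thesis .
  qed
  have "norm ((\<integral>x. f l x \<bullet> g l x \<partial>M) - (\<integral>x. f' x \<bullet> g' x \<partial>M)) \<le>
      n (?df l) * n (?dg l) + n (?df l) * n g' + n f' * n (?dg l)" for l
  proof -
    have "(\<integral>x. f l x \<bullet> g l x \<partial>M) - (\<integral>x. f' x \<bullet> g' x \<partial>M) = (\<integral>x. f l x \<bullet> g l x - f' x \<bullet> g' x \<partial>M)"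
      using f g by (intro Bochner_Integration.integral_diff[symmetric] square_integrable_inner_integrable)
    also have "\<dots> = (\<integral>x. ?df l x \<bullet> ?dg l x + ?df l x \<bullet> g' x + f' x \<bullet> ?dg l x \<partial>M)"
      by (intro Bochner_Integration.integral_cong) (auto simp: algebra_simps)
    also have "\<dots> = (\<integral>x. ?df l x \<bullet> ?dg l x \<partial>M) + (\<integral>x. ?df l x \<bullet> g' x \<partial>M) + (\<integral>x. f' x \<bullet> ?dg l x \<partial>M)"
    proof -
      have "integrable M (\<lambda>x. ?df l x \<bullet> ?dg l x)" "integrable M (\<lambda>x. ?df l x \<bullet> g' x)" "integrable M (\<lambda>x. f' x \<bullet> ?dg l x)"
        by (rule square_integrable_inner_integrable df dg f(3) g(3))+
      then show ?thesis
        by (simp only: Bochner_Integration.integral_add Bochner_Integration.integrable_add)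
    qed
    finally show ?thesis
      using b[OF df[of l] dg[of l]] b[OF df[of l] g(3)] b[OF f(3) dg[of l]] by simp
  qed
  note bound = this
  have lim: "(\<lambda>l. n (?df l) * n (?dg l) + n (?df l) * n g' + n f' * n (?dg l)) \<longlonglongrightarrow> 0 * 0 + 0 * n g' + n f' * 0"
    by (intro tendsto_intros nf ng)
  then have lim: "(\<lambda>l. n (?df l) * n (?dg l) + n (?df l) * n g' + n f' * n (?dg l)) \<longlonglongrightarrow> 0"
    by (simp only: mult_zero_left mult_zero_right add_0)
  have "(\<lambda>l. (\<integral>x. f l x \<bullet> g l x \<partial>M) - (\<integral>x. f' x \<bullet> g' x \<partial>M)) \<longlonglongrightarrow> 0"
    by (rule Lim_null_comparison[OF always_eventually lim]) (rule allI, rule bound)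
  then show ?thesis by (simp add: LIM_zero_iff)
qed

lemma l2_tendsto_const: "l2_tendsto M (\<lambda>_. f) f"
  by (simp add: l2_tendsto_def)

lemma l2_tendsto_add:
  assumes f: "l2_tendsto M f f'" and g: "l2_tendsto M g g'"
    and [measurable]: "\<And>l. f l \<in> borel_measurable M" "f' \<in> borel_measurable M"
      "\<And>l. g l \<in> borel_measurable M" "g' \<in> borel_measurable M"
  shows "l2_tendsto M (\<lambda>l x. f l x + g l x) (\<lambda>x. f' x + g' x)"
  unfolding l2_tendsto_def
proof (rule tendsto_sandwich[OF _ _ tendsto_const])
  let ?F = "\<lambda>l. \<integral>\<^sup>+x. ennreal ((norm (f l x - f' x))\<^sup>2) \<partial>M"
  let ?G = "\<lambda>l. \<integral>\<^sup>+x. ennreal ((norm (g l x - g' x))\<^sup>2) \<partial>M"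
  have "(\<lambda>l. 2 * ?F l + 2 * ?G l) \<longlonglongrightarrow> 2 * 0 + 2 * 0"
    using f g unfolding l2_tendsto_def by (intro tendsto_add ennreal_tendsto_cmult) auto
  then show "(\<lambda>l. 2 * ?F l + 2 * ?G l) \<longlonglongrightarrow> 0" by simp
  have eq: "f l x + g l x - (f' x + g' x) = (f l x - f' x) + (g l x - g' x)" for l x by simp
  show "\<forall>\<^sub>F l in sequentially. (sqnorm M (\<lambda>x. f l x + g l x - (f' x + g' x))) \<le> 2 * ?F l + 2 * ?G l"
    unfolding eq by (intro always_eventually allI nn_integral_norm_add_square_le) auto
qed auto

lemma l2_tendsto_uminus:
  assumes "l2_tendsto M f f'"
  shows "l2_tendsto M (\<lambda>l x. - f l x) (\<lambda>x. - f' x)"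
proof -
  have "norm (- f l x - - f' x) = norm (f l x - f' x)" for l x
    by (metis minus_diff_minus norm_minus_cancel)
  then show ?thesis using assms by (simp add: l2_tendsto_def)
qed

lemma l2_tendsto_diff:
  assumes f: "l2_tendsto M f f'" and g: "l2_tendsto M g g'"
    and "\<And>l. f l \<in> borel_measurable M" "f' \<in> borel_measurable M"
      "\<And>l. g l \<in> borel_measurable M" "g' \<in> borel_measurable M"
  shows "l2_tendsto M (\<lambda>l x. f l x - g l x) (\<lambda>x. f' x - g' x)"
  using l2_tendsto_add[OF f l2_tendsto_uminus[OF g]] assms(3-6) by simp

section \<open>Brownian increments and the past of a single motion\<close>

text \<open>Lebesgue measure on \<open>real^'d\<close> is the image of the product measure indexed by \<open>Basis\<close>; the axes identify
  this index set with \<open>'d\<close>, and the integral of a product function over a product measure factorises.\<close>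

lemma lborel_vec_prod:
  fixes h :: "'d::finite \<Rightarrow> real \<Rightarrow> real"
  assumes h: "\<And>k. integrable lborel (h k)"
  shows "has_bochner_integral lborel (\<lambda>x::real^'d. \<Prod>k\<in>UNIV. h k (x $ k)) (\<Prod>k\<in>UNIV. integral\<^sup>L lborel (h k))"
proof -
  interpret product_sigma_finite "\<lambda>_::real^'d. lborel :: real measure" ..
  define g where "g b = h (axis_index b)" for b :: "real^'d"
  have inj: "inj (\<lambda>k::'d. axis k (1::real))" by (auto simp: inj_on_def axis_eq_axis)
  have B: "(Basis :: (real^'d) set) = range (\<lambda>k. axis k 1)" by (auto simp: Basis_vec_def)
  have re: "(\<Prod>b\<in>Basis. F b) = (\<Prod>k\<in>UNIV. F (axis k 1))" for F :: "real^'d \<Rightarrow> real"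
    unfolding B by (subst prod.reindex[OF inj]) simp
  have gi: "integrable lborel (g b)" for b unfolding g_def by (rule h)
  have gm[measurable]: "g b \<in> borel_measurable borel" for b
    using borel_measurable_integrable[OF gi[of b]] by simp
  let ?F = "\<lambda>x::real^'d. \<Prod>k\<in>UNIV. h k (x $ k)"
  have F: "?F x = (\<Prod>b\<in>Basis. g b (x \<bullet> b))" for x
    by (simp add: re g_def inner_axis)
  let ?T = "\<lambda>f. \<Sum>b\<in>Basis. f b *\<^sub>R (b::real^'d)"
  have T: "?T \<in> measurable (\<Pi>\<^sub>M b\<in>Basis. lborel) borel" by measurable
  have Fm: "?F \<in> borel_measurable borel" unfolding F by measurable
  have FT: "?F (?T f) = (\<Prod>b\<in>Basis. g b (f b))" for f
    unfolding F by (intro prod.cong refl) simp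
  have int: "integrable (\<Pi>\<^sub>M b\<in>(Basis::(real^'d) set). lborel) (\<lambda>f. \<Prod>b\<in>Basis. g b (f b))"
    by (intro product_integrable_prod gi) simp
  have "integrable lborel ?F"
    unfolding lborel_eq[where 'a="real^'d"] using int
    by (subst integrable_distr_eq[OF T]) (simp_all only: FT, use Fm in simp)
  moreover have "integral\<^sup>L lborel ?F = (\<integral>f. (\<Prod>b\<in>Basis. g b (f b)) \<partial>(\<Pi>\<^sub>M b\<in>(Basis::(real^'d) set). lborel))"
    unfolding lborel_eq[where 'a="real^'d"]
    by (subst integral_distr[OF T]) (simp_all only: FT, use Fm in simp)
  moreover have "\<dots> = (\<Prod>b\<in>Basis. integral\<^sup>L lborel (g b))"
    by (intro product_integral_prod gi) simp
  moreover have "\<dots> = (\<Prod>k\<in>UNIV. integral\<^sup>L lborel (h k))"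
    unfolding re by (simp add: g_def)
  ultimately show ?thesis by (simp add: has_bochner_integral_iff)
qed

text \<open>With exponents \<open>0\<close>, \<open>1\<close> and \<open>2\<close> a coordinate and a product of two coordinates become products of powers over
  all coordinates, so that both moments are products of one-dimensional Gaussian moments.\<close>

lemma gaussian_vector_moments:
  fixes X :: "'w \<Rightarrow> real^'d"
  assumes D: "distributed M lborel X (\<lambda>x. ennreal (\<Prod>j\<in>UNIV. normal_density 0 \<sigma> (x $ j)))" and s: "\<sigma> > 0"
  shows "integrable M (\<lambda>\<omega>. X \<omega> $ i)" (is ?g1) "(\<integral>\<omega>. X \<omega> $ i \<partial>M) = 0" (is ?g2)
    and "integrable M (\<lambda>\<omega>. X \<omega> $ i * X \<omega> $ j)" (is ?g3) "(\<integral>\<omega>. X \<omega> $ i * X \<omega> $ j \<partial>M) = of_bool (i = j) * \<sigma>\<^sup>2" (is ?g4)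
proof -
  let ?n = "normal_density 0 \<sigma>"
  have i: "integrable lborel (\<lambda>x. ?n x * x ^ k)" for k
    using integrable_normal_moment[OF s, of 0 k] by simp
  have m0: "integral\<^sup>L lborel ?n = 1" using s by simp
  have m1: "(\<integral>x. ?n x * x \<partial>lborel) = 0" using integral_normal_moment_nz_1[OF s, of 0] .
  have m2: "(\<integral>x. ?n x * x\<^sup>2 \<partial>lborel) = \<sigma>\<^sup>2" using integral_normal_moment_even[OF s, of 0 1] s
    by (simp add: fact_numeral)
  have nn: "0 \<le> (\<Prod>j\<in>UNIV. ?n (x $ j))" for x :: "real^'d"
    using s by (intro prod_nonneg) simp
  have key: "has_bochner_integral lborel (\<lambda>x::real^'d. (\<Prod>k\<in>UNIV. ?n (x $ k)) * (\<Prod>k\<in>UNIV. (x $ k) ^ p k))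
      (\<Prod>k\<in>UNIV. \<integral>x. ?n x * x ^ p k \<partial>lborel)" for p :: "'d \<Rightarrow> nat"
    using lborel_vec_prod[of "\<lambda>k x. ?n x * x ^ p k"] i by (simp add: prod.distrib)
  have one: "(\<Prod>k\<in>UNIV. (x $ k) ^ of_bool (k = i)) = x $ i" for x :: "real^'d" and i
  proof -
    have "(\<Prod>k\<in>UNIV. (x $ k) ^ of_bool (k = i)) = (\<Prod>k\<in>UNIV. if k = i then x $ k else 1)"
      by (intro prod.cong) auto
    then show ?thesis by simp
  qed
  have two: "(\<Prod>k\<in>UNIV. (x $ k) ^ (of_bool (k = i) + of_bool (k = j))) = x $ i * x $ j" for x :: "real^'d"
    by (simp add: power_add prod.distrib one)
  have k1: "has_bochner_integral lborel (\<lambda>x::real^'d. (\<Prod>k\<in>UNIV. ?n (x $ k)) * x $ i) 0"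
  proof -
    have "(\<Prod>k\<in>UNIV. \<integral>x. ?n x * x ^ of_bool (k = i) \<partial>lborel) = 0"
      by (rule prod_zero) (auto intro!: bexI[of _ i] simp: m1)
    then show ?thesis using key[of "\<lambda>k. of_bool (k = i)"] by (simp only: one)
  qed
  have k2: "has_bochner_integral lborel (\<lambda>x::real^'d. (\<Prod>k\<in>UNIV. ?n (x $ k)) * (x $ i * x $ j)) (of_bool (i = j) * \<sigma>\<^sup>2)"
  proof -
    have "(\<Prod>k\<in>UNIV. \<integral>x. ?n x * x ^ (of_bool (k = i) + of_bool (k = j)) \<partial>lborel) = of_bool (i = j) * \<sigma>\<^sup>2"
    proof (cases "i = j")
      case True
      have "(\<Prod>k\<in>UNIV. \<integral>x. ?n x * x ^ (of_bool (k = i) + of_bool (k = j)) \<partial>lborel) = (\<Prod>k\<in>UNIV. if k = i then \<sigma>\<^sup>2 else 1)"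
        using True m0 m2 by (intro prod.cong) (auto simp: numeral_2_eq_2)
      then show ?thesis using True by simp
    next
      case False
      then have "(\<Prod>k\<in>UNIV. \<integral>x. ?n x * x ^ (of_bool (k = i) + of_bool (k = j)) \<partial>lborel) = 0"
        by (intro prod_zero) (auto intro!: bexI[of _ i] simp: m1)
      then show ?thesis using False by simp
    qed
    then show ?thesis using key[of "\<lambda>k. of_bool (k = i) + of_bool (k = j)"] by (simp only: two)
  qed
  show ?g1
    using k1 by (subst distributed_integrable[OF D, symmetric]) (auto simp: nn has_bochner_integral_iff)
  show ?g2
    using k1 by (subst distributed_integral[OF D, symmetric]) (auto simp: nn has_bochner_integral_iff)
  show ?g3
    using k2 by (subst distributed_integrable[OF D, of "\<lambda>x. x $ i * x $ j", symmetric]) (auto simp: nn has_bochner_integral_iff)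
  show ?g4
    using k2 by (subst distributed_integral[OF D, of "\<lambda>x. x $ i * x $ j", symmetric]) (auto simp: nn has_bochner_integral_iff)
qed

lemma brownian_measurable:
  "brownian_motion M T B \<Longrightarrow> 0 \<le> t \<Longrightarrow> t \<le> T \<Longrightarrow> B t \<in> borel_measurable M"
  by (simp add: brownian_motion_def)

lemma brownian_moments:
  fixes B :: "real \<Rightarrow> 'w \<Rightarrow> real^'d"
  assumes B: "brownian_motion M T B" and st: "0 \<le> s" "s \<le> t" "t \<le> T"
  shows "integrable M (\<lambda>\<omega>. (B t \<omega> - B s \<omega>) $ i)" (is ?g1) "(\<integral>\<omega>. (B t \<omega> - B s \<omega>) $ i \<partial>M) = 0" (is ?g2)
    and "integrable M (\<lambda>\<omega>. (B t \<omega> - B s \<omega>) $ i * (B t \<omega> - B s \<omega>) $ j)" (is ?g3)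
      "(\<integral>\<omega>. (B t \<omega> - B s \<omega>) $ i * (B t \<omega> - B s \<omega>) $ j \<partial>M) = of_bool (i = j) * (t - s)" (is ?g4)
proof -
  have D: "distributed M lborel (\<lambda>\<omega>. B t \<omega> - B s \<omega>) (\<lambda>x. ennreal (\<Prod>j\<in>UNIV. normal_density 0 (sqrt (t - s)) (x $ j)))" if "s < t"
    using B st that by (simp add: brownian_motion_def)
  show ?g1
    using gaussian_vector_moments(1)[OF D] by (cases "s < t") (use st in auto)
  show ?g2
    using gaussian_vector_moments(2)[OF D] by (cases "s < t") (use st in auto)
  show ?g3
    using gaussian_vector_moments(3)[OF D] by (cases "s < t") (use st in auto)
  show ?g4
    using gaussian_vector_moments(4)[OF D] by (cases "s < t") (use st in auto)
qed

text \<open>The times \<open>0\<close>, those in \<open>S\<close> and \<open>a\<close> form a partition, extended by \<open>b\<close>. The values at the times in \<open>S\<close> are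
  sums of increments over the partition before \<open>a\<close>, and these are independent of the increment from \<open>a\<close>
  to \<open>b\<close>.\<close>

lemma brownian_past_independent:
  fixes B :: "real \<Rightarrow> 'w \<Rightarrow> real^'d" and g :: "real^'d \<Rightarrow> real"
  assumes "prob_space M" and B: "brownian_motion M T B" and ab: "0 \<le> a" "a \<le> b" "b \<le> T"
    and S: "finite S" "S \<subseteq> {0..a}" and A: "\<And>s. s \<in> S \<Longrightarrow> A s \<in> sets borel"
    and g[measurable]: "g \<in> borel_measurable borel" and gi: "integrable M (\<lambda>\<omega>. g (B b \<omega> - B a \<omega>))"
  shows "(\<integral>\<omega>. indicator {\<omega>. \<forall>s\<in>S. B s \<omega> \<in> A s} \<omega> * g (B b \<omega> - B a \<omega>) \<partial>M) =
    (\<integral>\<omega>. indicator {\<omega>. \<forall>s\<in>S. B s \<omega> \<in> A s} \<omega> \<partial>M) * (\<integral>\<omega>. g (B b \<omega> - B a \<omega>) \<partial>M)"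
proof -
  interpret prob_space M by fact
  define xs where "xs = sorted_list_of_set (insert 0 (insert a S))"
  have fin: "finite (insert 0 (insert a S))" using S by simp
  have set_xs: "set xs = insert 0 (insert a S)" unfolding xs_def using fin by (rule set_sorted_list_of_set)
  have sorted: "sorted xs" "distinct xs" unfolding xs_def by auto
  define n where "n = length xs"
  have n0: "n > 0" using set_xs unfolding n_def by (cases xs) auto
  have xs0: "xs ! 0 = 0"
  proof -
    obtain j where j: "j < n" "xs ! j = 0" using set_xs unfolding n_def by (metis in_set_conv_nth insertI1)
    have "xs ! 0 \<le> xs ! j" using sorted j unfolding n_def by (intro sorted_nth_mono) auto
    moreover have "xs ! 0 \<in> insert 0 (insert a S)" using n0 unfolding set_xs[symmetric] n_def by simp
    ultimately show ?thesis using j S ab by force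
  qed
  have xsn: "xs ! (n - 1) = a"
  proof -
    obtain j where j: "j < n" "xs ! j = a" using set_xs unfolding n_def by (metis in_set_conv_nth insertI1 insertI2)
    have "xs ! j \<le> xs ! (n - 1)" using sorted j unfolding n_def by (intro sorted_nth_mono) auto
    moreover have "xs ! (n - 1) \<in> insert 0 (insert a S)" using n0 unfolding set_xs[symmetric] n_def by simp
    ultimately show ?thesis using j S ab by force
  qed
  (* The last interval of the partition, with index n - 1, is the one from a to b. *)
  define \<tau> where "\<tau> j = (if j < n then xs ! j else b)" for j
  have tau_mono: "\<tau> j \<le> \<tau> (Suc j)" if "j < n" for j
  proof (cases "Suc j < n")
    case True then show ?thesis using sorted unfolding \<tau>_def n_def by (auto intro: sorted_nth_mono)
  next
    case False
    then have "j = n - 1" using that by simp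
    then show ?thesis using False that xsn ab by (simp add: \<tau>_def)
  qed
  have tau_n: "\<tau> n = b" by (simp add: \<tau>_def)
  have tau0: "\<tau> 0 = 0" using n0 xs0 by (simp add: \<tau>_def)
  define X where "X j \<omega> = B (\<tau> (Suc j)) \<omega> - B (\<tau> j) \<omega>" for j \<omega>
  have ind: "indep_vars (\<lambda>_. borel) X {..<n}"
    using B tau_mono tau_n tau0 ab unfolding brownian_motion_def X_def by auto
  (* The position of the time s in the partition. *)
  define p where "p s = (SOME j. j < n \<and> xs ! j = s)" for s
  have p: "p s < n" "xs ! p s = s" if "s \<in> S" for s
  proof -
    have "\<exists>j. j < n \<and> xs ! j = s" using that set_xs unfolding n_def by (metis in_set_conv_nth insertI2)
    from someI_ex[OF this] show "p s < n" "xs ! p s = s" unfolding p_def by auto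
  qed
  have Bs: "AE \<omega> in M. \<forall>s\<in>S. B s \<omega> = (\<Sum>j<p s. X j \<omega>)"
  proof -
    have "AE \<omega> in M. B 0 \<omega> = 0" using B by (simp add: brownian_motion_def)
    then show ?thesis
    proof (rule AE_mp, intro AE_I2 impI ballI)
      fix \<omega> s assume z: "B 0 \<omega> = 0" and s: "s \<in> S"
      have "(\<Sum>j<p s. X j \<omega>) = B (\<tau> (p s)) \<omega> - B (\<tau> 0) \<omega>"
        unfolding X_def by (rule sum_lessThan_telescope)
      then show "B s \<omega> = (\<Sum>j<p s. X j \<omega>)" using z p[OF s] by (simp add: \<tau>_def xs0)
    qed
  qed
  let ?I = "{..<n - 1}" and ?J = "{n - 1}"
  let ?P1 = "PiM ?I (\<lambda>_. borel :: (real^'d) measure)" and ?P2 = "PiM ?J (\<lambda>_. borel :: (real^'d) measure)"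
  define \<phi> where "\<phi> x = (indicator {x. \<forall>s\<in>S. (\<Sum>j<p s. x j) \<in> A s} x :: real)" for x :: "nat \<Rightarrow> real^'d"
  define \<psi> where "\<psi> x = g (x (n - 1))" for x :: "nat \<Rightarrow> real^'d"
  have iv: "indep_var ?P1 (\<lambda>\<omega>. restrict (\<lambda>i. X i \<omega>) ?I) ?P2 (\<lambda>\<omega>. restrict (\<lambda>i. X i \<omega>) ?J)"
    using n0 by (intro indep_var_restrict[OF ind]) auto
  have sub: "j \<in> ?I" if "s \<in> S" "j < p s" for s j using p[OF that(1)] that(2) by auto
  have \<phi>m: "\<phi> \<in> borel_measurable ?P1"
  proof -
    have "(\<lambda>x. \<Sum>j<p s. x j) \<in> measurable ?P1 borel" if "s \<in> S" for s
      by (intro borel_measurable_sum measurable_component_singleton sub[OF that]) simp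
    then have "{x \<in> space ?P1. (\<Sum>j<p s. x j) \<in> A s} \<in> sets ?P1" if "s \<in> S" for s
      using A[OF that] that by (auto intro: measurable_sets[unfolded vimage_def Int_def, simplified conj_commute] simp: Collect_conj_eq)
    then have "{x \<in> space ?P1. \<forall>s\<in>S. (\<Sum>j<p s. x j) \<in> A s} \<in> sets ?P1"
      using S by (intro sets.sets_Collect_finite_All) auto
    then have "(\<lambda>x. indicator {x \<in> space ?P1. \<forall>s\<in>S. (\<Sum>j<p s. x j) \<in> A s} x :: real) \<in> borel_measurable ?P1"
      by (rule borel_measurable_indicator)
    then show ?thesis
      by (rule measurable_cong[THEN iffD1, rotated]) (auto simp: \<phi>_def indicator_def)
  qed
  have \<psi>m: "\<psi> \<in> borel_measurable ?P2" unfolding \<psi>_def by measurable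
  have iv2: "indep_var borel (\<lambda>\<omega>. \<phi> (restrict (\<lambda>i. X i \<omega>) ?I)) borel (\<lambda>\<omega>. \<psi> (restrict (\<lambda>i. X i \<omega>) ?J))"
    using indep_var_compose[OF iv \<phi>m \<psi>m] by (simp add: comp_def)
  have \<psi>e: "\<psi> (restrict (\<lambda>i. X i \<omega>) ?J) = g (B b \<omega> - B a \<omega>)" for \<omega>
    using n0 xsn by (simp add: \<psi>_def X_def \<tau>_def)
  have \<phi>e: "\<phi> (restrict (\<lambda>i. X i \<omega>) ?I) = indicator {\<omega>. \<forall>s\<in>S. (\<Sum>j<p s. X j \<omega>) \<in> A s} \<omega>" for \<omega>
  proof -
    have "(\<Sum>j<p s. restrict (\<lambda>i. X i \<omega>) ?I j) = (\<Sum>j<p s. X j \<omega>)" if "s \<in> S" for s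
      using sub[OF that] by (intro sum.cong refl) (metis lessThan_iff restrict_apply')
    then show ?thesis by (simp add: \<phi>_def indicator_def)
  qed
  have \<phi>i: "integrable M (\<lambda>\<omega>. \<phi> (restrict (\<lambda>i. X i \<omega>) ?I))"
    using indep_var_rv1[OF iv2] by (intro integrable_const_bound[where B=1]) (auto simp: \<phi>_def indicator_def)
  have ev: "AE \<omega> in M. \<phi> (restrict (\<lambda>i. X i \<omega>) ?I) = (indicator {\<omega>. \<forall>s\<in>S. B s \<omega> \<in> A s} \<omega> :: real)"
    unfolding \<phi>e using Bs by eventually_elim (auto simp: indicator_def)
  have Em[measurable]: "(\<lambda>\<omega>. indicator {\<omega>. \<forall>s\<in>S. B s \<omega> \<in> A s} \<omega> :: real) \<in> borel_measurable M"
  proof -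
    have "{\<omega> \<in> space M. B s \<omega> \<in> A s} \<in> sets M" if "s \<in> S" for s
      using measurable_sets[OF brownian_measurable[OF B, of s] A[OF that]] S ab that
      by (auto simp: vimage_def Int_def conj_commute)
    then have "{\<omega> \<in> space M. \<forall>s\<in>S. B s \<omega> \<in> A s} \<in> sets M"
      using S by (intro sets.sets_Collect_finite_All) auto
    from borel_measurable_indicator[OF this] show ?thesis
      by (rule measurable_cong[THEN iffD1, rotated]) (auto simp: indicator_def)
  qed
  have m1: "(\<lambda>\<omega>. \<phi> (restrict (\<lambda>i. X i \<omega>) ?I)) \<in> borel_measurable M" using \<phi>i by auto
  have m3: "(\<lambda>\<omega>. g (B b \<omega> - B a \<omega>)) \<in> borel_measurable M" using gi by auto
  have "(\<integral>\<omega>. indicator {\<omega>. \<forall>s\<in>S. B s \<omega> \<in> A s} \<omega> * g (B b \<omega> - B a \<omega>) \<partial>M)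
     = (\<integral>\<omega>. \<phi> (restrict (\<lambda>i. X i \<omega>) ?I) * \<psi> (restrict (\<lambda>i. X i \<omega>) ?J) \<partial>M)"
    unfolding \<psi>e
    by (rule integral_cong_AE[OF borel_measurable_times[OF Em m3] borel_measurable_times[OF m1 m3]])
      (use ev in \<open>eventually_elim, simp only:\<close>)
  also have "\<dots> = (\<integral>\<omega>. \<phi> (restrict (\<lambda>i. X i \<omega>) ?I) \<partial>M) * (\<integral>\<omega>. \<psi> (restrict (\<lambda>i. X i \<omega>) ?J) \<partial>M)"
    by (rule indep_var_lebesgue_integral[OF iv2 \<phi>i]) (simp only: \<psi>e gi)
  also have "(\<integral>\<omega>. \<phi> (restrict (\<lambda>i. X i \<omega>) ?I) \<partial>M) = (\<integral>\<omega>. indicator {\<omega>. \<forall>s\<in>S. B s \<omega> \<in> A s} \<omega> \<partial>M)"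
    by (rule integral_cong_AE[OF m1 Em ev])
  finally show ?thesis by (simp only: \<psi>e)
qed

section \<open>Brownian increments given the augmented filtration\<close>

lemma pair_integral_mult:
  fixes f :: "'a \<Rightarrow> real" and g :: "'b \<Rightarrow> real"
  assumes "sigma_finite_measure M1" "sigma_finite_measure M2" and f: "integrable M1 f" and g: "integrable M2 g"
  shows "integrable (M1 \<Otimes>\<^sub>M M2) (\<lambda>\<omega>. f (fst \<omega>) * g (snd \<omega>))"
    and "(\<integral>\<omega>. f (fst \<omega>) * g (snd \<omega>) \<partial>(M1 \<Otimes>\<^sub>M M2)) = (\<integral>x. f x \<partial>M1) * (\<integral>y. g y \<partial>M2)"
proof -
  interpret M1: sigma_finite_measure M1 by fact
  interpret M2: sigma_finite_measure M2 by fact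
  interpret pair_sigma_finite M1 M2 ..
  let ?h = "\<lambda>\<omega>. f (fst \<omega>) * g (snd \<omega>)"
  have [measurable]: "f \<in> borel_measurable M1" "g \<in> borel_measurable M2" using f g by auto
  have m: "?h \<in> borel_measurable (M1 \<Otimes>\<^sub>M M2)" by measurable
  show i: "integrable (M1 \<Otimes>\<^sub>M M2) ?h"
  proof (rule Fubini_integrable[OF m])
    show "integrable M1 (\<lambda>x. \<integral>y. norm (?h (x, y)) \<partial>M2)"
      using f g by (simp add: abs_mult)
    show "AE x in M1. integrable M2 (\<lambda>y. ?h (x, y))"
      using g by simp
  qed
  have "(\<integral>\<omega>. ?h \<omega> \<partial>(M1 \<Otimes>\<^sub>M M2)) = (\<integral>x. \<integral>y. ?h (x, y) \<partial>M2 \<partial>M1)" by (rule integral_fst'[OF i, symmetric])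
  also have "\<dots> = (\<integral>x. f x \<partial>M1) * (\<integral>y. g y \<partial>M2)" by simp
  finally show "(\<integral>\<omega>. ?h \<omega> \<partial>(M1 \<Otimes>\<^sub>M M2)) = (\<integral>x. f x \<partial>M1) * (\<integral>y. g y \<partial>M2)" .
qed

lemma measurable_product_space:
  "f \<in> measurable M0 N \<Longrightarrow> (\<lambda>\<omega>. f (fst \<omega>)) \<in> measurable (product_space M0 M1) N"
  "g \<in> measurable M1 N \<Longrightarrow> (\<lambda>\<omega>. g (snd \<omega>)) \<in> measurable (product_space M0 M1) N"
  unfolding product_space_def
  by (rule measurable_completion[OF measurable_compose[OF measurable_fst]], assumption)
    (rule measurable_completion[OF measurable_compose[OF measurable_snd]], assumption)

lemma prob_space_product_space:
  assumes "prob_space M0" "prob_space M1"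
  shows "prob_space (product_space M0 M1)"
proof -
  interpret M0: prob_space M0 by fact
  interpret M1: prob_space M1 by fact
  interpret pair_prob_space M0 M1 ..
  show ?thesis unfolding product_space_def by (rule prob_space_completion)
qed

lemma product_space_integral_mult:
  fixes f :: "'a \<Rightarrow> real" and g :: "'b \<Rightarrow> real"
  assumes "prob_space M0" "prob_space M1" and f: "integrable M0 f" and g: "integrable M1 g"
  shows "integrable (product_space M0 M1) (\<lambda>\<omega>. f (fst \<omega>) * g (snd \<omega>))"
    and "(\<integral>\<omega>. f (fst \<omega>) * g (snd \<omega>) \<partial>product_space M0 M1) = (\<integral>x. f x \<partial>M0) * (\<integral>y. g y \<partial>M1)"
proof -
  interpret M0: prob_space M0 by fact
  interpret M1: prob_space M1 by fact
  note pm = pair_integral_mult[OF M0.sigma_finite_measure_axioms M1.sigma_finite_measure_axioms f g]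
  have m: "(\<lambda>\<omega>. f (fst \<omega>) * g (snd \<omega>)) \<in> borel_measurable (M0 \<Otimes>\<^sub>M M1)"
    using pm(1) by (rule borel_measurable_integrable)
  show "integrable (product_space M0 M1) (\<lambda>\<omega>. f (fst \<omega>) * g (snd \<omega>))"
    unfolding product_space_def using m pm(1) by (simp add: integrable_completion)
  show "(\<integral>\<omega>. f (fst \<omega>) * g (snd \<omega>) \<partial>product_space M0 M1) = (\<integral>x. f x \<partial>M0) * (\<integral>y. g y \<partial>M1)"
    unfolding product_space_def integral_completion[OF m] by (rule pm(2))
qed

text \<open>The events on which \<open>\<phi>\<close> has the same mean as on the whole space are closed under complements and countable
  disjoint unions, so the claim is an instance of Dynkin's theorem.\<close>

lemma uncorrelated_sigma_sets:
  fixes \<phi> :: "'w \<Rightarrow> real"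
  assumes "prob_space P" and \<phi>: "integrable P \<phi>" and st: "Int_stable G" and sub: "G \<subseteq> sets P"
    and eq: "\<And>E. E \<in> G \<Longrightarrow> (\<integral>\<omega>. indicator E \<omega> * \<phi> \<omega> \<partial>P) = measure P E * (\<integral>\<omega>. \<phi> \<omega> \<partial>P)"
    and A: "A \<in> sigma_sets (space P) G"
  shows "(\<integral>\<omega>. indicator A \<omega> * \<phi> \<omega> \<partial>P) = measure P A * (\<integral>\<omega>. \<phi> \<omega> \<partial>P)"
proof -
  interpret prob_space P by fact
  have Pow: "G \<subseteq> Pow (space P)" using sub sets.sets_into_space by blast
  have sets: "B \<in> sets P" if "B \<in> sigma_sets (space P) G" for B
    using sub that by (metis sets.sigma_sets_subset subsetD)
  have I: "integrable P (\<lambda>\<omega>. indicator B \<omega> * \<phi> \<omega>)" if "B \<in> sets P" for B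
    using integrable_mult_indicator[OF that \<phi>] by simp
  from st Pow A show ?thesis
  proof (induction rule: sigma_sets_induct_disjoint)
    case (basic A) then show ?case by (rule eq)
  next
    case empty show ?case by simp
  next
    case (compl A)
    note A = sets[OF compl(1)]
    have "(\<integral>\<omega>. indicator (space P - A) \<omega> * \<phi> \<omega> \<partial>P) = (\<integral>\<omega>. \<phi> \<omega> - indicator A \<omega> * \<phi> \<omega> \<partial>P)"
      by (intro Bochner_Integration.integral_cong) (auto simp: indicator_def)
    also have "\<dots> = (\<integral>\<omega>. \<phi> \<omega> \<partial>P) - (\<integral>\<omega>. indicator A \<omega> * \<phi> \<omega> \<partial>P)"
      by (rule Bochner_Integration.integral_diff[OF \<phi> I[OF A]])
    also have "\<dots> = measure P (space P - A) * (\<integral>\<omega>. \<phi> \<omega> \<partial>P)"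
      using A compl(2) by (simp add: prob_compl algebra_simps)
    finally show ?case .
  next
    case (union D)
    have D: "D i \<in> sets P" for i using union(2) sets by blast
    have U: "(\<Union>i. D i) \<in> sets P" using D by blast
    have "(\<integral>\<omega>. indicator (\<Union>i. D i) \<omega> * \<phi> \<omega> \<partial>P) = (LINT \<omega>:(\<Union>i. D i)|P. \<phi> \<omega>)"
      by (simp add: set_lebesgue_integral_def)
    also have "\<dots> = (\<Sum>i. LINT \<omega>:D i|P. \<phi> \<omega>)"
      using D union(1) I[OF U]
      by (intro lebesgue_integral_countable_add) (auto simp: disjoint_family_on_def set_integrable_def)
    also have "\<dots> = (\<Sum>i. measure P (D i) * (\<integral>\<omega>. \<phi> \<omega> \<partial>P))"
      using union(3) by (simp add: set_lebesgue_integral_def)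
    also have "\<dots> = measure P (\<Union>i. D i) * (\<integral>\<omega>. \<phi> \<omega> \<partial>P)"
      using D union(1) by (intro sums_unique[symmetric] sums_mult2 finite_measure_UNION) auto
    finally show ?case .
  qed
qed

text \<open>Fubini's theorem separates the common noise from the others, which are independent on the second factor.\<close>

lemma product_space_path_functional:
  fixes W0 :: "real \<Rightarrow> 'a \<Rightarrow> real^'d" and Wi :: "nat \<Rightarrow> real \<Rightarrow> 'b \<Rightarrow> real^'d"
    and h :: "nat \<Rightarrow> (real \<Rightarrow> real^'d) \<Rightarrow> real"
  assumes M0: "prob_space M0" and M1: "prob_space M1"
    and ind: "prob_space.indep_vars M1 (\<lambda>_. PiM {0..T} (\<lambda>_. borel)) (\<lambda>k. trajectory T (Wi k)) {1..n}"
    and hm: "\<And>k. k \<in> {1..n} \<Longrightarrow> h k \<in> borel_measurable (PiM {0..T} (\<lambda>_. borel))"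
    and i0: "integrable M0 (\<lambda>x. h 0 (trajectory T W0 x))"
    and i1: "\<And>k. k \<in> {1..n} \<Longrightarrow> integrable M1 (\<lambda>y. h k (trajectory T (Wi k) y))"
  shows "integrable (product_space M0 M1)
      (\<lambda>\<omega>. \<Prod>k\<le>n. h k (if k = 0 then trajectory T W0 (fst \<omega>) else trajectory T (Wi k) (snd \<omega>)))" (is ?g1)
    and "(\<integral>\<omega>. (\<Prod>k\<le>n. h k (if k = 0 then trajectory T W0 (fst \<omega>) else trajectory T (Wi k) (snd \<omega>))) \<partial>product_space M0 M1) =
      (\<integral>x. h 0 (trajectory T W0 x) \<partial>M0) * (\<Prod>k\<in>{1..n}. \<integral>y. h k (trajectory T (Wi k) y) \<partial>M1)" (is ?g2)
proof -
  interpret M1: prob_space M1 by fact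
  have iv: "M1.indep_vars (\<lambda>_. borel) (\<lambda>k y. h k (trajectory T (Wi k) y)) {1..n}"
    by (rule M1.indep_vars_compose2[OF ind hm])
  have split: "{..n} = insert 0 {1..n}" by auto
  have eq: "(\<Prod>k\<le>n. h k (if k = 0 then trajectory T W0 x else trajectory T (Wi k) y)) =
      h 0 (trajectory T W0 x) * (\<Prod>k\<in>{1..n}. h k (trajectory T (Wi k) y))" for x y
    unfolding split by (subst prod.insert) (auto intro!: prod.cong)
  have i: "integrable M1 (\<lambda>y. \<Prod>k\<in>{1..n}. h k (trajectory T (Wi k) y))"
    by (rule M1.indep_vars_integrable[OF _ iv i1]) auto
  show ?g1
    unfolding eq by (rule product_space_integral_mult(1)[OF M0 M1 i0 i])
  have e: "(\<integral>y. (\<Prod>k\<in>{1..n}. h k (trajectory T (Wi k) y)) \<partial>M1) = (\<Prod>k\<in>{1..n}. \<integral>y. h k (trajectory T (Wi k) y) \<partial>M1)"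
    by (rule M1.indep_vars_lebesgue_integral[OF _ iv i1]) auto
  show ?g2
    unfolding eq product_space_integral_mult(2)[OF M0 M1 i0 i] e ..
qed

text \<open>The common noise gets the index \<open>0\<close>, so that all noises of the \<open>n\<close>-particle system form one family
  indexed by \<open>{..n}\<close>.\<close>

definition lifted_motion :: "(real \<Rightarrow> 'a \<Rightarrow> real^'d) \<Rightarrow> (nat \<Rightarrow> real \<Rightarrow> 'b \<Rightarrow> real^'d) \<Rightarrow> nat \<Rightarrow> real \<Rightarrow> 'a \<times> 'b \<Rightarrow> real^'d" where
  "lifted_motion W0 Wi k t \<omega> = (if k = 0 then W0 t (fst \<omega>) else Wi k t (snd \<omega>))"

definition cylinder :: "nat \<Rightarrow> (nat \<Rightarrow> real \<Rightarrow> 'w \<Rightarrow> 'x) \<Rightarrow> real set \<Rightarrow> (nat \<Rightarrow> real \<Rightarrow> 'x set) \<Rightarrow> 'w set" where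
  "cylinder n B S A = {\<omega>. \<forall>k\<le>n. \<forall>s\<in>S. B k s \<omega> \<in> A k s}"

text \<open>The indicator function of a cylinder and the product of functions of increments both factorise over the motions.
  Hence the expectations do, and each factor is treated by \<open>brownian_past_independent\<close>. Products
  of functions \<open>q k\<close> are general enough to contain the coordinates of the increments and their products.\<close>

lemma cylinder_uncorrelated:
  fixes W0 :: "real \<Rightarrow> 'a \<Rightarrow> real^'d" and Wi :: "nat \<Rightarrow> real \<Rightarrow> 'b \<Rightarrow> real^'d"
    and q :: "nat \<Rightarrow> real^'d \<Rightarrow> real"
  defines "B \<equiv> lifted_motion W0 Wi"
  assumes M0: "prob_space M0" and M1: "prob_space M1"
    and ind: "prob_space.indep_vars M1 (\<lambda>_. PiM {0..T} (\<lambda>_. borel)) (\<lambda>k. trajectory T (Wi k)) {1..n}"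
    and W0: "brownian_motion M0 T W0" and Wi: "\<And>k. k \<in> {1..n} \<Longrightarrow> brownian_motion M1 T (Wi k)"
    and ab: "0 \<le> a" "a \<le> b" "b \<le> T"
    and S: "finite S" "S \<subseteq> {0..a}" and A: "\<And>k s. k \<le> n \<Longrightarrow> s \<in> S \<Longrightarrow> A k s \<in> sets borel"
    and q[measurable]: "\<And>k. q k \<in> borel_measurable borel"
    and q0: "integrable M0 (\<lambda>x. q 0 (W0 b x - W0 a x))"
    and q1: "\<And>k. k \<in> {1..n} \<Longrightarrow> integrable M1 (\<lambda>y. q k (Wi k b y - Wi k a y))"
  shows "integrable (product_space M0 M1) (\<lambda>\<omega>. \<Prod>k\<le>n. q k (B k b \<omega> - B k a \<omega>))"
    and "(\<integral>\<omega>. (\<Prod>k\<le>n. q k (B k b \<omega> - B k a \<omega>)) \<partial>product_space M0 M1) =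
      (\<integral>x. q 0 (W0 b x - W0 a x) \<partial>M0) * (\<Prod>k\<in>{1..n}. \<integral>y. q k (Wi k b y - Wi k a y) \<partial>M1)" (is ?g2)
    and "(\<integral>\<omega>. indicator (cylinder n B S A) \<omega> * (\<Prod>k\<le>n. q k (B k b \<omega> - B k a \<omega>)) \<partial>product_space M0 M1) =
      (\<integral>\<omega>. indicator (cylinder n B S A) \<omega> \<partial>product_space M0 M1) *
      (\<integral>\<omega>. (\<Prod>k\<le>n. q k (B k b \<omega> - B k a \<omega>)) \<partial>product_space M0 M1)" (is ?g3)
proof -
  interpret M0: prob_space M0 by fact
  interpret M1: prob_space M1 by fact
  let ?PM = "PiM {0..T} (\<lambda>_. borel :: (real^'d) measure)"
  let ?P = "product_space M0 M1"
  let ?x = "\<lambda>k \<omega>. if k = 0 then trajectory T W0 (fst \<omega>) else trajectory T (Wi k) (snd \<omega>)"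
  define e where "e k x = (indicator {x. \<forall>s\<in>S. x s \<in> A k s} x :: real)" for k and x :: "real \<Rightarrow> real^'d"
  define d where "d k x = q k (x b - x a)" for k and x :: "real \<Rightarrow> real^'d"
  have ST: "s \<in> {0..T}" if "s \<in> S" for s using S ab that by auto
  have tr: "trajectory T X \<omega> s = X s \<omega>" if "s \<in> {0..T}" for X :: "real \<Rightarrow> 'z \<Rightarrow> real^'d" and \<omega> s
    using that by (simp add: trajectory_def)
  have abT: "a \<in> {0..T}" "b \<in> {0..T}" using ab by auto
  have dm: "d k \<in> borel_measurable ?PM" for k
    unfolding d_def using abT by measurable
  have em: "e k \<in> borel_measurable ?PM" if "k \<le> n" for k
  proof -
    have "{x \<in> space ?PM. x s \<in> A k s} \<in> sets ?PM" if s: "s \<in> S" for s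
      using measurable_sets[OF measurable_component_singleton[OF ST[OF s]] A[OF \<open>k \<le> n\<close> s]]
      by (simp add: vimage_def Int_def conj_commute)
    then have "{x \<in> space ?PM. \<forall>s\<in>S. x s \<in> A k s} \<in> sets ?PM"
      using S by (intro sets.sets_Collect_finite_All) auto
    from borel_measurable_indicator[OF this] show ?thesis
      by (rule measurable_cong[THEN iffD1, rotated]) (auto simp: e_def indicator_def)
  qed
  have dx: "d k (trajectory T X \<omega>) = q k (X b \<omega> - X a \<omega>)" for k \<omega> and X :: "real \<Rightarrow> 'z \<Rightarrow> real^'d"
    using abT by (simp add: d_def tr)
  have ex: "e k (trajectory T X \<omega>) = indicator {\<omega>. \<forall>s\<in>S. X s \<omega> \<in> A k s} \<omega>" for k \<omega> and X :: "real \<Rightarrow> 'z \<Rightarrow> real^'d"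
  proof -
    have "(\<forall>s\<in>S. trajectory T X \<omega> s \<in> A k s) = (\<forall>s\<in>S. X s \<omega> \<in> A k s)"
      by (intro ball_cong refl) (simp add: tr[OF ST])
    then show ?thesis by (simp add: e_def indicator_def)
  qed
  have trm: "trajectory T X \<in> measurable M ?PM" if "brownian_motion M T X" for X :: "real \<Rightarrow> 'z \<Rightarrow> real^'d" and M
    unfolding trajectory_def using that by (intro measurable_restrict) (simp add: brownian_motion_def)
  have dB: "d k (?x k \<omega>) = q k (B k b \<omega> - B k a \<omega>)" for k \<omega>
    by (simp add: B_def lifted_motion_def dx)
  have eB: "(\<Prod>k\<le>n. e k (?x k \<omega>)) = indicator (cylinder n B S A) \<omega>" for \<omega>
  proof (cases "\<omega> \<in> cylinder n B S A")
    case True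
    then have "e k (?x k \<omega>) = 1" if "k \<le> n" for k
      using that ex[of k W0] ex[of k "Wi k"] by (auto simp: cylinder_def B_def lifted_motion_def indicator_def)
    then show ?thesis using True by simp
  next
    case False
    then obtain k where k: "k \<le> n" "\<not> (\<forall>s\<in>S. B k s \<omega> \<in> A k s)" by (auto simp: cylinder_def)
    then have "e k (?x k \<omega>) = 0"
      using ex[of k W0] ex[of k "Wi k"] by (auto simp: B_def lifted_motion_def indicator_def)
    then have "(\<Prod>k\<le>n. e k (?x k \<omega>)) = 0"
      using k(1) by (intro prod_zero finite_atMost bexI[of _ k]) simp_all
    then show ?thesis using False by simp
  qed
  have d0: "integrable M0 (\<lambda>x. d 0 (trajectory T W0 x))" unfolding dx by (rule q0)
  have d1: "integrable M1 (\<lambda>y. d k (trajectory T (Wi k) y))" if "k \<in> {1..n}" for k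
    unfolding dx by (rule q1[OF that])
  have en: "\<bar>e k x\<bar> \<le> 1" for k x by (simp add: e_def indicator_def)
  have e0: "integrable M0 (\<lambda>x. e 0 (trajectory T W0 x))"
    by (rule M0.integrable_const_bound[where B=1]) (auto simp: en intro!: measurable_compose[OF trm[OF W0] em])
  have e1: "integrable M1 (\<lambda>y. e k (trajectory T (Wi k) y))" if "k \<in> {1..n}" for k
    using that by (intro M1.integrable_const_bound[where B=1]) (auto simp: en intro!: measurable_compose[OF trm[OF Wi] em])
  have ed0: "integrable M0 (\<lambda>x. e 0 (trajectory T W0 x) * d 0 (trajectory T W0 x))"
    using e0 by (intro Bochner_Integration.integrable_bound[OF d0])
      (auto simp: abs_mult intro!: mult_left_le_one_le en borel_measurable_times measurable_compose[OF trm[OF W0] dm])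
  have ed1: "integrable M1 (\<lambda>y. e k (trajectory T (Wi k) y) * d k (trajectory T (Wi k) y))" if "k \<in> {1..n}" for k
    using e1[OF that] by (intro Bochner_Integration.integrable_bound[OF d1[OF that]])
      (auto simp: abs_mult intro!: mult_left_le_one_le en borel_measurable_times measurable_compose[OF trm[OF Wi[OF that]] dm])
  note F = product_space_path_functional[OF M0 M1 ind]
  show "integrable ?P (\<lambda>\<omega>. \<Prod>k\<le>n. q k (B k b \<omega> - B k a \<omega>))"
    using F(1)[of d, OF dm d0 d1] unfolding dB .
  show q_int: ?g2
    using F(2)[of d, OF dm d0 d1] unfolding dB dx .
  have e_int: "(\<integral>\<omega>. indicator (cylinder n B S A) \<omega> \<partial>?P) =
      (\<integral>x. e 0 (trajectory T W0 x) \<partial>M0) * (\<Prod>k\<in>{1..n}. \<integral>y. e k (trajectory T (Wi k) y) \<partial>M1)"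
    using F(2)[of e, OF em e0 e1] unfolding eB by simp
  have "(\<integral>\<omega>. indicator (cylinder n B S A) \<omega> * (\<Prod>k\<le>n. q k (B k b \<omega> - B k a \<omega>)) \<partial>?P) =
      (\<integral>x. e 0 (trajectory T W0 x) * d 0 (trajectory T W0 x) \<partial>M0) *
      (\<Prod>k\<in>{1..n}. \<integral>y. e k (trajectory T (Wi k) y) * d k (trajectory T (Wi k) y) \<partial>M1)"
    using F(2)[of "\<lambda>k x. e k x * d k x", OF borel_measurable_times[OF em dm] ed0 ed1]
    unfolding prod.distrib eB dB by simp
  also have "(\<integral>x. e 0 (trajectory T W0 x) * d 0 (trajectory T W0 x) \<partial>M0) =
      (\<integral>x. e 0 (trajectory T W0 x) \<partial>M0) * (\<integral>x. q 0 (W0 b x - W0 a x) \<partial>M0)"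
    unfolding dx ex by (rule brownian_past_independent[OF M0 W0 ab S A q q0]) auto
  also have "(\<Prod>k\<in>{1..n}. \<integral>y. e k (trajectory T (Wi k) y) * d k (trajectory T (Wi k) y) \<partial>M1) =
      (\<Prod>k\<in>{1..n}. (\<integral>y. e k (trajectory T (Wi k) y) \<partial>M1) * (\<integral>y. q k (Wi k b y - Wi k a y) \<partial>M1))"
  proof (rule prod.cong[OF refl])
    fix k assume k: "k \<in> {1..n}"
    show "(\<integral>y. e k (trajectory T (Wi k) y) * d k (trajectory T (Wi k) y) \<partial>M1) =
      (\<integral>y. e k (trajectory T (Wi k) y) \<partial>M1) * (\<integral>y. q k (Wi k b y - Wi k a y) \<partial>M1)"
      unfolding dx ex by (rule brownian_past_independent[OF M1 Wi[OF k] ab S A q q1[OF k]]) (use k in auto)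
  qed
  finally show ?g3
    unfolding e_int q_int by (simp add: prod.distrib)
qed

lemma lifted_motion_measurable:
  assumes "brownian_motion M0 T W0" "\<And>k. k \<in> {1..n} \<Longrightarrow> brownian_motion M1 T (Wi k)"
    and "k \<le> n" "0 \<le> t" "t \<le> T"
  shows "lifted_motion W0 Wi k t \<in> borel_measurable (product_space M0 M1)"
proof -
  have "(\<lambda>\<omega>. W0 t (fst \<omega>)) \<in> borel_measurable (product_space M0 M1)"
    using assms by (intro measurable_product_space(1) brownian_measurable)
  moreover have "(\<lambda>\<omega>. Wi k t (snd \<omega>)) \<in> borel_measurable (product_space M0 M1)" if "k \<noteq> 0"
    using assms that by (intro measurable_product_space(2) brownian_measurable[of M1 T]) auto
  ultimately show ?thesis by (cases "k = 0") (simp_all add: lifted_motion_def[abs_def])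
qed

text \<open>The generators of the sigma-algebras that the augmented filtration intersects over \<open>u > t\<close>.\<close>

definition past_events :: "'w measure \<Rightarrow> real \<Rightarrow> (real \<Rightarrow> 'w \<Rightarrow> 'x::topological_space) set \<Rightarrow> real \<Rightarrow> 'w set set" where
  "past_events M T X u = null_sets M \<union>
     {X' s -` A \<inter> space M | X' s A. X' \<in> X \<and> 0 \<le> s \<and> s \<le> T \<and> s \<le> u \<and> A \<in> sets borel}"

text \<open>The intersection is already a sigma-algebra.\<close>

lemma sets_augmented_filtration:
  "sets (augmented_filtration M T X t) = (\<Inter>u\<in>{t<..}. sigma_sets (space M) (past_events M T X u))"
proof -
  let ?I = "\<Inter>u\<in>{t<..}. sigma_sets (space M) (past_events M T X u)"
  have pow: "past_events M T X u \<subseteq> Pow (space M)" for u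
    using sets.sets_into_space by (fastforce simp: past_events_def null_sets_def)
  have ne: "{t<..} \<noteq> {}" by (simp add: not_le[symmetric] exI[of _ "t + 1"])
  have "sigma_algebra (space M) ?I"
  proof (rule sigma_algebra_iff2[THEN iffD2], intro conjI ballI allI impI)
    show "?I \<subseteq> Pow (space M)"
    proof (rule order_trans[OF INF_lower])
      show "t + 1 \<in> {t<..}" by simp
      show "sigma_sets (space M) (past_events M T X (t + 1)) \<subseteq> Pow (space M)"
        using sigma_sets_into_sp[OF pow] by blast
    qed
    show "{} \<in> ?I" by (auto intro: sigma_sets.Empty)
    show "space M - s \<in> ?I" if "s \<in> ?I" for s using that by (auto intro: sigma_sets.Compl)
    show "(\<Union>i. A i) \<in> ?I" if "range A \<subseteq> ?I" for A :: "nat \<Rightarrow> _"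
      using that by (auto intro!: sigma_sets.Union)
  qed
  then interpret sigma_algebra "space M" ?I .
  show ?thesis unfolding augmented_filtration_def past_events_def[symmetric]
    using space_closed by (simp add: sigma_sets_eq)
qed

lemma space_augmented_filtration[simp]: "space (augmented_filtration M T X t) = space M"
  unfolding augmented_filtration_def by (simp add: space_measure_of_conv)

lemma augmented_filtration_mono:
  assumes "t \<le> t'" "X \<subseteq> X'"
  shows "sets (augmented_filtration M T X t) \<subseteq> sets (augmented_filtration M T X' t')"
  unfolding sets_augmented_filtration
proof (rule INT_greatest)
  fix u assume u: "u \<in> {t'<..}"
  have "past_events M T X u \<subseteq> past_events M T X' u" using assms(2) by (auto simp: past_events_def)
  then have "sigma_sets (space M) (past_events M T X u) \<subseteq> sigma_sets (space M) (past_events M T X' u)"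
    by (rule sigma_sets_mono')
  then show "(\<Inter>u\<in>{t<..}. sigma_sets (space M) (past_events M T X u)) \<subseteq> sigma_sets (space M) (past_events M T X' u)"
    using u assms(1) by (intro INF_lower2[of u]) auto
qed

lemma augmented_filtration_sub:
  assumes "\<And>X' s. X' \<in> X \<Longrightarrow> 0 \<le> s \<Longrightarrow> s \<le> T \<Longrightarrow> X' s \<in> borel_measurable M"
  shows "sets (augmented_filtration M T X t) \<subseteq> sets M"
proof -
  have "past_events M T X (t + 1) \<subseteq> sets M"
    using assms by (auto simp: past_events_def intro: measurable_sets)
  then have "sigma_sets (space M) (past_events M T X (t + 1)) \<subseteq> sets M" by (rule sets.sigma_sets_subset)
  then show ?thesis unfolding sets_augmented_filtration by (intro INF_lower2[of "t+1"]) auto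
qed

lemma measurable_augmented_filtration:
  assumes "X' \<in> X" "0 \<le> t" "t \<le> T"
  shows "X' t \<in> borel_measurable (augmented_filtration M T X t)"
proof (rule measurableI)
  fix A :: "'b set" assume A: "A \<in> sets borel"
  have "X' t -` A \<inter> space M \<in> past_events M T X u" if "t < u" for u
    using assms A that unfolding past_events_def by (intro UnI2 CollectI exI[of _ X'] exI[of _ t] exI[of _ A]) auto
  then show "X' t -` A \<inter> space (augmented_filtration M T X t) \<in> sets (augmented_filtration M T X t)"
    unfolding sets_augmented_filtration by (auto intro: sigma_sets.Basic)
qed simp

text \<open>Two cylinders intersect in a cylinder over the union of their finite sets of times. The null sets have to
  be among the generators because they generate the augmented filtration as well; they absorb
  intersections with measurable sets.\<close>

lemma cylinder_Int_stable:
  assumes sub: "\<And>S A. P S A \<Longrightarrow> cylinder n B S A \<inter> space M \<in> sets M"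
    and P: "\<And>S A. P S A \<longleftrightarrow> finite S \<and> S \<subseteq> {0..u::real} \<and> (\<forall>k\<le>n. \<forall>s\<in>S. A k s \<in> sets (borel :: 'x::topological_space measure))"
  shows "Int_stable (null_sets M \<union> {cylinder n B S A \<inter> space M | S A. P S A})"
proof (rule Int_stableI)
  fix E E' assume E: "E \<in> null_sets M \<union> {cylinder n B S A \<inter> space M | S A. P S A}"
    and E': "E' \<in> null_sets M \<union> {cylinder n B S A \<inter> space M | S A. P S A}"
  have m: "E \<in> sets M" "E' \<in> sets M" using E E' sub by (auto simp: null_sets_def)
  show "E \<inter> E' \<in> null_sets M \<union> {cylinder n B S A \<inter> space M | S A. P S A}"
  proof (cases "E \<in> null_sets M \<or> E' \<in> null_sets M")
    case True then show ?thesis using m null_set_Int1 null_set_Int2 by blast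
  next
    case False
    then obtain S A S' A' where 1: "E = cylinder n B S A \<inter> space M" "P S A" "E' = cylinder n B S' A' \<inter> space M" "P S' A'"
      using E E' by blast
    define A'' where "A'' k s = (if s \<in> S then A k s else UNIV) \<inter> (if s \<in> S' then A' k s else UNIV)" for k s
    have "E \<inter> E' = cylinder n B (S \<union> S') A'' \<inter> space M"
      unfolding 1 cylinder_def A''_def by auto
    moreover have "P (S \<union> S') A''" using 1(2,4) unfolding P A''_def by (auto intro!: sets.Int)
    ultimately show ?thesis by blast
  qed
qed

text \<open>The moments of the increments after time \<open>a\<close>, given the sigma-algebra generated by the null sets and the past
  up to time \<open>a\<close>. The events here are those of one sigma-algebra of the intersection that defines the
  filtration.\<close>

lemma past_event_increment_moments:
  fixes M0 :: "'a measure" and M1 :: "'b measure" and W0 :: "real \<Rightarrow> 'a \<Rightarrow> real^'d" and Wi :: "nat \<Rightarrow> real \<Rightarrow> 'b \<Rightarrow> real^'d"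
  defines "B \<equiv> lifted_motion W0 Wi" and "P \<equiv> product_space M0 M1"
  assumes M0: "prob_space M0" and M1: "prob_space M1"
    and ind: "prob_space.indep_vars M1 (\<lambda>_. PiM {0..T} (\<lambda>_. borel)) (\<lambda>k. trajectory T (Wi k)) {1..n}"
    and W0: "brownian_motion M0 T W0" and Wi: "\<And>k. k \<in> {1..n} \<Longrightarrow> brownian_motion M1 T (Wi k)"
    and ab: "0 \<le> a" "a \<le> b" "b \<le> T"
    and E: "E \<in> sigma_sets (space P) (past_events P T (B ` {..n}) a)"
    and kl: "k \<le> n" "l \<le> n"
  shows "integrable P (\<lambda>\<omega>. (B k b \<omega> - B k a \<omega>) $ i)" (is ?g1)
    and "(\<integral>\<omega>. indicator E \<omega> * (B k b \<omega> - B k a \<omega>) $ i \<partial>P) = 0" (is ?g2)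
    and "integrable P (\<lambda>\<omega>. (B k b \<omega> - B k a \<omega>) $ i * (B l b \<omega> - B l a \<omega>) $ j)" (is ?g3)
    and "(\<integral>\<omega>. indicator E \<omega> * ((B k b \<omega> - B k a \<omega>) $ i * (B l b \<omega> - B l a \<omega>) $ j) \<partial>P) =
      measure P E * (of_bool (k = l \<and> i = j) * (b - a))" (is ?g4)
proof -
  interpret M0: prob_space M0 by fact
  interpret M1: prob_space M1 by fact
  interpret P: prob_space P unfolding P_def by (rule prob_space_product_space[OF M0 M1])
  have Bm: "B k t \<in> borel_measurable P" if "k \<le> n" "0 \<le> t" "t \<le> T" for k t
    unfolding B_def P_def using W0 Wi that by (rule lifted_motion_measurable)
  define Q where "Q S A \<longleftrightarrow> finite S \<and> S \<subseteq> {0..a} \<and> (\<forall>k\<le>n. \<forall>s\<in>S. A k s \<in> sets borel)" for S and A :: "nat \<Rightarrow> real \<Rightarrow> (real^'d) set"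
  define G where "G = null_sets P \<union> {cylinder n B S A \<inter> space P | S A. Q S A}"
  have cyl: "cylinder n B S A \<inter> space P \<in> sets P" if "Q S A" for S A
  proof -
    have m: "{\<omega> \<in> space P. B k s \<omega> \<in> A k s} \<in> sets P" if "k \<le> n" "s \<in> S" for k s
      using measurable_sets[OF Bm[of k s], of "A k s"] \<open>Q S A\<close> that ab
      by (auto simp: Q_def vimage_def Int_def conj_commute)
    have "{\<omega> \<in> space P. \<forall>k\<in>{..n}. \<forall>s\<in>S. B k s \<omega> \<in> A k s} \<in> sets P"
      using \<open>Q S A\<close> m by (intro sets.sets_Collect_finite_All) (auto simp: Q_def)
    moreover have "{\<omega> \<in> space P. \<forall>k\<in>{..n}. \<forall>s\<in>S. B k s \<omega> \<in> A k s} = cylinder n B S A \<inter> space P"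
      by (auto simp: cylinder_def)
    ultimately show ?thesis by simp
  qed
  have st: "Int_stable G" unfolding G_def by (rule cylinder_Int_stable[OF cyl, of Q a]) (auto simp: Q_def)
  have sub: "G \<subseteq> sets P" using cyl by (auto simp: G_def null_sets_def)
  have "past_events P T (B ` {..n}) a \<subseteq> G"
  proof
    fix D assume "D \<in> past_events P T (B ` {..n}) a"
    then consider "D \<in> null_sets P" | k s A where "k \<le> n" "0 \<le> s" "s \<le> a" "A \<in> sets borel" "D = B k s -` A \<inter> space P"
      by (auto simp: past_events_def)
    then show "D \<in> G"
    proof cases
      case 1 then show ?thesis by (simp add: G_def)
    next
      case 2
      define A' where "A' k' s' = (if k' = k \<and> s' = s then A else UNIV)" for k' :: nat and s' :: real
      have "D = cylinder n B {s} A' \<inter> space P"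
        using 2 by (auto simp: cylinder_def A'_def)
      moreover have "Q {s} A'" using 2 by (auto simp: Q_def A'_def)
      ultimately show ?thesis unfolding G_def by blast
    qed
  qed
  then have EG: "E \<in> sigma_sets (space P) G" using E sigma_sets_mono' by blast
  have unc: "(\<integral>\<omega>. indicator E \<omega> * \<phi> \<omega> \<partial>P) = measure P E * (\<integral>\<omega>. \<phi> \<omega> \<partial>P)"
    if \<phi>: "integrable P \<phi>" and c: "\<And>S A. Q S A \<Longrightarrow> (\<integral>\<omega>. indicator (cylinder n B S A) \<omega> * \<phi> \<omega> \<partial>P) =
      (\<integral>\<omega>. indicator (cylinder n B S A) \<omega> \<partial>P) * (\<integral>\<omega>. \<phi> \<omega> \<partial>P)" for \<phi> :: "'a \<times> 'b \<Rightarrow> real"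
  proof (rule uncorrelated_sigma_sets[OF P.prob_space_axioms \<phi> st sub _ EG])
    fix D assume "D \<in> G"
    then consider "D \<in> null_sets P" | S A where "D = cylinder n B S A \<inter> space P" "Q S A" unfolding G_def by blast
    then show "(\<integral>\<omega>. indicator D \<omega> * \<phi> \<omega> \<partial>P) = measure P D * (\<integral>\<omega>. \<phi> \<omega> \<partial>P)"
    proof cases
      case 1
      have "(\<integral>\<omega>. indicator D \<omega> * \<phi> \<omega> \<partial>P) = (\<integral>\<omega>. 0 \<partial>P)"
        using \<phi> 1 AE_not_in[OF 1] by (intro integral_cong_AE) (auto simp: null_sets_def)
      then show ?thesis using 1 by (simp add: measure_eq_0_null_sets)
    next
      case 2
      have "(\<integral>\<omega>. indicator D \<omega> * \<phi> \<omega> \<partial>P) = (\<integral>\<omega>. indicator (cylinder n B S A) \<omega> * \<phi> \<omega> \<partial>P)"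
        using 2 by (intro Bochner_Integration.integral_cong) (auto simp: indicator_def)
      moreover have "measure P D = (\<integral>\<omega>. indicator D \<omega> \<partial>P)"
        using cyl[OF 2(2)] 2(1) by simp
      moreover have "\<dots> = (\<integral>\<omega>. indicator (cylinder n B S A) \<omega> \<partial>P)"
        using 2 by (intro Bochner_Integration.integral_cong) (auto simp: indicator_def)
      ultimately show ?thesis using c[OF 2(2)] by simp
    qed
  qed
  have one: "(\<Prod>k'\<le>n. (x k' $ i) ^ of_bool (k' = k)) = x k $ i" if "k \<le> n" for k i and x :: "nat \<Rightarrow> real^'d"
  proof -
    have "(\<Prod>k'\<le>n. (x k' $ i) ^ of_bool (k' = k)) = (\<Prod>k'\<le>n. if k' = k then x k' $ i else 1)"
      by (intro prod.cong) auto
    then show ?thesis using that by simp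
  qed
  define D where "D k' \<omega> = B k' b \<omega> - B k' a \<omega>" for k' \<omega>
  {
    (* A test function that is the coordinate for the motion k and 1 for the other motions. *)
    define q where "q k' x = (x $ i) ^ of_bool (k' = k)" for k' :: nat and x :: "real^'d"
    have qm: "q k' \<in> borel_measurable borel" for k' unfolding q_def by measurable
    have q0: "integrable M0 (\<lambda>x. q 0 (W0 b x - W0 a x))"
      using brownian_moments(1)[OF W0 ab, of i] unfolding q_def by (cases "k = 0") auto
    have q1: "integrable M1 (\<lambda>y. q k' (Wi k' b y - Wi k' a y))" if "k' \<in> {1..n}" for k'
      using brownian_moments(1)[OF Wi[OF that] ab, of i] unfolding q_def by (cases "k' = k") auto
    have Q: "(\<Prod>k'\<le>n. q k' (B k' b \<omega> - B k' a \<omega>)) = D k \<omega> $ i" for \<omega>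
      unfolding q_def D_def by (rule one[OF kl(1)])
    note C = cylinder_uncorrelated[OF M0 M1 ind W0 Wi ab _ _ _ qm q0 q1, folded B_def P_def, unfolded Q]
    have z: "(\<integral>x. q 0 (W0 b x - W0 a x) \<partial>M0) * (\<Prod>k'\<in>{1..n}. \<integral>y. q k' (Wi k' b y - Wi k' a y) \<partial>M1) = 0"
    proof (cases "k = 0")
      case True then show ?thesis using brownian_moments(2)[OF W0 ab, of i] by (simp add: q_def)
    next
      case False
      then have k: "k \<in> {1..n}" using kl by auto
      have "(\<Prod>k'\<in>{1..n}. \<integral>y. q k' (Wi k' b y - Wi k' a y) \<partial>M1) = 0"
        using brownian_moments(2)[OF Wi[OF k] ab, of i] k by (intro prod_zero) (auto simp: q_def intro!: bexI[of _ k])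
      then show ?thesis by simp
    qed
    have I: "integrable P (\<lambda>\<omega>. D k \<omega> $ i)"
      by (rule C(1)[of "{}" "\<lambda>_ _. UNIV"]) auto
    then show ?g1 by (simp add: D_def)
    have "(\<integral>\<omega>. indicator E \<omega> * D k \<omega> $ i \<partial>P) = measure P E * (\<integral>\<omega>. D k \<omega> $ i \<partial>P)"
      by (rule unc[OF I]) (rule C(3), auto simp: Q_def)
    also have "(\<integral>\<omega>. D k \<omega> $ i \<partial>P) = 0"
      using C(2)[of "{}" "\<lambda>_ _. UNIV"] z by simp
    finally show ?g2 by (simp add: D_def)
  }
  {
    define q where "q k' x = (x $ i) ^ of_bool (k' = k) * (x $ j) ^ of_bool (k' = l)" for k' :: nat and x :: "real^'d"
    have qm: "q k' \<in> borel_measurable borel" for k' unfolding q_def by measurable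
    have bm: "integrable M (\<lambda>x. q k' (X b x - X a x))"
       "(\<integral>x. q k' (X b x - X a x) \<partial>M) = (if k' = k \<and> k' = l then of_bool (i = j) * (b - a) else if k' = k \<or> k' = l then 0 else 1)"
      if "prob_space M" "brownian_motion M T X" for M and X :: "real \<Rightarrow> 'z \<Rightarrow> real^'d" and k'
    proof -
      interpret prob_space M by fact
      show "integrable M (\<lambda>x. q k' (X b x - X a x))"
        using brownian_moments(1)[OF that(2) ab, of i] brownian_moments(1)[OF that(2) ab, of j]
          brownian_moments(3)[OF that(2) ab, of i j]
        unfolding q_def by (cases "k' = k"; cases "k' = l") auto
      show "(\<integral>x. q k' (X b x - X a x) \<partial>M) = (if k' = k \<and> k' = l then of_bool (i = j) * (b - a) else if k' = k \<or> k' = l then 0 else 1)"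
        using brownian_moments(2)[OF that(2) ab, of i] brownian_moments(2)[OF that(2) ab, of j]
          brownian_moments(4)[OF that(2) ab, of i j] prob_space
        unfolding q_def by (cases "k' = k"; cases "k' = l") auto
    qed
    have Q: "(\<Prod>k'\<le>n. q k' (B k' b \<omega> - B k' a \<omega>)) = D k \<omega> $ i * D l \<omega> $ j" for \<omega>
      unfolding q_def D_def prod.distrib using one[OF kl(1)] one[OF kl(2)] by (simp only:)
    have q1: "integrable M1 (\<lambda>y. q k' (Wi k' b y - Wi k' a y))" if "k' \<in> {1..n}" for k'
      by (rule bm(1)[OF M1 Wi[OF that]])
    note C = cylinder_uncorrelated[OF M0 M1 ind W0 Wi ab _ _ _ qm bm(1)[OF M0 W0] q1, folded B_def P_def, unfolded Q]
    have z: "(\<integral>x. q 0 (W0 b x - W0 a x) \<partial>M0) * (\<Prod>k'\<in>{1..n}. \<integral>y. q k' (Wi k' b y - Wi k' a y) \<partial>M1) = of_bool (k = l \<and> i = j) * (b - a)"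
    proof -
      define v where "v k' = (if k' = k \<and> k' = l then of_bool (i = j) * (b - a) else if k' = k \<or> k' = l then 0 else 1)" for k' :: nat
      have "(\<integral>x. q 0 (W0 b x - W0 a x) \<partial>M0) * (\<Prod>k'\<in>{1..n}. \<integral>y. q k' (Wi k' b y - Wi k' a y) \<partial>M1) = v 0 * (\<Prod>k'\<in>{1..n}. v k')"
        unfolding v_def bm(2)[OF M0 W0] using bm(2)[OF M1 Wi] by simp
      also have "\<dots> = (\<Prod>k'\<le>n. v k')"
      proof -
        have "{..n} = insert 0 {1..n}" by auto
        then show ?thesis by simp
      qed
      also have "\<dots> = of_bool (k = l \<and> i = j) * (b - a)"
      proof (cases "k = l")
        case True
        have "(\<Prod>k'\<le>n. v k') = (\<Prod>k'\<le>n. if k' = k then of_bool (i = j) * (b - a) else 1)"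
          using True by (intro prod.cong) (auto simp: v_def)
        then show ?thesis using True kl by simp
      next
        case False
        then have "(\<Prod>k'\<le>n. v k') = 0" using kl by (intro prod_zero) (auto simp: v_def intro!: bexI[of _ k])
        then show ?thesis using False by simp
      qed
      finally show ?thesis .
    qed
    have I: "integrable P (\<lambda>\<omega>. D k \<omega> $ i * D l \<omega> $ j)"
      by (rule C(1)[of "{}" "\<lambda>_ _. UNIV"]) auto
    then show ?g3 by (simp add: D_def)
    have "(\<integral>\<omega>. indicator E \<omega> * (D k \<omega> $ i * D l \<omega> $ j) \<partial>P) = measure P E * (\<integral>\<omega>. D k \<omega> $ i * D l \<omega> $ j \<partial>P)"
      by (rule unc[OF I]) (rule C(3), auto simp: Q_def)
    also have "(\<integral>\<omega>. D k \<omega> $ i * D l \<omega> $ j \<partial>P) = of_bool (k = l \<and> i = j) * (b - a)"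
      using C(2)[of "{}" "\<lambda>_ _. UNIV"] z by simp
    finally show ?g4 by (simp add: D_def)
  }
qed

text \<open>An event of the right-continuous filtration at time \<open>a\<close> belongs to the sigma-algebra of the past up to \<open>u\<close>
  for every \<open>u > a\<close>. So \<open>past_event_increment_moments\<close> applies to the increments from \<open>u\<close> to \<open>b\<close>,
  and these tend in \<open>L\<^sup>2\<close> to the increments from \<open>a\<close> to \<open>b\<close> when \<open>u\<close> decreases to \<open>a\<close>.\<close>

lemma filtration_increment_moments:
  fixes M0 :: "'a measure" and M1 :: "'b measure"
    and W0 :: "real \<Rightarrow> 'a \<Rightarrow> real^'d" and Wi :: "nat \<Rightarrow> real \<Rightarrow> 'b \<Rightarrow> real^'d"
  defines "B \<equiv> lifted_motion W0 Wi" and "P \<equiv> product_space M0 M1"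
  assumes M0: "prob_space M0" and M1: "prob_space M1"
    and ind: "prob_space.indep_vars M1 (\<lambda>_. PiM {0..T} (\<lambda>_. borel)) (\<lambda>k. trajectory T (Wi k)) {1..n}"
    and W0: "brownian_motion M0 T W0" and Wi: "\<And>k. k \<in> {1..n} \<Longrightarrow> brownian_motion M1 T (Wi k)"
    and ab: "0 \<le> a" "a < b" "b \<le> T"
    and E: "E \<in> sets (augmented_filtration P T (B ` {..n}) a)"
    and kl: "k \<le> n" "l \<le> n"
  shows "(\<integral>\<omega>. indicator E \<omega> * (B k b \<omega> - B k a \<omega>) $ i \<partial>P) = 0" (is ?g1)
    and "(\<integral>\<omega>. indicator E \<omega> * ((B k b \<omega> - B k a \<omega>) $ i * (B l b \<omega> - B l a \<omega>) $ j) \<partial>P) =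
      measure P E * (of_bool (k = l \<and> i = j) * (b - a))" (is ?g2)
proof -
  interpret P: prob_space P unfolding P_def by (rule prob_space_product_space[OF M0 M1])
  have Bm[measurable]: "B k t \<in> borel_measurable P" if "k \<le> n" "0 \<le> t" "t \<le> T" for k t
    unfolding B_def P_def using W0 Wi that by (rule lifted_motion_measurable)
  have EP: "E \<in> sets P"
  proof -
    have "sets (augmented_filtration P T (B ` {..n}) a) \<subseteq> sets P"
      by (rule augmented_filtration_sub) (auto intro!: Bm)
    then show ?thesis using E by (rule subsetD)
  qed
  note mom = past_event_increment_moments[OF M0 M1 ind W0 Wi, folded B_def P_def]
  have sq: "square_integrable P (\<lambda>\<omega>. (B k t \<omega> - B k s \<omega>) $ i)"
    "(sqnorm P (\<lambda>\<omega>. (B k t \<omega> - B k s \<omega>) $ i)) = ennreal (t - s)"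
    if "k \<le> n" "0 \<le> s" "s \<le> t" "t \<le> T" for k s t i
  proof -
    note m = mom(3,4)[OF _ that(2,3,4) _ that(1,1), of "space P" i i]
    have sp: "space P \<in> sigma_sets (space P) (past_events P T (B ` {..n}) s)" by (rule sigma_sets_top)
    have I: "integrable P (\<lambda>\<omega>. (norm ((B k t \<omega> - B k s \<omega>) $ i))\<^sup>2)"
      using m(1)[OF _ sp] by (simp add: power2_eq_square)
    then show "square_integrable P (\<lambda>\<omega>. (B k t \<omega> - B k s \<omega>) $ i)"
    proof -
      have "(\<lambda>\<omega>. (B k t \<omega> - B k s \<omega>) $ i) \<in> borel_measurable P"
        by (rule borel_measurable_integrable) (rule mom(1)[OF _ that(2,3,4) sp that(1,1)], simp)
      then show ?thesis using I by (simp add: square_integrable_iff)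
    qed
    have "(\<integral>\<omega>. (norm ((B k t \<omega> - B k s \<omega>) $ i))\<^sup>2 \<partial>P) = (\<integral>\<omega>. indicator (space P) \<omega> * ((B k t \<omega> - B k s \<omega>) $ i * (B k t \<omega> - B k s \<omega>) $ i) \<partial>P)"
      by (intro Bochner_Integration.integral_cong) (auto simp: power2_eq_square)
    also have "\<dots> = t - s" using m(2)[OF _ sp] by (simp add: P.prob_space)
    finally show "(sqnorm P (\<lambda>\<omega>. (B k t \<omega> - B k s \<omega>) $ i)) = ennreal (t - s)"
      using nn_integral_eq_integral[OF I] by simp
  qed
  (* Times in ]a, b] that decrease to a. *)
  define u where "u m = a + (b - a) * inverse (real (Suc m))" for m :: nat
  have u: "a < u m" "u m \<le> b" "0 \<le> u m" "u m \<le> T" for m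
  proof -
    show "a < u m" using ab by (simp add: u_def)
    have "(b - a) * inverse (real (Suc m)) \<le> (b - a) * 1"
      using ab by (intro mult_left_mono) (auto simp: inverse_eq_divide)
    then show "u m \<le> b" by (simp add: u_def)
    then show "u m \<le> T" using ab by simp
    show "0 \<le> u m" using \<open>a < u m\<close> ab by simp
  qed
  have ulim: "u \<longlonglongrightarrow> a"
  proof -
    have "(\<lambda>m. a + (b - a) * inverse (real (Suc m))) \<longlonglongrightarrow> a + (b - a) * 0"
      by (intro tendsto_intros LIMSEQ_inverse_real_of_nat)
    then show ?thesis by (simp add: u_def[abs_def])
  qed
  have Eu: "E \<in> sigma_sets (space P) (past_events P T (B ` {..n}) (u m))" for m
    using E u(1)[of m] unfolding sets_augmented_filtration by auto
  define D where "D k i v \<omega> = (B k b \<omega> - B k v \<omega>) $ i" for k i v \<omega>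
  have Dsq: "square_integrable P (D k i v)" if "k \<le> n" "0 \<le> v" "v \<le> b" for k i v
    unfolding D_def using that ab by (intro sq(1)) auto
  have Dlim: "l2_tendsto P (\<lambda>m. D k i (u m)) (D k i a)" if "k \<le> n" for k i
  proof -
    have "norm (D k i (u m) \<omega> - D k i a \<omega>) = norm ((B k (u m) \<omega> - B k a \<omega>) $ i)" for m \<omega>
      by (simp add: D_def)
    then have "(sqnorm P (\<lambda>\<omega>. D k i (u m) \<omega> - D k i a \<omega>)) = ennreal (u m - a)" for m
      using sq(2)[OF that ab(1) less_imp_le[OF u(1)[of m]] u(4)[of m], of i] by simp
    moreover have "(\<lambda>m. ennreal (u m - a)) \<longlonglongrightarrow> ennreal (a - a)"
      by (intro tendsto_intros ulim)
    ultimately show ?thesis by (simp add: l2_tendsto_def)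
  qed
  have indsq: "square_integrable P (\<lambda>\<omega>. indicator E \<omega> * X \<omega>)" if "square_integrable P X" for X :: "'a \<times> 'b \<Rightarrow> real"
    unfolding square_integrable_def
  proof
    show "(\<lambda>\<omega>. indicator E \<omega> * X \<omega>) \<in> borel_measurable P" using that EP by measurable
    have "(sqnorm P (\<lambda>\<omega>. indicator E \<omega> * X \<omega>)) \<le> (sqnorm P X)"
      by (intro nn_integral_mono) (auto simp: indicator_def)
    then show "(sqnorm P (\<lambda>\<omega>. indicator E \<omega> * X \<omega>)) < \<infinity>"
      using that by (simp add: square_integrable_def order.strict_trans1)
  qed
  have indlim: "l2_tendsto P (\<lambda>m \<omega>. indicator E \<omega> * D k i (u m) \<omega>) (\<lambda>\<omega>. indicator E \<omega> * D k i a \<omega>)" if "k \<le> n" for k i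
    unfolding l2_tendsto_def
  proof (rule tendsto_sandwich[OF _ _ tendsto_const])
    show "\<forall>\<^sub>F m in sequentially. (sqnorm P (\<lambda>\<omega>. indicator E \<omega> * D k i (u m) \<omega> - indicator E \<omega> * D k i a \<omega>))
        \<le> (sqnorm P (\<lambda>\<omega>. D k i (u m) \<omega> - D k i a \<omega>))"
      by (intro always_eventually allI nn_integral_mono) (auto simp: indicator_def)
    show "(\<lambda>m. \<integral>\<^sup>+\<omega>. ennreal ((norm (D k i (u m) \<omega> - D k i a \<omega>))\<^sup>2) \<partial>P) \<longlonglongrightarrow> 0"
      using Dlim[OF that] by (simp add: l2_tendsto_def)
  qed auto
  have one: "square_integrable P (\<lambda>\<omega>. 1 :: real)" by (simp add: square_integrable_def P.emeasure_space_1)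
  have Du: "square_integrable P (D k i (u m))" "square_integrable P (D k i a)" if "k \<le> n" for k i m
    using u[of m] ab that by (auto intro!: Dsq)
  have "(\<lambda>m. \<integral>\<omega>. (indicator E \<omega> * D k i (u m) \<omega>) \<bullet> 1 \<partial>P) \<longlonglongrightarrow> (\<integral>\<omega>. (indicator E \<omega> * D k i a \<omega>) \<bullet> 1 \<partial>P)"
    by (rule l2_tendsto_inner[OF indlim indsq[OF Du(1)] indsq[OF Du(2)] l2_tendsto_const one one]) (use kl in auto)
  moreover have "(\<integral>\<omega>. (indicator E \<omega> * D k i (u m) \<omega>) \<bullet> 1 \<partial>P) = 0" for m
    using mom(2)[OF _ u(3) u(2) ab(3) Eu kl] by (simp add: D_def)
  ultimately show ?g1
    by (simp add: D_def LIMSEQ_const_iff)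
  have "(\<lambda>m. \<integral>\<omega>. (indicator E \<omega> * D k i (u m) \<omega>) \<bullet> D l j (u m) \<omega> \<partial>P) \<longlonglongrightarrow> (\<integral>\<omega>. (indicator E \<omega> * D k i a \<omega>) \<bullet> D l j a \<omega> \<partial>P)"
    by (rule l2_tendsto_inner[OF indlim indsq[OF Du(1)] indsq[OF Du(2)] Dlim Du]) (use kl in auto)
  moreover have "(\<integral>\<omega>. (indicator E \<omega> * D k i (u m) \<omega>) \<bullet> D l j (u m) \<omega> \<partial>P) = measure P E * (of_bool (k = l \<and> i = j) * (b - u m))" for m
    using mom(4)[OF _ u(3) u(2) ab(3) Eu kl, of m i j] by (simp add: D_def mult.assoc)
  ultimately have "(\<lambda>m. measure P E * (of_bool (k = l \<and> i = j) * (b - u m))) \<longlonglongrightarrow> (\<integral>\<omega>. (indicator E \<omega> * D k i a \<omega>) \<bullet> D l j a \<omega> \<partial>P)"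
    by simp
  moreover have "(\<lambda>m. measure P E * (of_bool (k = l \<and> i = j) * (b - u m))) \<longlonglongrightarrow> measure P E * (of_bool (k = l \<and> i = j) * (b - a))"
    by (intro tendsto_intros ulim)
  ultimately show ?g2
    using LIMSEQ_unique by (fastforce simp: D_def mult.assoc)
qed

section \<open>Elementary stochastic integrals\<close>

lemma square_integrable_bounded_mult:
  fixes X Y :: "'w \<Rightarrow> real"
  assumes Y: "square_integrable M Y" and X: "X \<in> borel_measurable M" and b: "\<And>\<omega>. \<omega> \<in> space M \<Longrightarrow> \<bar>X \<omega>\<bar> \<le> C"
  shows "square_integrable M (\<lambda>\<omega>. X \<omega> * Y \<omega>)"
  unfolding square_integrable_def
proof
  have [measurable]: "X \<in> borel_measurable M" "Y \<in> borel_measurable M" using X Y by auto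
  show "(\<lambda>\<omega>. X \<omega> * Y \<omega>) \<in> borel_measurable M" by measurable
  have "(sqnorm M (\<lambda>\<omega>. X \<omega> * Y \<omega>)) \<le> (\<integral>\<^sup>+\<omega>. ennreal (C\<^sup>2) * ennreal ((norm (Y \<omega>))\<^sup>2) \<partial>M)"
  proof (rule nn_integral_mono)
    fix \<omega> assume "\<omega> \<in> space M"
    then have "\<bar>X \<omega>\<bar>\<^sup>2 \<le> C\<^sup>2" using b by (intro power_mono) auto
    then have "(norm (X \<omega> * Y \<omega>))\<^sup>2 \<le> C\<^sup>2 * (norm (Y \<omega>))\<^sup>2"
      by (simp add: power_mult_distrib mult_right_mono)
    then show "ennreal ((norm (X \<omega> * Y \<omega>))\<^sup>2) \<le> ennreal (C\<^sup>2) * ennreal ((norm (Y \<omega>))\<^sup>2)"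
      by (simp add: ennreal_mult[symmetric])
  qed
  also have "\<dots> = ennreal (C\<^sup>2) * (sqnorm M Y)"
    by (rule nn_integral_cmult) measurable
  also have "\<dots> < \<infinity>" using Y by (simp add: square_integrable_def ennreal_mult_less_top)
  finally show "(sqnorm M (\<lambda>\<omega>. X \<omega> * Y \<omega>)) < \<infinity>" .
qed

lemma square_integrable_mult_integrable:
  fixes X Y :: "'w \<Rightarrow> real"
  assumes "square_integrable M X" "square_integrable M Y"
  shows "integrable M (\<lambda>\<omega>. X \<omega> * Y \<omega>)"
  using square_integrable_inner_integrable[OF assms] by simp

lemma square_integrable_vec_nth:
  fixes X :: "'w \<Rightarrow> 'x::euclidean_space^'n"
  assumes "square_integrable M X"
  shows "square_integrable M (\<lambda>\<omega>. X \<omega> $ i)"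
  unfolding square_integrable_def
proof
  have X[measurable]: "X \<in> borel_measurable M" using assms by auto
  show "(\<lambda>\<omega>. X \<omega> $ i) \<in> borel_measurable M"
    by (rule measurable_compose[OF X borel_measurable_continuous_onI]) (intro continuous_intros)
  have "(sqnorm M (\<lambda>\<omega>. X \<omega> $ i)) \<le> (sqnorm M X)"
    by (intro nn_integral_mono ennreal_leI power_mono Finite_Cartesian_Product.norm_nth_le norm_ge_zero)
  then show "(sqnorm M (\<lambda>\<omega>. X \<omega> $ i)) < \<infinity>"
    using assms by (simp add: square_integrable_def order.strict_trans1)
qed

lemma measurable_vec_nth_comp:
  fixes X :: "'w \<Rightarrow> 'x::euclidean_space^'n"
  assumes "X \<in> borel_measurable M"
  shows "(\<lambda>\<omega>. X \<omega> $ i) \<in> borel_measurable M"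
  by (rule measurable_compose[OF assms borel_measurable_continuous_onI]) (intro continuous_intros)

text \<open>The properties of the noises and of the filtration on which the stochastic integration rests: given the past,
  an increment has mean \<open>0\<close> and the second moments of a Brownian increment, and different motions are
  uncorrelated.\<close>

locale brownian_basis = prob_space P for P :: "'w measure" +
  fixes T :: real and F :: "real \<Rightarrow> 'w measure" and K :: "'k set" and B :: "'k \<Rightarrow> real \<Rightarrow> 'w \<Rightarrow> real^'d"
  assumes T_pos: "T > 0"
    and finite_K: "finite K"
    and space_F: "\<And>t. space (F t) = space P"
    and F_sub: "\<And>t. sets (F t) \<subseteq> sets P"
    and F_mono: "\<And>s t. s \<le> t \<Longrightarrow> sets (F s) \<subseteq> sets (F t)"
    and adapted: "\<And>k t. k \<in> K \<Longrightarrow> 0 \<le> t \<Longrightarrow> t \<le> T \<Longrightarrow> B k t \<in> borel_measurable (F t)"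
    and increment_mean: "\<And>k a b E i. k \<in> K \<Longrightarrow> 0 \<le> a \<Longrightarrow> a < b \<Longrightarrow> b \<le> T \<Longrightarrow> E \<in> sets (F a) \<Longrightarrow>
      (\<integral>\<omega>. indicator E \<omega> * (B k b \<omega> - B k a \<omega>) $ i \<partial>P) = 0"
    and increment_covariance: "\<And>k l a b E i j. k \<in> K \<Longrightarrow> l \<in> K \<Longrightarrow> 0 \<le> a \<Longrightarrow> a < b \<Longrightarrow> b \<le> T \<Longrightarrow> E \<in> sets (F a) \<Longrightarrow>
      (\<integral>\<omega>. indicator E \<omega> * ((B k b \<omega> - B k a \<omega>) $ i * (B l b \<omega> - B l a \<omega>) $ j) \<partial>P) =
      measure P E * (of_bool (k = l \<and> i = j) * (b - a))"
begin

lemma measurable_F_mono: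
  assumes "f \<in> measurable (F s) N" "s \<le> t"
  shows "f \<in> measurable (F t) N"
  by (rule measurable_mono[THEN subsetD, OF order_refl refl _ _ assms(1)]) (use F_mono[OF assms(2)] in \<open>auto simp: space_F\<close>)

lemma measurable_F_P:
  assumes "f \<in> measurable (F s) N"
  shows "f \<in> measurable P N"
  by (rule measurable_mono[THEN subsetD, OF order_refl refl _ _ assms(1)]) (use F_sub in \<open>auto simp: space_F\<close>)

definition incr :: "'k \<Rightarrow> 'd \<Rightarrow> real \<Rightarrow> real \<Rightarrow> 'w \<Rightarrow> real" where
  "incr k i a b \<omega> = (B k b \<omega> - B k a \<omega>) $ i"

lemma incr_measurable:
  assumes "k \<in> K" "0 \<le> a" "a \<le> b" "b \<le> T"
  shows "incr k i a b \<in> borel_measurable (F b)"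
  unfolding incr_def using assms
  by (intro measurable_vec_nth_comp borel_measurable_diff adapted measurable_F_mono[OF adapted, of k a b]) auto

lemma incr_square_integrable:
  assumes "k \<in> K" "0 \<le> a" "a \<le> b" "b \<le> T"
  shows "square_integrable P (incr k i a b)"
proof (cases "a < b")
  case True
  have "(\<integral>\<omega>. indicator (space P) \<omega> * (incr k i a b \<omega> * incr k i a b \<omega>) \<partial>P) = b - a"
    using increment_covariance[OF assms(1,1,2) True assms(4), of "space P" i i] sets.top[of "F a"]
    by (simp add: incr_def space_F prob_space)
  (* The Bochner integral of a function that is not integrable is 0, so a value different from 0 proves integrability. *)
  then have "integrable P (\<lambda>\<omega>. indicator (space P) \<omega> * (incr k i a b \<omega> * incr k i a b \<omega>))"
    using True not_integrable_integral_eq by fastforce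
  then have "integrable P (\<lambda>\<omega>. (norm (incr k i a b \<omega>))\<^sup>2)"
    by (rule Bochner_Integration.integrable_cong[THEN iffD1, OF refl, rotated]) (auto simp: power2_eq_square)
  then show ?thesis using measurable_F_P[OF incr_measurable[OF assms]] by (simp add: square_integrable_iff)
next
  case False
  then have "incr k i a b = (\<lambda>_. 0)" using assms by (auto simp: incr_def)
  then show ?thesis by (simp add: square_integrable_def)
qed

lemma subalgebra_F: "sigma_finite_subalgebra P (F a)"
proof -
  have "finite_measure_subalgebra P (F a)"
    by standard (auto simp: subalgebra_def space_F F_sub)
  then interpret finite_measure_subalgebra P "F a" .
  show ?thesis by (rule sigma_finite_subalgebra_axioms)
qed

text \<open>By hypothesis the constant \<open>c\<close> is a version of the conditional expectation of \<open>g\<close> given \<open>F a\<close>.\<close>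

lemma integral_mult_conditional:
  assumes g: "integrable P g" and c: "\<And>E. E \<in> sets (F a) \<Longrightarrow> (\<integral>\<omega>. indicator E \<omega> * g \<omega> \<partial>P) = measure P E * c"
    and X: "X \<in> borel_measurable (F a)" and Xg: "integrable P (\<lambda>\<omega>. X \<omega> * g \<omega>)"
  shows "(\<integral>\<omega>. X \<omega> * g \<omega> \<partial>P) = c * (\<integral>\<omega>. X \<omega> \<partial>P)"
proof -
  interpret sigma_finite_subalgebra P "F a" by (rule subalgebra_F)
  have "AE \<omega> in P. real_cond_exp P (F a) g \<omega> = c"
  proof (rule real_cond_exp_charact[OF _ g])
    fix E assume E: "E \<in> sets (F a)"
    then have "E \<in> sets P" using F_sub by blast
    then show "set_lebesgue_integral P E g = (LINT \<omega>:E|P. c)"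
      using c[OF E] by (simp add: set_lebesgue_integral_def)
  qed auto
  moreover have "X \<in> borel_measurable P" using X by (rule measurable_F_P)
  ultimately have "(\<integral>\<omega>. X \<omega> * real_cond_exp P (F a) g \<omega> \<partial>P) = (\<integral>\<omega>. X \<omega> * c \<partial>P)"
    by (intro integral_cong_AE) auto
  also have "(\<integral>\<omega>. X \<omega> * real_cond_exp P (F a) g \<omega> \<partial>P) = (\<integral>\<omega>. X \<omega> * g \<omega> \<partial>P)"
    using g by (intro real_cond_exp_intg(2)[OF Xg X]) auto
  finally show ?thesis by (simp add: mult.commute)
qed

lemma mean_incr:
  assumes "k \<in> K" "0 \<le> a" "a \<le> b" "b \<le> T" and X: "X \<in> borel_measurable (F a)" "square_integrable P X"
  shows "(\<integral>\<omega>. X \<omega> * incr k i a b \<omega> \<partial>P) = 0"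
proof (cases "a < b")
  case True
  have "integrable P (incr k i a b)"
    using square_integrable_mult_integrable[OF _ incr_square_integrable[OF assms(1-4)], of "\<lambda>_. 1"]
    by (simp add: square_integrable_def emeasure_space_1)
  from integral_mult_conditional[OF this _ X(1), of 0] show ?thesis
    using increment_mean[OF assms(1,2) True assms(4)] square_integrable_mult_integrable[OF X(2) incr_square_integrable[OF assms(1-4)]]
    by (simp add: incr_def)
qed (use assms in \<open>auto simp: incr_def\<close>)

definition bounded_on :: "('w \<Rightarrow> 'x::real_normed_vector) \<Rightarrow> bool" where
  "bounded_on H \<longleftrightarrow> (\<exists>C. \<forall>\<omega>\<in>space P. norm (H \<omega>) \<le> C)"

lemma bounded_on_mult:
  fixes X Y :: "'w \<Rightarrow> real"
  shows "bounded_on X \<Longrightarrow> bounded_on Y \<Longrightarrow> bounded_on (\<lambda>\<omega>. X \<omega> * Y \<omega>)"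
proof -
  assume "bounded_on X" "bounded_on Y"
  then obtain C D where "\<forall>\<omega>\<in>space P. \<bar>X \<omega>\<bar> \<le> C" "\<forall>\<omega>\<in>space P. \<bar>Y \<omega>\<bar> \<le> D" by (auto simp: bounded_on_def)
  then have "\<forall>\<omega>\<in>space P. \<bar>X \<omega> * Y \<omega>\<bar> \<le> C * D" unfolding abs_mult by (intro ballI mult_mono') auto
  then show ?thesis by (auto simp: bounded_on_def)
qed

lemma bounded_on_integrable:
  fixes X :: "'w \<Rightarrow> real"
  shows "bounded_on X \<Longrightarrow> X \<in> borel_measurable P \<Longrightarrow> integrable P X"
  unfolding bounded_on_def by (elim exE, rule integrable_const_bound) (auto intro: AE_I2)

lemma bounded_on_square_integrable_mult:
  fixes X :: "'w \<Rightarrow> real"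
  shows "bounded_on X \<Longrightarrow> X \<in> borel_measurable P \<Longrightarrow> square_integrable P Y \<Longrightarrow> square_integrable P (\<lambda>\<omega>. X \<omega> * Y \<omega>)"
  by (auto simp: bounded_on_def intro!: square_integrable_bounded_mult)

lemma covariance_incr:
  assumes kl: "k \<in> K" "l \<in> K" and ab: "0 \<le> a" "a \<le> b" "b \<le> T" and X: "X \<in> borel_measurable (F a)" "bounded_on X"
  shows "(\<integral>\<omega>. X \<omega> * (incr k i a b \<omega> * incr l j a b \<omega>) \<partial>P) = of_bool (k = l \<and> i = j) * (b - a) * (\<integral>\<omega>. X \<omega> \<partial>P)"
proof (cases "a < b")
  case True
  have s: "square_integrable P (incr k i a b)" "square_integrable P (incr l j a b)"
    using kl ab by (auto intro: incr_square_integrable)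
  have "integrable P (\<lambda>\<omega>. (X \<omega> * incr k i a b \<omega>) * incr l j a b \<omega>)"
    by (rule square_integrable_mult_integrable[OF bounded_on_square_integrable_mult[OF X(2) measurable_F_P[OF X(1)] s(1)] s(2)])
  then have "integrable P (\<lambda>\<omega>. X \<omega> * (incr k i a b \<omega> * incr l j a b \<omega>))" by (simp add: mult.assoc)
  from integral_mult_conditional[OF square_integrable_mult_integrable[OF s] _ X(1) this, of "of_bool (k = l \<and> i = j) * (b - a)"]
  show ?thesis using increment_covariance[OF kl ab(1) True ab(3)] by (simp add: incr_def)
qed (use assms in \<open>auto simp: incr_def\<close>)

definition overlap :: "real \<Rightarrow> real \<Rightarrow> real \<Rightarrow> real \<Rightarrow> real" where
  "overlap a b a' b' = max 0 (min b b' - max a a')"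

text \<open>Cutting the two intervals at each other's end points leaves pairs of disjoint intervals and a common interval. On
  disjoint intervals the later increment is centred given the other factors, so that only the
  overlap contributes.\<close>

lemma scalar_isometry:
  assumes kl: "k \<in> K" "l \<in> K" and ab: "0 \<le> a" "a \<le> b" "b \<le> T" and ab': "0 \<le> a'" "a' \<le> b'" "b' \<le> T"
    and X: "X \<in> borel_measurable (F a)" "bounded_on X" and X': "X' \<in> borel_measurable (F a')" "bounded_on X'"
  shows "(\<integral>\<omega>. (X \<omega> * incr k i a b \<omega>) * (X' \<omega> * incr l j a' b' \<omega>) \<partial>P) =
    of_bool (k = l \<and> i = j) * overlap a b a' b' * (\<integral>\<omega>. X \<omega> * X' \<omega> \<partial>P)"
proof -
  have mP: "f \<in> borel_measurable P" if "f \<in> borel_measurable (F a)" for f :: "'w \<Rightarrow> real" and a using that by (rule measurable_F_P)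
  have sq: "square_integrable P (\<lambda>\<omega>. X \<omega> * incr k i a b \<omega>)"
    if "k \<in> K" "0 \<le> a" "a \<le> b" "b \<le> T" "X \<in> borel_measurable P" "bounded_on X" for X k i a b
    using that by (intro bounded_on_square_integrable_mult incr_square_integrable) auto
  have disj: "(\<integral>\<omega>. (X \<omega> * incr k i a b \<omega>) * (X' \<omega> * incr l j a' b' \<omega>) \<partial>P) = 0"
    if "k \<in> K" "l \<in> K" "0 \<le> a" "a \<le> b" "b \<le> a'" "a' \<le> b'" "b' \<le> T" "X \<in> borel_measurable (F a)" "bounded_on X"
      "X' \<in> borel_measurable (F a')" "bounded_on X'" for X X' k l i j a b a' b'
  proof -
    have "incr k i a b \<in> borel_measurable (F a')"
      using that by (intro measurable_F_mono[OF incr_measurable, of k a b a']) auto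
    moreover have "X \<in> borel_measurable (F a')" using that by (auto intro: measurable_F_mono)
    ultimately have m: "(\<lambda>\<omega>. X' \<omega> * (X \<omega> * incr k i a b \<omega>)) \<in> borel_measurable (F a')"
      using that by (intro borel_measurable_times) auto
    have s: "square_integrable P (\<lambda>\<omega>. X' \<omega> * (X \<omega> * incr k i a b \<omega>))"
      using that by (intro bounded_on_square_integrable_mult sq[of k a b X]) (auto intro: mP)
    have "(\<integral>\<omega>. (X' \<omega> * (X \<omega> * incr k i a b \<omega>)) * incr l j a' b' \<omega> \<partial>P) = 0"
      using that by (intro mean_incr[OF _ _ _ _ m s]) auto
    then show ?thesis by (simp add: mult_ac)
  qed
  have split: "(\<integral>\<omega>. (X \<omega> * incr k i a c \<omega>) * Y \<omega> \<partial>P) =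
      (\<integral>\<omega>. (X \<omega> * incr k i a b \<omega>) * Y \<omega> \<partial>P) + (\<integral>\<omega>. (X \<omega> * incr k i b c \<omega>) * Y \<omega> \<partial>P)"
    if "k \<in> K" "0 \<le> a" "a \<le> b" "b \<le> c" "c \<le> T" "X \<in> borel_measurable P" "bounded_on X" "square_integrable P Y"
    for X k i a b c Y
  proof -
    have "(\<integral>\<omega>. (X \<omega> * incr k i a c \<omega>) * Y \<omega> \<partial>P) =
      (\<integral>\<omega>. (X \<omega> * incr k i a b \<omega>) * Y \<omega> + (X \<omega> * incr k i b c \<omega>) * Y \<omega> \<partial>P)"
      by (intro Bochner_Integration.integral_cong) (auto simp: incr_def algebra_simps)
    also have "\<dots> = (\<integral>\<omega>. (X \<omega> * incr k i a b \<omega>) * Y \<omega> \<partial>P) + (\<integral>\<omega>. (X \<omega> * incr k i b c \<omega>) * Y \<omega> \<partial>P)"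
      using that by (intro Bochner_Integration.integral_add square_integrable_mult_integrable sq) auto
    finally show ?thesis .
  qed
  have same: "(\<integral>\<omega>. (X \<omega> * incr k i a b \<omega>) * (X' \<omega> * incr l j a b' \<omega>) \<partial>P) =
      of_bool (k = l \<and> i = j) * (b - a) * (\<integral>\<omega>. X \<omega> * X' \<omega> \<partial>P)"
    if h: "k \<in> K" "l \<in> K" "0 \<le> a" "a \<le> b" "b \<le> b'" "b' \<le> T" "X \<in> borel_measurable (F a)" "bounded_on X"
      "X' \<in> borel_measurable (F a)" "bounded_on X'" for X X' k l i j a b b'
  proof -
    have "(\<integral>\<omega>. (X' \<omega> * incr l j a b' \<omega>) * (X \<omega> * incr k i a b \<omega>) \<partial>P) =
       (\<integral>\<omega>. (X' \<omega> * incr l j a b \<omega>) * (X \<omega> * incr k i a b \<omega>) \<partial>P) + (\<integral>\<omega>. (X' \<omega> * incr l j b b' \<omega>) * (X \<omega> * incr k i a b \<omega>) \<partial>P)"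
      using h by (intro split sq mP[of _ a]) auto
    also have "(\<integral>\<omega>. (X' \<omega> * incr l j b b' \<omega>) * (X \<omega> * incr k i a b \<omega>) \<partial>P) = 0"
      using disj[of k l a b b b' X X' i j] h measurable_F_mono[OF h(9,4)] by (simp add: mult.commute)
    also have "(\<integral>\<omega>. (X' \<omega> * incr l j a b \<omega>) * (X \<omega> * incr k i a b \<omega>) \<partial>P) =
       (\<integral>\<omega>. (X \<omega> * X' \<omega>) * (incr k i a b \<omega> * incr l j a b \<omega>) \<partial>P)"
      by (intro Bochner_Integration.integral_cong) auto
    also have "\<dots> = of_bool (k = l \<and> i = j) * (b - a) * (\<integral>\<omega>. X \<omega> * X' \<omega> \<partial>P)"
      using h by (intro covariance_incr borel_measurable_times bounded_on_mult) auto
    finally show ?thesis by (simp add: mult.commute)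
  qed
  have le: "(\<integral>\<omega>. (X \<omega> * incr k i a b \<omega>) * (X' \<omega> * incr l j a' b' \<omega>) \<partial>P) =
    of_bool (k = l \<and> i = j) * overlap a b a' b' * (\<integral>\<omega>. X \<omega> * X' \<omega> \<partial>P)"
    if h: "k \<in> K" "l \<in> K" "0 \<le> a" "a \<le> b" "b \<le> T" "0 \<le> a'" "a' \<le> b'" "b' \<le> T" "a \<le> a'"
      "X \<in> borel_measurable (F a)" "bounded_on X" "X' \<in> borel_measurable (F a')" "bounded_on X'" for X X' k l i j a b a' b'
  proof (cases "b \<le> a'")
    case True
    then show ?thesis using disj[of k l a b a' b' X X' i j] h by (auto simp: overlap_def)
  next
    case False
    have Xm: "X \<in> borel_measurable (F a')" using h by (auto intro: measurable_F_mono)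
    have "(\<integral>\<omega>. (X \<omega> * incr k i a b \<omega>) * (X' \<omega> * incr l j a' b' \<omega>) \<partial>P) =
      (\<integral>\<omega>. (X \<omega> * incr k i a a' \<omega>) * (X' \<omega> * incr l j a' b' \<omega>) \<partial>P) + (\<integral>\<omega>. (X \<omega> * incr k i a' b \<omega>) * (X' \<omega> * incr l j a' b' \<omega>) \<partial>P)"
      using h False by (intro split sq mP[of X a] mP[of X' a']) auto
    also have "(\<integral>\<omega>. (X \<omega> * incr k i a a' \<omega>) * (X' \<omega> * incr l j a' b' \<omega>) \<partial>P) = 0"
      using h False by (intro disj) auto
    also have "(\<integral>\<omega>. (X \<omega> * incr k i a' b \<omega>) * (X' \<omega> * incr l j a' b' \<omega>) \<partial>P) =
       of_bool (k = l \<and> i = j) * overlap a b a' b' * (\<integral>\<omega>. X \<omega> * X' \<omega> \<partial>P)"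
    proof (cases "b \<le> b'")
      case True
      then have "overlap a b a' b' = b - a'" using False h by (auto simp: overlap_def)
      then show ?thesis using same[of k l a' b b' X X' i j] h Xm True False by simp
    next
      case F2: False
      then have "overlap a b a' b' = b' - a'" using False h by (auto simp: overlap_def)
      moreover have "(\<integral>\<omega>. (X' \<omega> * incr l j a' b' \<omega>) * (X \<omega> * incr k i a' b \<omega>) \<partial>P) =
          of_bool (l = k \<and> j = i) * (b' - a') * (\<integral>\<omega>. X' \<omega> * X \<omega> \<partial>P)"
        using h Xm F2 False by (intro same) auto
      ultimately show ?thesis by (auto simp: mult.commute)
    qed
    finally show ?thesis by simp
  qed
  show ?thesis
  proof (cases "a \<le> a'")
    case True then show ?thesis using assms by (intro le) auto
  next
    case False
    then have "(\<integral>\<omega>. (X' \<omega> * incr l j a' b' \<omega>) * (X \<omega> * incr k i a b \<omega>) \<partial>P) =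
      of_bool (l = k \<and> j = i) * overlap a' b' a b * (\<integral>\<omega>. X' \<omega> * X \<omega> \<partial>P)"
      using assms by (intro le) auto
    moreover have "overlap a' b' a b = overlap a b a' b'" by (auto simp: overlap_def max_def min_def)
    ultimately show ?thesis by (auto simp: mult.commute)
  qed
qed

end

lemma square_integrable_sum:
  fixes f :: "'i \<Rightarrow> 'a \<Rightarrow> 'x::euclidean_space"
  assumes "\<And>i. i \<in> I \<Longrightarrow> square_integrable M (f i)"
  shows "square_integrable M (\<lambda>x. \<Sum>i\<in>I. f i x)"
  using assms
proof (induction I rule: infinite_finite_induct)
  case (insert i I) then show ?case by (simp add: square_integrable_add)
qed (simp_all add: square_integrable_def)

lemma measurable_vecI:
  fixes X :: "'w \<Rightarrow> real^'n"
  assumes "\<And>r. (\<lambda>\<omega>. X \<omega> $ r) \<in> borel_measurable M"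
  shows "X \<in> borel_measurable M"
  by (rule borel_measurable_euclidean_space[THEN iffD2]) (use assms in \<open>auto simp: Basis_vec_def inner_axis\<close>)

lemma norm_vec_square: "(norm x)\<^sup>2 = (\<Sum>r\<in>UNIV. (norm (x $ r))\<^sup>2)" for x :: "real^'n"
  by (simp add: norm_vec_def L2_set_def sum_nonneg)

lemma square_integrable_vecI:
  fixes X :: "'w \<Rightarrow> real^'n"
  assumes "\<And>r. square_integrable M (\<lambda>\<omega>. X \<omega> $ r)"
  shows "square_integrable M X"
  using assms measurable_vecI[of X M]
  by (auto simp: square_integrable_iff norm_vec_square intro!: Bochner_Integration.integrable_sum)

lemma matrix_vector_inner:
  fixes H H' :: "real^'d^'m"
  shows "(H *v x) \<bullet> (H' *v y) = (\<Sum>r\<in>UNIV. \<Sum>i\<in>UNIV. \<Sum>j\<in>UNIV. (H $ r $ i * x $ i) * (H' $ r $ j * y $ j))"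
  by (simp add: inner_vec_def matrix_vector_mult_def sum_product)

lemma inner_matrix_vector:
  fixes H :: "real^'d^'m"
  shows "v \<bullet> (H *v x) = (\<Sum>r\<in>UNIV. \<Sum>i\<in>UNIV. (v $ r * H $ r $ i) * x $ i)"
  by (simp add: inner_vec_def matrix_vector_mult_def sum_distrib_left mult.assoc)

lemma inner_matrix:
  fixes H H' :: "real^'d^'m"
  shows "H \<bullet> H' = (\<Sum>r\<in>UNIV. \<Sum>i\<in>UNIV. H $ r $ i * H' $ r $ i)"
  by (simp add: inner_vec_def)

text \<open>The projection onto \<open>[s, t]\<close>: between \<open>s\<close> and \<open>t\<close>, an elementary integral over \<open>]a, b]\<close> gains its value over
  the clipped interval.\<close>

definition clip :: "real \<Rightarrow> real \<Rightarrow> real \<Rightarrow> real" where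
  "clip s t x = max s (min x t)"

text \<open>The integrand \<open>H\<close> on \<open>]a, b]\<close> against the motion with index \<open>k\<close>, and \<open>0\<close> elsewhere. An elementary process is a list
  of such terms and not a function on a partition: the sum of processes with different partitions
  or different motions is then the concatenation of the lists.\<close>

type_synonym ('k, 'w, 'd, 'm) ito_term = "'k \<times> real \<times> real \<times> ('w \<Rightarrow> real^'d^'m)"

definition term_value :: "('k, 'w, 'd::finite, 'm::finite) ito_term \<Rightarrow> 'k \<Rightarrow> real \<Rightarrow> 'w \<Rightarrow> real^'d^'m" where
  "term_value e k r \<omega> = (case e of (k', a, b, H) \<Rightarrow> (of_bool (k' = k) * indicator {a<..b} r) *\<^sub>R H \<omega>)"

definition terms_value :: "('k, 'w, 'd::finite, 'm::finite) ito_term list \<Rightarrow> 'k \<Rightarrow> real \<Rightarrow> 'w \<Rightarrow> real^'d^'m" where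
  "terms_value L k r \<omega> = (\<Sum>e\<leftarrow>L. term_value e k r \<omega>)"

definition term_integral :: "('k \<Rightarrow> real \<Rightarrow> 'w \<Rightarrow> real^'d) \<Rightarrow> ('k, 'w, 'd::finite, 'm::finite) ito_term \<Rightarrow> real \<Rightarrow> 'w \<Rightarrow> real^'m" where
  "term_integral B e t \<omega> = (case e of (k, a, b, H) \<Rightarrow> H \<omega> *v (B k (min b t) \<omega> - B k (min a t) \<omega>))"

definition terms_integral :: "('k \<Rightarrow> real \<Rightarrow> 'w \<Rightarrow> real^'d) \<Rightarrow> ('k, 'w, 'd::finite, 'm::finite) ito_term list \<Rightarrow> real \<Rightarrow> 'w \<Rightarrow> real^'m" where
  "terms_integral B L t \<omega> = (\<Sum>e\<leftarrow>L. term_integral B e t \<omega>)"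

lemma term_integral_diff:
  assumes "s \<le> t" "a \<le> b"
  shows "term_integral B (k, a, b, H) t \<omega> - term_integral B (k, a, b, H) s \<omega> =
    H \<omega> *v (B k (clip s t b) \<omega> - B k (clip s t a) \<omega>)"
proof -
  have c: "B k (min x t) \<omega> - B k (min x s) \<omega> = B k (clip s t x) \<omega> - B k s \<omega>" for x
    using assms(1) by (auto simp: clip_def min_def max_def)
  have "(B k (min b t) \<omega> - B k (min a t) \<omega>) - (B k (min b s) \<omega> - B k (min a s) \<omega>) = B k (clip s t b) \<omega> - B k (clip s t a) \<omega>"
  proof -
    have "(B k (min b t) \<omega> - B k (min a t) \<omega>) - (B k (min b s) \<omega> - B k (min a s) \<omega>) =
      (B k (min b t) \<omega> - B k (min b s) \<omega>) - (B k (min a t) \<omega> - B k (min a s) \<omega>)" by simp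
    then show ?thesis unfolding c by simp
  qed
  then show ?thesis by (simp add: term_integral_def flip: matrix_vector_mult_diff_distrib)
qed

context brownian_basis
begin

lemma bounded_on_nth:
  fixes H :: "'w \<Rightarrow> real^'d^'m"
  assumes "bounded_on H" shows "bounded_on (\<lambda>\<omega>. H \<omega> $ r $ i)"
proof -
  obtain C where C: "\<forall>\<omega>\<in>space P. norm (H \<omega>) \<le> C" using assms by (auto simp: bounded_on_def)
  have "\<bar>H \<omega> $ r $ i\<bar> \<le> norm (H \<omega>)" for \<omega>
    using Finite_Cartesian_Product.norm_nth_le[of "H \<omega> $ r" i] Finite_Cartesian_Product.norm_nth_le[of "H \<omega>" r] by simp
  then show ?thesis using C unfolding bounded_on_def real_norm_def by (meson order_trans)
qed

lemma nth_measurable: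
  fixes H :: "'w \<Rightarrow> real^'d^'m"
  assumes "H \<in> borel_measurable M" shows "(\<lambda>\<omega>. H \<omega> $ r $ i) \<in> borel_measurable M"
  by (intro measurable_vec_nth_comp assms)

text \<open>The case distinction on \<open>a < b\<close> in the hypotheses makes the lemma applicable to clipped intervals: if \<open>a\<close>
  lies after \<open>t\<close>, then \<open>]a, b]\<close> is clipped to an empty interval at \<open>t\<close>, and \<open>H\<close>, which is known at time \<open>a\<close>,
  need not be \<open>F t\<close>-measurable.\<close>

lemma vector_isometry:
  fixes H H' :: "'w \<Rightarrow> real^'d^'m"
  assumes kl: "k \<in> K" "l \<in> K" and ab: "0 \<le> a" "a \<le> b" "b \<le> T" and ab': "0 \<le> a'" "a' \<le> b'" "b' \<le> T"
    and H: "a < b \<Longrightarrow> H \<in> borel_measurable (F a)" "bounded_on H"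
    and H': "a' < b' \<Longrightarrow> H' \<in> borel_measurable (F a')" "bounded_on H'"
  shows "square_integrable P (\<lambda>\<omega>. H \<omega> *v (B k b \<omega> - B k a \<omega>))" (is ?sq)
    and "(\<integral>\<omega>. (H \<omega> *v (B k b \<omega> - B k a \<omega>)) \<bullet> (H' \<omega> *v (B l b' \<omega> - B l a' \<omega>)) \<partial>P) =
      of_bool (k = l) * overlap a b a' b' * (\<integral>\<omega>. H \<omega> \<bullet> H' \<omega> \<partial>P)" (is ?iso)
proof -
  have sq: "square_integrable P (\<lambda>\<omega>. H \<omega> $ r $ i * incr k i a b \<omega>)"
    if "k \<in> K" "0 \<le> a" "a < b" "b \<le> T" "H \<in> borel_measurable (F a)" "bounded_on H" for H :: "'w \<Rightarrow> real^'d^'m" and r i k a b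
    using that by (intro bounded_on_square_integrable_mult incr_square_integrable bounded_on_nth nth_measurable measurable_F_P) auto
  show ?sq
  proof (cases "a < b")
    case True
    show ?thesis
      by (rule square_integrable_vecI)
        (simp add: matrix_vector_mult_def, rule square_integrable_sum,
          use sq[OF kl(1) ab(1) True ab(3) H(1)[OF True] H(2)] in \<open>simp add: incr_def\<close>)
  next
    case False then show ?thesis using ab by (simp add: square_integrable_def)
  qed
  show ?iso
  proof (cases "a < b \<and> a' < b'")
    case True
    then have ne: "a < b" "a' < b'" by auto
    note h = H(1)[OF ne(1)] and h' = H'(1)[OF ne(2)]
    have I: "integrable P (\<lambda>\<omega>. (H \<omega> $ r $ i * incr k i a b \<omega>) * (H' \<omega> $ r $ j * incr l j a' b' \<omega>))" for r i j
      by (rule square_integrable_mult_integrable[OF sq[OF kl(1) ab(1) ne(1) ab(3) h H(2)] sq[OF kl(2) ab'(1) ne(2) ab'(3) h' H'(2)]])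
    have J: "integrable P (\<lambda>\<omega>. H \<omega> $ r $ i * H' \<omega> $ r $ i)" for r i
      by (rule bounded_on_integrable[OF bounded_on_mult[OF bounded_on_nth[OF H(2)] bounded_on_nth[OF H'(2)]]
        borel_measurable_times[OF nth_measurable[OF measurable_F_P[OF h]] nth_measurable[OF measurable_F_P[OF h']]]])
    have s: "(\<integral>\<omega>. (H \<omega> $ r $ i * incr k i a b \<omega>) * (H' \<omega> $ r $ j * incr l j a' b' \<omega>) \<partial>P) =
       of_bool (k = l \<and> i = j) * overlap a b a' b' * (\<integral>\<omega>. H \<omega> $ r $ i * H' \<omega> $ r $ j \<partial>P)" for r i j
      by (rule scalar_isometry[OF kl ab ab' nth_measurable[OF h] bounded_on_nth[OF H(2)] nth_measurable[OF h'] bounded_on_nth[OF H'(2)]])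
    have "(\<integral>\<omega>. (H \<omega> *v (B k b \<omega> - B k a \<omega>)) \<bullet> (H' \<omega> *v (B l b' \<omega> - B l a' \<omega>)) \<partial>P) =
      (\<Sum>r\<in>UNIV. \<Sum>i\<in>UNIV. \<Sum>j\<in>UNIV. \<integral>\<omega>. (H \<omega> $ r $ i * incr k i a b \<omega>) * (H' \<omega> $ r $ j * incr l j a' b' \<omega>) \<partial>P)"
      unfolding matrix_vector_inner using I by (simp add: incr_def)
    also have "\<dots> = (\<Sum>r\<in>UNIV. \<Sum>i\<in>UNIV. \<Sum>j\<in>UNIV. if j = i then of_bool (k = l) * overlap a b a' b' * (\<integral>\<omega>. H \<omega> $ r $ i * H' \<omega> $ r $ i \<partial>P) else 0)"
      unfolding s by (intro sum.cong refl) auto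
    also have "\<dots> = (\<Sum>r\<in>UNIV. \<Sum>i\<in>UNIV. of_bool (k = l) * overlap a b a' b' * (\<integral>\<omega>. H \<omega> $ r $ i * H' \<omega> $ r $ i \<partial>P))"
      by simp
    also have "\<dots> = of_bool (k = l) * overlap a b a' b' * (\<integral>\<omega>. H \<omega> \<bullet> H' \<omega> \<partial>P)"
      unfolding inner_matrix using J by (simp add: sum_distrib_left)
    finally show ?thesis .
  next
    case False
    then have "a = b \<or> a' = b'" using ab ab' by auto
    moreover from this have "overlap a b a' b' = 0" using ab ab' by (auto simp: overlap_def)
    ultimately show ?thesis by auto
  qed
qed

lemma vector_orthogonality:
  fixes H :: "'w \<Rightarrow> real^'d^'m" and U :: "'w \<Rightarrow> real^'m"
  assumes k: "k \<in> K" and ab: "0 \<le> a" "a \<le> b" "b \<le> T"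
    and H: "a < b \<Longrightarrow> H \<in> borel_measurable (F a)" "bounded_on H"
    and U: "U \<in> borel_measurable (F a)" "square_integrable P U"
  shows "(\<integral>\<omega>. U \<omega> \<bullet> (H \<omega> *v (B k b \<omega> - B k a \<omega>)) \<partial>P) = 0"
proof (cases "a < b")
  case True
  note h = H(1)[OF True]
  have sq: "square_integrable P (\<lambda>\<omega>. U \<omega> $ r * H \<omega> $ r $ i)" for r i
    using bounded_on_square_integrable_mult[OF bounded_on_nth[OF H(2)] nth_measurable[OF measurable_F_P[OF h]] square_integrable_vec_nth[OF U(2)], of r i r]
    by (simp add: mult.commute)
  have m: "(\<lambda>\<omega>. U \<omega> $ r * H \<omega> $ r $ i) \<in> borel_measurable (F a)" for r i
    by (intro borel_measurable_times nth_measurable h measurable_vec_nth_comp U)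
  have I: "integrable P (\<lambda>\<omega>. (U \<omega> $ r * H \<omega> $ r $ i) * incr k i a b \<omega>)" for r i
    by (rule square_integrable_mult_integrable[OF sq incr_square_integrable[OF k ab]])
  have "(\<integral>\<omega>. U \<omega> \<bullet> (H \<omega> *v (B k b \<omega> - B k a \<omega>)) \<partial>P) =
    (\<Sum>r\<in>UNIV. \<Sum>i\<in>UNIV. \<integral>\<omega>. (U \<omega> $ r * H \<omega> $ r $ i) * incr k i a b \<omega> \<partial>P)"
    unfolding inner_matrix_vector using I by (simp add: incr_def)
  also have "\<dots> = 0" using mean_incr[OF k ab m sq] by simp
  finally show ?thesis .
qed (use ab in auto)

definition valid_term :: "('k, 'w, 'd, 'm::finite) ito_term \<Rightarrow> bool" where
  "valid_term e \<longleftrightarrow> (case e of (k, a, b, H) \<Rightarrow>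
     k \<in> K \<and> 0 \<le> a \<and> a \<le> b \<and> b \<le> T \<and> H \<in> borel_measurable (F a) \<and> bounded_on H)"

lemma clip_facts:
  assumes "0 \<le> s" "s \<le> t" "t \<le> T" "a \<le> b"
  shows "0 \<le> clip s t a" "clip s t a \<le> clip s t b" "clip s t b \<le> T" "s \<le> clip s t a"
    and "clip s t a < clip s t b \<Longrightarrow> a \<le> clip s t a"
  using assms by (auto simp: clip_def min_def max_def split: if_splits)

lemma term_increment_isometry:
  fixes e e' :: "('k, 'w, 'd, 'm::finite) ito_term"
  assumes e: "valid_term (k, a, b, H)" and e': "valid_term (k', a', b', H')" and st: "0 \<le> s" "s \<le> t" "t \<le> T"
  shows "square_integrable P (\<lambda>\<omega>. term_integral B (k, a, b, H) t \<omega> - term_integral B (k, a, b, H) s \<omega>)" (is ?g1)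
    and "(\<integral>\<omega>. (term_integral B (k, a, b, H) t \<omega> - term_integral B (k, a, b, H) s \<omega>) \<bullet>
       (term_integral B (k', a', b', H') t \<omega> - term_integral B (k', a', b', H') s \<omega>) \<partial>P) =
       of_bool (k = k') * overlap (clip s t a) (clip s t b) (clip s t a') (clip s t b') * (\<integral>\<omega>. H \<omega> \<bullet> H' \<omega> \<partial>P)" (is ?g2)
proof -
  have 1: "k \<in> K" "a \<le> b" "H \<in> borel_measurable (F a)" "bounded_on H" and 2: "k' \<in> K" "a' \<le> b'" "H' \<in> borel_measurable (F a')" "bounded_on H'"
    using e e' by (auto simp: valid_term_def)
  note c = clip_facts[OF st 1(2)] and c' = clip_facts[OF st 2(2)]
  note iso = vector_isometry[OF 1(1) 2(1) c(1-3) c'(1-3) measurable_F_mono[OF 1(3) c(5)] 1(4) measurable_F_mono[OF 2(3) c'(5)] 2(4)]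
  show ?g1
    unfolding term_integral_diff[OF st(2) 1(2)] using iso(1) .
  show ?g2
    unfolding term_integral_diff[OF st(2) 1(2)] term_integral_diff[OF st(2) 2(2)] using iso(2) .
qed

lemma term_increment_orthogonality:
  fixes U :: "'w \<Rightarrow> real^'m"
  assumes e: "valid_term e" and st: "0 \<le> s" "s \<le> t" "t \<le> T"
    and U: "U \<in> borel_measurable (F s)" "square_integrable P U"
  shows "(\<integral>\<omega>. U \<omega> \<bullet> (term_integral B e t \<omega> - term_integral B e s \<omega>) \<partial>P) = 0"
proof -
  obtain k a b H where e_eq: "e = (k, a, b, H)" by (cases e)
  have 1: "k \<in> K" "a \<le> b" "H \<in> borel_measurable (F a)" "bounded_on H"
    using e by (auto simp: valid_term_def e_eq)
  note c = clip_facts[OF st 1(2)]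
  show ?thesis unfolding e_eq term_integral_diff[OF st(2) 1(2)]
    by (rule vector_orthogonality[OF 1(1) c(1-3) measurable_F_mono[OF 1(3) c(5)] 1(4) measurable_F_mono[OF U(1) c(4)] U(2)])
qed

definition timespace :: "(real \<times> 'w) measure" where
  "timespace = restrict_space lborel {0..T} \<Otimes>\<^sub>M P"

lemma sigma_finite_time: "sigma_finite_measure (restrict_space lborel {0..T} :: real measure)"
  by (intro sigma_finite_measure_restrict_space sigma_finite_lborel) auto

text \<open>The time integral of a product of two indicator functions is the same overlap as in the covariance of
  two increments; this is why the two sides of the isometry agree for each pair of terms.\<close>

lemma integral_overlap:
  assumes st: "0 \<le> s" "s \<le> t" "t \<le> T" and ab: "0 \<le> a" "a \<le> b" "b \<le> T" and ab': "0 \<le> a'" "a' \<le> b'" "b' \<le> T"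
  defines "h \<equiv> (\<lambda>r. indicator {s..t} r * (indicator {a<..b} r * indicator {a'<..b'} r) :: real)"
  shows "integrable (restrict_space lborel {0..T}) h" (is ?g1)
    and "(\<integral>r. h r \<partial>restrict_space lborel {0..T}) = overlap (clip s t a) (clip s t b) (clip s t a') (clip s t b')" (is ?g2)
proof -
  define x y where "x = max a a'" and "y = min (min b b') t"
  define S where "S = {s..t} \<inter> {a<..b} \<inter> {a'<..b'}"
  have h: "h r = indicator S r" for r by (auto simp: h_def S_def indicator_def)
  have S0: "S \<inter> {0..T} = S" using st by (auto simp: S_def)
  have Sb: "S \<in> sets borel" by (simp add: S_def)
  have S: "S = (if x < s then {s..y} else {x<..y})" by (auto simp: S_def x_def y_def)
  have m: "measure lborel S = overlap (clip s t a) (clip s t b) (clip s t a') (clip s t b')"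
    unfolding S using st ab ab' by (auto simp: x_def y_def overlap_def clip_def min_def max_def)
  have fin: "emeasure lborel S < \<infinity>"
  proof (rule order.strict_trans1)
    show "emeasure lborel S \<le> emeasure lborel {s..t}" by (rule emeasure_mono) (auto simp: S_def)
    show "emeasure lborel {s..t} < \<infinity>" using st by simp
  qed
  have hS: "h = indicator S" by (auto simp: h)
  have "integrable lborel (indicator S :: real \<Rightarrow> real)" using Sb fin by (simp add: integrable_indicator_iff)
  then show ?g1
    by (subst integrable_restrict_space) (auto simp: hS S0 indicator_inter_arith[symmetric] Int_commute)
  have "(\<integral>r. h r \<partial>restrict_space lborel {0..T}) = (\<integral>r. indicator S r \<partial>lborel)"
    by (subst integral_restrict_space) (auto simp: hS S0 indicator_inter_arith[symmetric] Int_commute)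
  also have "\<dots> = measure lborel S" using Sb by simp
  finally show ?g2
    using m by simp
qed

lemma bounded_on_inner_integrable:
  fixes H H' :: "'w \<Rightarrow> real^'d^'m"
  assumes "bounded_on H" "bounded_on H'" "H \<in> borel_measurable P" "H' \<in> borel_measurable P"
  shows "integrable P (\<lambda>\<omega>. H \<omega> \<bullet> H' \<omega>)"
proof -
  have sq: "square_integrable P H" if b: "bounded_on H" and that: "H \<in> borel_measurable P" for H :: "'w \<Rightarrow> real^'d^'m"
  proof -
    obtain C where C: "\<forall>\<omega>\<in>space P. norm (H \<omega>) \<le> C" using b by (auto simp: bounded_on_def)
    have "integrable P (\<lambda>\<omega>. (norm (H \<omega>))\<^sup>2)"
      using C that by (intro integrable_const_bound[where B="C\<^sup>2"]) (auto intro!: AE_I2 power_mono)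
    then show ?thesis using that by (simp add: square_integrable_iff)
  qed
  show ?thesis
    by (rule square_integrable_inner_integrable[OF sq[OF assms(1,3)] sq[OF assms(2,4)]])
qed

lemma term_value_isometry:
  fixes H H' :: "'w \<Rightarrow> real^'d^'m"
  assumes e: "valid_term (k, a, b, H)" and e': "valid_term (k', a', b', H')" and st: "0 \<le> s" "s \<le> t" "t \<le> T"
  shows "integrable timespace (\<lambda>p. indicator {s..t} (fst p) * (term_value (k, a, b, H) l (fst p) (snd p) \<bullet> term_value (k', a', b', H') l (fst p) (snd p)))" (is ?g1)
    and "(\<integral>p. indicator {s..t} (fst p) * (term_value (k, a, b, H) l (fst p) (snd p) \<bullet> term_value (k', a', b', H') l (fst p) (snd p)) \<partial>timespace) =
       of_bool (k = l \<and> k' = l) * overlap (clip s t a) (clip s t b) (clip s t a') (clip s t b') * (\<integral>\<omega>. H \<omega> \<bullet> H' \<omega> \<partial>P)" (is ?g2)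
proof -
  have 1: "0 \<le> a" "a \<le> b" "b \<le> T" "H \<in> borel_measurable P" "bounded_on H" and 2: "0 \<le> a'" "a' \<le> b'" "b' \<le> T" "H' \<in> borel_measurable P" "bounded_on H'"
    using e e' by (auto simp: valid_term_def intro: measurable_F_P)
  have eq: "indicator {s..t} (fst p) * (term_value (k, a, b, H) l (fst p) (snd p) \<bullet> term_value (k', a', b', H') l (fst p) (snd p)) =
    of_bool (k = l \<and> k' = l) * ((indicator {s..t} (fst p) * (indicator {a<..b} (fst p) * indicator {a'<..b'} (fst p))) * (H (snd p) \<bullet> H' (snd p)))" for p
    by (cases "k = l"; cases "k' = l") (simp_all add: term_value_def)
  note overlap = integral_overlap[OF st 1(1-3) 2(1-3)]
  note I = bounded_on_inner_integrable[OF 1(5) 2(5) 1(4) 2(4)]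
  note pm = pair_integral_mult[OF sigma_finite_time sigma_finite_measure_axioms overlap(1) I, folded timespace_def]
  show ?g1
    unfolding eq by (rule integrable_mult_right) (use pm(1) in simp)
  show ?g2
    unfolding eq using pm(2) overlap(2) by simp
qed

end

lemma terms_value_Nil [simp]: "terms_value [] k r \<omega> = 0"
  by (simp add: terms_value_def)

lemma terms_value_append: "terms_value (L @ L') k r \<omega> = terms_value L k r \<omega> + terms_value L' k r \<omega>"
  by (simp add: terms_value_def)

lemma terms_integral_append: "terms_integral B (L @ L') t \<omega> = terms_integral B L t \<omega> + terms_integral B L' t \<omega>"
  by (simp add: terms_integral_def)

definition negate_term :: "('k, 'w, 'd::finite, 'm::finite) ito_term \<Rightarrow> ('k, 'w, 'd, 'm) ito_term" where
  "negate_term e = (case e of (k, a, b, H) \<Rightarrow> (k, a, b, \<lambda>\<omega>. - H \<omega>))"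

lemma terms_value_negate:
  fixes L :: "('k, 'w, 'd::finite, 'm::finite) ito_term list"
  shows "terms_value (map negate_term L) k r \<omega> = - terms_value L k r \<omega>"
proof -
  have "term_value (negate_term e) k r \<omega> = - term_value e k r \<omega>" for e :: "('k, 'w, 'd, 'm) ito_term"
    by (cases e) (simp add: negate_term_def term_value_def)
  then show ?thesis by (simp add: terms_value_def comp_def uminus_sum_list_map)
qed

lemma terms_integral_negate:
  fixes L :: "('k, 'w, 'd::finite, 'm::finite) ito_term list"
  shows "terms_integral B (map negate_term L) t \<omega> = - terms_integral B L t \<omega>"
proof -
  have neg: "(- M) *v x = - (M *v x)" for M :: "real^'d^'m" and x
    by (metis matrix_vector_mult_diff_rdistrib matrix_vector_mult_0 diff_0)
  have "term_integral B (negate_term e) t \<omega> = - term_integral B e t \<omega>" for e :: "('k, 'w, 'd, 'm) ito_term"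
    by (cases e) (simp add: negate_term_def term_integral_def neg)
  then show ?thesis by (simp add: terms_integral_def comp_def uminus_sum_list_map)
qed

lemma terms_value_sum: "terms_value L k r \<omega> = (\<Sum>p\<in>{0..<length L}. term_value (L ! p) k r \<omega>)"
  by (simp add: terms_value_def sum_list_sum_nth)

lemma terms_integral_sum: "terms_integral B L t \<omega> = (\<Sum>p\<in>{0..<length L}. term_integral B (L ! p) t \<omega>)"
  by (simp add: terms_integral_def sum_list_sum_nth)

lemma l2_tendsto_indicator:
  fixes f :: "nat \<Rightarrow> 'a \<Rightarrow> 'x::euclidean_space"
  assumes "l2_tendsto M f g"
  shows "l2_tendsto M (\<lambda>l x. indicator A x *\<^sub>R f l x) (\<lambda>x. indicator A x *\<^sub>R g x)"
  unfolding l2_tendsto_def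
proof (rule tendsto_sandwich[OF _ _ tendsto_const])
  show "\<forall>\<^sub>F l in sequentially. (sqnorm M (\<lambda>x. indicator A x *\<^sub>R f l x - indicator A x *\<^sub>R g x))
      \<le> (sqnorm M (\<lambda>x. f l x - g x))"
    by (intro always_eventually allI nn_integral_mono) (auto simp: indicator_def)
  show "(\<lambda>l. \<integral>\<^sup>+x. ennreal ((norm (f l x - g x))\<^sup>2) \<partial>M) \<longlonglongrightarrow> 0"
    using assms by (simp add: l2_tendsto_def)
qed auto

lemma square_integrable_indicator:
  fixes f :: "'a \<Rightarrow> 'x::euclidean_space"
  assumes f: "square_integrable M f" and A: "A \<inter> space M \<in> sets M"
  shows "square_integrable M (\<lambda>x. indicator A x *\<^sub>R f x)"
  unfolding square_integrable_def
proof
  have "(\<lambda>x. indicator (A \<inter> space M) x *\<^sub>R f x) \<in> borel_measurable M"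
    using f A by (intro borel_measurable_scaleR borel_measurable_indicator) auto
  then show "(\<lambda>x. indicator A x *\<^sub>R f x) \<in> borel_measurable M"
    by (rule measurable_cong[THEN iffD1, rotated]) (auto simp: indicator_def)
  have "(sqnorm M (\<lambda>x. indicator A x *\<^sub>R f x)) \<le> (sqnorm M f)"
    by (intro nn_integral_mono) (auto simp: indicator_def)
  then show "(sqnorm M (\<lambda>x. indicator A x *\<^sub>R f x)) < \<infinity>"
    using f by (simp add: square_integrable_def order.strict_trans1)
qed

lemma l2_limit_square_integrable:
  fixes f :: "nat \<Rightarrow> 'a \<Rightarrow> 'x::euclidean_space"
  assumes lim: "l2_tendsto M f g" and f: "\<And>l. square_integrable M (f l)" and g: "g \<in> borel_measurable M"
  shows "square_integrable M g"
proof -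
  have "\<forall>\<^sub>F l in sequentially. (sqnorm M (\<lambda>x. f l x - g x)) < \<infinity>"
    using order_tendstoD(2)[OF lim[unfolded l2_tendsto_def], of \<infinity>] by simp
  then obtain l where l: "(sqnorm M (\<lambda>x. f l x - g x)) < \<infinity>"
    by (auto simp: eventually_sequentially)
  have "square_integrable M (\<lambda>x. f l x - g x)"
    using l f[of l] g unfolding square_integrable_def by auto
  from square_integrable_diff[OF f[of l] this] show ?thesis by simp
qed

lemma norm_sum_square:
  fixes f :: "'i \<Rightarrow> 'x::real_inner"
  shows "(norm (\<Sum>p\<in>J. f p))\<^sup>2 = (\<Sum>p\<in>J. \<Sum>q\<in>J. f p \<bullet> f q)"
  unfolding power2_norm_eq_inner by (subst inner_sum_left) (simp only: inner_sum_right)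

context brownian_basis
begin

definition valid :: "('k, 'w, 'd, 'm::finite) ito_term list \<Rightarrow> bool" where
  "valid L \<longleftrightarrow> (\<forall>e\<in>set L. valid_term e)"

text \<open>The common value of the two sides of the isometry on \<open>[s, t]\<close> for a pair of terms with the same motion.\<close>

definition term_cov :: "real \<Rightarrow> real \<Rightarrow> ('k, 'w, 'd, 'm::finite) ito_term \<Rightarrow> ('k, 'w, 'd, 'm) ito_term \<Rightarrow> real" where
  "term_cov s t e e' = (case e of (k, a, b, H) \<Rightarrow> case e' of (k', a', b', H') \<Rightarrow>
     overlap (clip s t a) (clip s t b) (clip s t a') (clip s t b') * (\<integral>\<omega>. H \<omega> \<bullet> H' \<omega> \<partial>P))"

definition term_increment :: "real \<Rightarrow> real \<Rightarrow> ('k, 'w, 'd, 'm::finite) ito_term \<Rightarrow> 'w \<Rightarrow> real^'m" where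
  "term_increment s t e \<omega> = term_integral B e t \<omega> - term_integral B e s \<omega>"

lemma term_isometries:
  fixes e e' :: "('k, 'w, 'd, 'm::finite) ito_term"
  assumes v: "valid_term e" "valid_term e'" and st: "0 \<le> s" "s \<le> t" "t \<le> T"
  shows "square_integrable P (term_increment s t e)" (is ?g1)
    and "(\<integral>\<omega>. term_increment s t e \<omega> \<bullet> term_increment s t e' \<omega> \<partial>P) = of_bool (fst e = fst e') * term_cov s t e e'" (is ?g2)
    and "integrable timespace (\<lambda>p. indicator {s..t} (fst p) * (term_value e l (fst p) (snd p) \<bullet> term_value e' l (fst p) (snd p)))" (is ?g3)
    and "(\<integral>p. indicator {s..t} (fst p) * (term_value e l (fst p) (snd p) \<bullet> term_value e' l (fst p) (snd p)) \<partial>timespace) =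
       of_bool (fst e = l \<and> fst e' = l) * term_cov s t e e'" (is ?g4)
proof -
  obtain k a b H where e: "e = (k, a, b, H)" by (cases e)
  obtain k' a' b' H' where e': "e' = (k', a', b', H')" by (cases e')
  note A = term_increment_isometry[OF v[unfolded e e'] st] term_value_isometry[OF v[unfolded e e'] st, of l]
  show ?g1
    using A(1) by (simp add: e term_increment_def[abs_def])
  show ?g2
    using A(2) by (simp add: e e' term_increment_def term_cov_def)
  show ?g3
    using A(3) by (simp add: e e')
  show ?g4
    using A(4) by (simp add: e e' term_cov_def)
qed

lemma valid_nth: "valid L \<Longrightarrow> p \<in> {0..<length L} \<Longrightarrow> valid_term (L ! p)"
  by (simp add: valid_def)

lemma terms_increment: "terms_integral B L t \<omega> - terms_integral B L s \<omega> = (\<Sum>p\<in>{0..<length L}. term_increment s t (L ! p) \<omega>)"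
  by (simp add: terms_integral_sum term_increment_def sum_subtractf)

lemma terms_increment_square_integrable:
  assumes "valid L" "0 \<le> s" "s \<le> t" "t \<le> T"
  shows "square_integrable P (\<lambda>\<omega>. terms_integral B L t \<omega> - terms_integral B L s \<omega>)"
  unfolding terms_increment
  using assms by (intro square_integrable_sum term_isometries(1)[where e'="L ! _"] valid_nth) auto

lemma terms_integral_at_zero:
  assumes "valid L" shows "terms_integral B L 0 = (\<lambda>\<omega>. 0)"
proof
  fix \<omega>
  have "term_integral B (L ! p) 0 \<omega> = 0" if "p \<in> {0..<length L}" for p
    using valid_nth[OF assms that] by (cases "L ! p") (auto simp: term_integral_def valid_term_def)
  then show "terms_integral B L 0 \<omega> = 0" by (simp add: terms_integral_sum)
qed

lemma terms_integral_square_integrable: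
  assumes "valid L" "0 \<le> t" "t \<le> T"
  shows "square_integrable P (terms_integral B L t)"
  using terms_increment_square_integrable[OF assms(1) order_refl assms(2,3)] terms_integral_at_zero[OF assms(1)] by simp

lemma measurable_fst_timespace: "A \<in> sets borel \<Longrightarrow> {p. fst p \<in> A} \<inter> space timespace \<in> sets timespace"
proof -
  assume A: "A \<in> sets borel"
  have "fst \<in> measurable timespace (restrict_space lborel {0..T})" unfolding timespace_def by simp
  moreover have "A \<inter> {0..T} \<in> sets (restrict_space lborel {0..T})" using A by (auto simp: sets_restrict_space)
  ultimately have "fst -` (A \<inter> {0..T}) \<inter> space timespace \<in> sets timespace" by (rule measurable_sets)
  moreover have "fst -` (A \<inter> {0..T}) \<inter> space timespace = {p. fst p \<in> A} \<inter> space timespace"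
    by (auto simp: timespace_def space_pair_measure space_restrict_space)
  ultimately show ?thesis by simp
qed

lemma terms_value_measurable:
  assumes "valid L"
  shows "(\<lambda>p. terms_value L k (fst p) (snd p)) \<in> borel_measurable timespace"
  unfolding terms_value_sum
proof (rule borel_measurable_sum)
  fix q assume q: "q \<in> {0..<length L}"
  obtain k' a b H where e: "L ! q = (k', a, b, H)" by (cases "L ! q")
  have H: "H \<in> borel_measurable P" using valid_nth[OF assms q] by (auto simp: e valid_term_def intro: measurable_F_P)
  have Hs: "(\<lambda>p. H (snd p)) \<in> borel_measurable timespace"
    unfolding timespace_def by (rule measurable_compose[OF measurable_snd H])
  have "(\<lambda>p. indicator ({p. fst p \<in> {a<..b}} \<inter> space timespace) p :: real) \<in> borel_measurable timespace"
    by (intro borel_measurable_indicator measurable_fst_timespace) auto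
  then have i: "(\<lambda>p. indicator {a<..b} (fst p) :: real) \<in> borel_measurable timespace"
    by (rule measurable_cong[THEN iffD1, rotated]) (auto simp: indicator_def)
  show "(\<lambda>p. term_value (L ! q) k (fst p) (snd p)) \<in> borel_measurable timespace"
    unfolding e term_value_def prod.case by (intro borel_measurable_scaleR borel_measurable_times i Hs borel_measurable_const)
qed

text \<open>Both squares expand into double sums over pairs of terms, which agree summand by summand.\<close>

lemma terms_isometry:
  fixes L :: "('k, 'w, 'd, 'm::finite) ito_term list"
  assumes v: "valid L" and st: "0 \<le> s" "s \<le> t" "t \<le> T"
  shows "integrable timespace (\<lambda>p. indicator {s..t} (fst p) * (norm (terms_value L k (fst p) (snd p)))\<^sup>2)" (is ?g1)
    and "(\<integral>\<omega>. (norm (terms_integral B L t \<omega> - terms_integral B L s \<omega>))\<^sup>2 \<partial>P) =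
      (\<Sum>k\<in>K. \<integral>p. indicator {s..t} (fst p) * (norm (terms_value L k (fst p) (snd p)))\<^sup>2 \<partial>timespace)" (is ?g2)
proof -
  let ?J = "{0..<length L}"
  let ?v = "\<lambda>p q k. \<lambda>x. indicator {s..t} (fst x) * (term_value (L ! p) k (fst x) (snd x) \<bullet> term_value (L ! q) k (fst x) (snd x))"
  note T = term_isometries[OF valid_nth[OF v] valid_nth[OF v] st]
  have e1: "indicator {s..t} (fst x) * (norm (terms_value L k (fst x) (snd x)))\<^sup>2 = (\<Sum>p\<in>?J. \<Sum>q\<in>?J. ?v p q k x)" for k x
    unfolding terms_value_sum norm_sum_square by (simp only: sum_distrib_left)
  show ?g1
    unfolding e1 by (intro Bochner_Integration.integrable_sum T(3))
  have r: "(\<integral>p. indicator {s..t} (fst p) * (norm (terms_value L k (fst p) (snd p)))\<^sup>2 \<partial>timespace) =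
     (\<Sum>p\<in>?J. \<Sum>q\<in>?J. of_bool (fst (L ! p) = k \<and> fst (L ! q) = k) * term_cov s t (L ! p) (L ! q))" for k
  proof -
    have "(\<integral>p. indicator {s..t} (fst p) * (norm (terms_value L k (fst p) (snd p)))\<^sup>2 \<partial>timespace) =
      (\<Sum>p\<in>?J. \<Sum>q\<in>?J. \<integral>x. ?v p q k x \<partial>timespace)"
      unfolding e1
      by (subst Bochner_Integration.integral_sum, intro Bochner_Integration.integrable_sum T(3), assumption+,
          intro sum.cong refl Bochner_Integration.integral_sum T(3))
    also have "\<dots> = (\<Sum>p\<in>?J. \<Sum>q\<in>?J. of_bool (fst (L ! p) = k \<and> fst (L ! q) = k) * term_cov s t (L ! p) (L ! q))"
      by (intro sum.cong refl T(4))
    finally show ?thesis .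
  qed
  have inc_int: "integrable P (\<lambda>\<omega>. term_increment s t (L ! p) \<omega> \<bullet> term_increment s t (L ! q) \<omega>)" if "p \<in> ?J" "q \<in> ?J" for p q
    by (rule square_integrable_inner_integrable[OF T(1)[OF that(1,1)] T(1)[OF that(2,2)]])
  have "(\<integral>\<omega>. (norm (terms_integral B L t \<omega> - terms_integral B L s \<omega>))\<^sup>2 \<partial>P) =
    (\<integral>\<omega>. (\<Sum>p\<in>?J. \<Sum>q\<in>?J. term_increment s t (L ! p) \<omega> \<bullet> term_increment s t (L ! q) \<omega>) \<partial>P)"
    unfolding terms_increment norm_sum_square ..
  also have "\<dots> = (\<Sum>p\<in>?J. \<Sum>q\<in>?J. \<integral>\<omega>. term_increment s t (L ! p) \<omega> \<bullet> term_increment s t (L ! q) \<omega> \<partial>P)"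
    by (subst Bochner_Integration.integral_sum, intro Bochner_Integration.integrable_sum inc_int, assumption+,
        intro sum.cong refl Bochner_Integration.integral_sum inc_int)
  also have "\<dots> = (\<Sum>p\<in>?J. \<Sum>q\<in>?J. of_bool (fst (L ! p) = fst (L ! q)) * term_cov s t (L ! p) (L ! q))"
    by (intro sum.cong refl T(2))
  also have "\<dots> = (\<Sum>p\<in>?J. \<Sum>q\<in>?J. \<Sum>k\<in>K. of_bool (fst (L ! p) = k \<and> fst (L ! q) = k) * term_cov s t (L ! p) (L ! q))"
  proof (intro sum.cong refl)
    fix p q assume p: "p \<in> ?J"
    have "fst (L ! p) \<in> K" using valid_nth[OF v p] by (cases "L ! p") (auto simp: valid_term_def)
    have "(\<Sum>k\<in>K. of_bool (fst (L ! p) = k \<and> fst (L ! q) = k) * term_cov s t (L ! p) (L ! q)) =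
       (\<Sum>k\<in>K. if k = fst (L ! p) then of_bool (fst (L ! p) = fst (L ! q)) * term_cov s t (L ! p) (L ! q) else 0)"
      by (intro sum.cong refl) auto
    also have "\<dots> = of_bool (fst (L ! p) = fst (L ! q)) * term_cov s t (L ! p) (L ! q)"
      using finite_K \<open>fst (L ! p) \<in> K\<close> by (simp add: sum.delta)
    finally show "of_bool (fst (L ! p) = fst (L ! q)) * term_cov s t (L ! p) (L ! q) =
       (\<Sum>k\<in>K. of_bool (fst (L ! p) = k \<and> fst (L ! q) = k) * term_cov s t (L ! p) (L ! q))" by simp
  qed
  also have "\<dots> = (\<Sum>k\<in>K. \<Sum>p\<in>?J. \<Sum>q\<in>?J. of_bool (fst (L ! p) = k \<and> fst (L ! q) = k) * term_cov s t (L ! p) (L ! q))"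
  proof -
    have "(\<Sum>p\<in>?J. \<Sum>q\<in>?J. \<Sum>k\<in>K. f p q k) = (\<Sum>k\<in>K. \<Sum>p\<in>?J. \<Sum>q\<in>?J. f p q k)" for f :: "nat \<Rightarrow> nat \<Rightarrow> 'k \<Rightarrow> real"
    proof -
      have "(\<Sum>p\<in>?J. \<Sum>q\<in>?J. \<Sum>k\<in>K. f p q k) = (\<Sum>p\<in>?J. \<Sum>k\<in>K. \<Sum>q\<in>?J. f p q k)"
        by (intro sum.cong refl sum.swap)
      also have "\<dots> = (\<Sum>k\<in>K. \<Sum>p\<in>?J. \<Sum>q\<in>?J. f p q k)" by (rule sum.swap)
      finally show ?thesis .
    qed
    then show ?thesis .
  qed
  finally show ?g2
    unfolding r .
qed

lemma terms_orthogonality: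
  fixes U :: "'w \<Rightarrow> real^'m"
  assumes v: "valid L" and st: "0 \<le> s" "s \<le> t" "t \<le> T"
    and U: "U \<in> borel_measurable (F s)" "square_integrable P U"
  shows "(\<integral>\<omega>. U \<omega> \<bullet> (terms_integral B L t \<omega> - terms_integral B L s \<omega>) \<partial>P) = 0"
proof -
  have "(\<integral>\<omega>. U \<omega> \<bullet> (terms_integral B L t \<omega> - terms_integral B L s \<omega>) \<partial>P) =
    (\<Sum>p\<in>{0..<length L}. \<integral>\<omega>. U \<omega> \<bullet> term_increment s t (L ! p) \<omega> \<partial>P)"
    unfolding terms_increment inner_sum_right
    by (intro Bochner_Integration.integral_sum square_integrable_inner_integrable U term_isometries(1)[where e'="L ! _"] valid_nth[OF v] st)
  also have "\<dots> = 0"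
    unfolding term_increment_def
    by (intro sum.neutral ballI term_increment_orthogonality st U valid_nth[OF v])
  finally show ?thesis .
qed

end

section \<open>Ito integrals as square-integrable limits\<close>

context brownian_basis
begin

text \<open>\<open>M\<close> is the sum over \<open>k\<close> of the Ito integrals of \<open>V k\<close> against the motions \<open>B k\<close>. All integrands are
  approximated by one sequence of lists, because the elements of a list may refer to different motions.
  Continuity of the paths is kept as a separate property.\<close>

definition ito_limit :: "('k \<Rightarrow> real \<Rightarrow> 'w \<Rightarrow> real^'d^'m) \<Rightarrow> (real \<Rightarrow> 'w \<Rightarrow> real^'m) \<Rightarrow> bool" where
  "ito_limit V M \<longleftrightarrow>
    (\<forall>k\<in>K. square_integrable timespace (\<lambda>p. V k (fst p) (snd p))) \<and>
    (\<forall>t\<in>{0..T}. M t \<in> borel_measurable (F t) \<and> square_integrable P (M t)) \<and>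
    (\<exists>L. (\<forall>l. valid (L l)) \<and>
      (\<forall>k\<in>K. l2_tendsto timespace (\<lambda>l p. terms_value (L l) k (fst p) (snd p)) (\<lambda>p. V k (fst p) (snd p))) \<and>
      (\<forall>t\<in>{0..T}. l2_tendsto P (\<lambda>l. terms_integral B (L l) t) (M t)))"

end

lemma progressive_adapted:
  fixes X :: "real \<Rightarrow> 'w \<Rightarrow> 'x::topological_space"
  assumes X: "progressive T G X" and t: "0 \<le> t" "t \<le> T"
  shows "X t \<in> borel_measurable (G t)"
proof -
  have "(\<lambda>(s, \<omega>). X s \<omega>) \<in> borel_measurable (restrict_space borel {0..t} \<Otimes>\<^sub>M G t)"
    using X t by (auto simp: progressive_def)
  moreover have "(\<lambda>\<omega>. (t, \<omega>)) \<in> measurable (G t) (restrict_space borel {0..t} \<Otimes>\<^sub>M G t)"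
    using t by (intro measurable_Pair1') (simp add: space_restrict_space)
  ultimately have "(\<lambda>\<omega>. (\<lambda>(s, \<omega>). X s \<omega>) (t, \<omega>)) \<in> borel_measurable (G t)"
    by (rule measurable_compose[rotated])
  then show ?thesis by simp
qed

context brownian_basis
begin

lemma ito_limitD:
  assumes "ito_limit V M"
  shows "k \<in> K \<Longrightarrow> square_integrable timespace (\<lambda>p. V k (fst p) (snd p))"
    and "0 \<le> t \<Longrightarrow> t \<le> T \<Longrightarrow> M t \<in> borel_measurable (F t)"
    and "0 \<le> t \<Longrightarrow> t \<le> T \<Longrightarrow> square_integrable P (M t)"
  using assms by (auto simp: ito_limit_def)

lemma indicator_timespace:
  fixes V :: "real \<Rightarrow> 'w \<Rightarrow> 'x::euclidean_space"
  assumes "square_integrable timespace (\<lambda>p. V (fst p) (snd p))"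
  shows "square_integrable timespace (\<lambda>p. indicator {s..t} (fst p) *\<^sub>R V (fst p) (snd p))"
proof -
  have "square_integrable timespace (\<lambda>p. indicator {p. fst p \<in> {s..t}} p *\<^sub>R V (fst p) (snd p))"
    by (rule square_integrable_indicator[OF assms measurable_fst_timespace]) simp
  then show ?thesis by (simp add: indicator_def)
qed

lemma norm_indicator_square:
  "(norm (indicator A x *\<^sub>R y))\<^sup>2 = indicator A x * (norm (y::'x::real_normed_vector))\<^sup>2"
  by (simp add: indicator_def)

lemma ito_isometry:
  assumes V: "ito_limit V M" and st: "0 \<le> s" "s \<le> t" "t \<le> T"
  shows "(\<integral>\<omega>. (norm (M t \<omega> - M s \<omega>))\<^sup>2 \<partial>P) =
    (\<Sum>k\<in>K. \<integral>p. indicator {s..t} (fst p) * (norm (V k (fst p) (snd p)))\<^sup>2 \<partial>timespace)"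
proof -
  obtain L where L: "\<And>l. valid (L l)"
    and Lv: "\<And>k. k \<in> K \<Longrightarrow> l2_tendsto timespace (\<lambda>l p. terms_value (L l) k (fst p) (snd p)) (\<lambda>p. V k (fst p) (snd p))"
    and Li: "\<And>t. t \<in> {0..T} \<Longrightarrow> l2_tendsto P (\<lambda>l. terms_integral B (L l) t) (M t)"
    using V unfolding ito_limit_def by blast
  have stT: "s \<in> {0..T}" "t \<in> {0..T}" using st by auto
  note D = ito_limitD[OF V]
  have Mm: "M r \<in> borel_measurable P" if "r \<in> {0..T}" for r using D(3)[of r] that by auto
  have Im: "terms_integral B (L l) r \<in> borel_measurable P" if "r \<in> {0..T}" for l r
    using terms_integral_square_integrable[OF L, of r] that by auto
  have lim: "l2_tendsto P (\<lambda>l \<omega>. terms_integral B (L l) t \<omega> - terms_integral B (L l) s \<omega>) (\<lambda>\<omega>. M t \<omega> - M s \<omega>)"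
    using stT by (intro l2_tendsto_diff Li Mm Im)
  have sqM: "square_integrable P (\<lambda>\<omega>. M t \<omega> - M s \<omega>)"
    using st by (intro square_integrable_diff D(3)) auto
  note sqI = terms_increment_square_integrable[OF L st]
  have l1: "(\<lambda>l. \<integral>\<omega>. (norm (terms_integral B (L l) t \<omega> - terms_integral B (L l) s \<omega>))\<^sup>2 \<partial>P) \<longlonglongrightarrow> (\<integral>\<omega>. (norm (M t \<omega> - M s \<omega>))\<^sup>2 \<partial>P)"
    using l2_tendsto_inner[OF lim sqI sqM lim sqI sqM] by (simp add: power2_norm_eq_inner)
  have l2: "(\<lambda>l. \<integral>p. indicator {s..t} (fst p) * (norm (terms_value (L l) k (fst p) (snd p)))\<^sup>2 \<partial>timespace) \<longlonglongrightarrow>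
      (\<integral>p. indicator {s..t} (fst p) * (norm (V k (fst p) (snd p)))\<^sup>2 \<partial>timespace)" if k: "k \<in> K" for k
  proof -
    have a: "l2_tendsto timespace (\<lambda>l p. indicator {s..t} (fst p) *\<^sub>R terms_value (L l) k (fst p) (snd p))
        (\<lambda>p. indicator {s..t} (fst p) *\<^sub>R V k (fst p) (snd p))"
      using l2_tendsto_indicator[OF Lv[OF k], of "{p. fst p \<in> {s..t}}"] by (simp add: indicator_def)
    have b: "square_integrable timespace (\<lambda>p. indicator {s..t} (fst p) *\<^sub>R terms_value (L l) k (fst p) (snd p))" for l
    proof -
      have "(\<lambda>p. indicator {p. fst p \<in> {s..t}} p *\<^sub>R terms_value (L l) k (fst p) (snd p)) \<in> borel_measurable timespace"
      proof -
        have "(\<lambda>p. indicator ({p. fst p \<in> {s..t}} \<inter> space timespace) p *\<^sub>R terms_value (L l) k (fst p) (snd p)) \<in> borel_measurable timespace"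
          by (intro borel_measurable_scaleR borel_measurable_indicator measurable_fst_timespace terms_value_measurable L) simp
        then show ?thesis by (rule measurable_cong[THEN iffD1, rotated]) (auto simp: indicator_def)
      qed
      then have "(\<lambda>p. indicator {s..t} (fst p) *\<^sub>R terms_value (L l) k (fst p) (snd p)) \<in> borel_measurable timespace"
        by (simp add: indicator_def)
      then show ?thesis
        unfolding square_integrable_iff norm_indicator_square using terms_isometry(1)[OF L st] by (rule conjI)
    qed
    have c: "square_integrable timespace (\<lambda>p. indicator {s..t} (fst p) *\<^sub>R V k (fst p) (snd p))"
      by (rule indicator_timespace[OF D(1)[OF k]])
    have "(\<lambda>l. \<integral>p. (norm (indicator {s..t} (fst p) *\<^sub>R terms_value (L l) k (fst p) (snd p)))\<^sup>2 \<partial>timespace) \<longlonglongrightarrow>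
      (\<integral>p. (norm (indicator {s..t} (fst p) *\<^sub>R V k (fst p) (snd p)))\<^sup>2 \<partial>timespace)"
      unfolding power2_norm_eq_inner by (rule l2_tendsto_inner[OF a b c a b c])
    then show ?thesis unfolding norm_indicator_square .
  qed
  have "(\<lambda>l. \<Sum>k\<in>K. \<integral>p. indicator {s..t} (fst p) * (norm (terms_value (L l) k (fst p) (snd p)))\<^sup>2 \<partial>timespace) \<longlonglongrightarrow>
    (\<Sum>k\<in>K. \<integral>p. indicator {s..t} (fst p) * (norm (V k (fst p) (snd p)))\<^sup>2 \<partial>timespace)"
    by (intro tendsto_sum l2)
  with l1[unfolded terms_isometry(2)[OF L st]] show ?thesis by (rule LIMSEQ_unique)
qed

lemma ito_orthogonality:
  fixes U :: "'w \<Rightarrow> real^'m"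
  assumes V: "ito_limit V M" and st: "0 \<le> s" "s \<le> t" "t \<le> T"
    and U: "U \<in> borel_measurable (F s)" "square_integrable P U"
  shows "(\<integral>\<omega>. U \<omega> \<bullet> (M t \<omega> - M s \<omega>) \<partial>P) = 0"
proof -
  obtain L where L: "\<And>l. valid (L l)"
    and Li: "\<And>t. t \<in> {0..T} \<Longrightarrow> l2_tendsto P (\<lambda>l. terms_integral B (L l) t) (M t)"
    using V unfolding ito_limit_def by blast
  have stT: "s \<in> {0..T}" "t \<in> {0..T}" using st by auto
  note D = ito_limitD[OF V]
  have Mm: "M r \<in> borel_measurable P" if "r \<in> {0..T}" for r using D(3)[of r] that by auto
  have Im: "terms_integral B (L l) r \<in> borel_measurable P" if "r \<in> {0..T}" for l r
    using terms_integral_square_integrable[OF L, of r] that by auto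
  have lim: "l2_tendsto P (\<lambda>l \<omega>. terms_integral B (L l) t \<omega> - terms_integral B (L l) s \<omega>) (\<lambda>\<omega>. M t \<omega> - M s \<omega>)"
    using stT by (intro l2_tendsto_diff Li Mm Im)
  have sqM: "square_integrable P (\<lambda>\<omega>. M t \<omega> - M s \<omega>)"
    using st by (intro square_integrable_diff D(3)) auto
  have "(\<lambda>l. \<integral>\<omega>. U \<omega> \<bullet> (terms_integral B (L l) t \<omega> - terms_integral B (L l) s \<omega>) \<partial>P) \<longlonglongrightarrow> (\<integral>\<omega>. U \<omega> \<bullet> (M t \<omega> - M s \<omega>) \<partial>P)"
    by (rule l2_tendsto_inner[OF l2_tendsto_const U(2) U(2) lim terms_increment_square_integrable[OF L st] sqM])
  then show ?thesis unfolding terms_orthogonality[OF L st U] by (simp add: LIMSEQ_const_iff)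
qed

lemma ito_limit_add:
  fixes V V' :: "'k \<Rightarrow> real \<Rightarrow> 'w \<Rightarrow> real^'d^'m"
  assumes V: "ito_limit V M" and V': "ito_limit V' M'"
  shows "ito_limit (\<lambda>k r \<omega>. V k r \<omega> + V' k r \<omega>) (\<lambda>t \<omega>. M t \<omega> + M' t \<omega>)"
proof -
  obtain L where L: "\<And>l. valid (L l)"
    and Lv: "\<And>k. k \<in> K \<Longrightarrow> l2_tendsto timespace (\<lambda>l p. terms_value (L l) k (fst p) (snd p)) (\<lambda>p. V k (fst p) (snd p))"
    and Li: "\<And>t. t \<in> {0..T} \<Longrightarrow> l2_tendsto P (\<lambda>l. terms_integral B (L l) t) (M t)"
    using V unfolding ito_limit_def by blast
  obtain L' where L': "\<And>l. valid (L' l)"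
    and Lv': "\<And>k. k \<in> K \<Longrightarrow> l2_tendsto timespace (\<lambda>l p. terms_value (L' l) k (fst p) (snd p)) (\<lambda>p. V' k (fst p) (snd p))"
    and Li': "\<And>t. t \<in> {0..T} \<Longrightarrow> l2_tendsto P (\<lambda>l. terms_integral B (L' l) t) (M' t)"
    using V' unfolding ito_limit_def by blast
  note D = ito_limitD[OF V] and D' = ito_limitD[OF V']
  have meas: "f \<in> borel_measurable N" if "square_integrable N f" for f :: "'z \<Rightarrow> 'y::euclidean_space" and N
    using that by auto
  have Im: "terms_integral B (L l) r \<in> borel_measurable P" "terms_integral B (L' l) r \<in> borel_measurable P" if "r \<in> {0..T}" for l r
    using terms_integral_square_integrable[OF L, of r] terms_integral_square_integrable[OF L', of r] that by auto
  show ?thesis unfolding ito_limit_def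
  proof (intro conjI ballI exI[of _ "\<lambda>l. L l @ L' l"] allI)
    show "square_integrable timespace (\<lambda>p. V k (fst p) (snd p) + V' k (fst p) (snd p))" if "k \<in> K" for k
      by (intro square_integrable_add D(1) D'(1) that)
    show "(\<lambda>\<omega>. M t \<omega> + M' t \<omega>) \<in> borel_measurable (F t)" if "t \<in> {0..T}" for t
      using that by (intro borel_measurable_add D(2) D'(2)) auto
    show "square_integrable P (\<lambda>\<omega>. M t \<omega> + M' t \<omega>)" if "t \<in> {0..T}" for t
      using that by (intro square_integrable_add D(3) D'(3)) auto
    show "valid (L l @ L' l)" for l using L[of l] L'[of l] by (auto simp: valid_def)
    show "l2_tendsto timespace (\<lambda>l p. terms_value (L l @ L' l) k (fst p) (snd p)) (\<lambda>p. V k (fst p) (snd p) + V' k (fst p) (snd p))"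
      if k: "k \<in> K" for k
      unfolding terms_value_append
      by (rule l2_tendsto_add[OF Lv[OF k] Lv'[OF k] terms_value_measurable[OF L] meas[OF D(1)[OF k]] terms_value_measurable[OF L'] meas[OF D'(1)[OF k]]])
    show "l2_tendsto P (\<lambda>l. terms_integral B (L l @ L' l) t) (\<lambda>\<omega>. M t \<omega> + M' t \<omega>)" if t: "t \<in> {0..T}" for t
    proof -
      have "square_integrable P (M t)" "square_integrable P (M' t)" using t D(3) D'(3) by auto
      then have "l2_tendsto P (\<lambda>l \<omega>. terms_integral B (L l) t \<omega> + terms_integral B (L' l) t \<omega>) (\<lambda>\<omega>. M t \<omega> + M' t \<omega>)"
        by (intro l2_tendsto_add Li[OF t] Li'[OF t] Im t meas)
      then show ?thesis by (simp add: terms_integral_append[abs_def])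
    qed
  qed
qed

lemma ito_limit_uminus:
  fixes V :: "'k \<Rightarrow> real \<Rightarrow> 'w \<Rightarrow> real^'d^'m"
  assumes V: "ito_limit V M"
  shows "ito_limit (\<lambda>k r \<omega>. - V k r \<omega>) (\<lambda>t \<omega>. - M t \<omega>)"
proof -
  obtain L where L: "\<And>l. valid (L l)"
    and Lv: "\<And>k. k \<in> K \<Longrightarrow> l2_tendsto timespace (\<lambda>l p. terms_value (L l) k (fst p) (snd p)) (\<lambda>p. V k (fst p) (snd p))"
    and Li: "\<And>t. t \<in> {0..T} \<Longrightarrow> l2_tendsto P (\<lambda>l. terms_integral B (L l) t) (M t)"
    using V unfolding ito_limit_def by blast
  note D = ito_limitD[OF V]
  have neg: "valid_term (negate_term e)" if "valid_term e" for e :: "('k, 'w, 'd, 'm) ito_term"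
    using that by (cases e) (auto simp: valid_term_def negate_term_def bounded_on_def)
  show ?thesis unfolding ito_limit_def
  proof (intro conjI ballI exI[of _ "\<lambda>l. map negate_term (L l)"] allI)
    show "square_integrable timespace (\<lambda>p. - V k (fst p) (snd p))" if "k \<in> K" for k
      by (intro square_integrable_uminus D(1) that)
    show "(\<lambda>\<omega>. - M t \<omega>) \<in> borel_measurable (F t)" if "t \<in> {0..T}" for t
      using that by (intro borel_measurable_uminus D(2)) auto
    show "square_integrable P (\<lambda>\<omega>. - M t \<omega>)" if "t \<in> {0..T}" for t
      using that by (intro square_integrable_uminus D(3)) auto
    show "valid (map negate_term (L l))" for l using L[of l] neg by (auto simp: valid_def)
    show "l2_tendsto timespace (\<lambda>l p. terms_value (map negate_term (L l)) k (fst p) (snd p)) (\<lambda>p. - V k (fst p) (snd p))"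
      if k: "k \<in> K" for k
      unfolding terms_value_negate by (rule l2_tendsto_uminus[OF Lv[OF k]])
    show "l2_tendsto P (\<lambda>l. terms_integral B (map negate_term (L l)) t) (\<lambda>\<omega>. - M t \<omega>)" if t: "t \<in> {0..T}" for t
      using l2_tendsto_uminus[OF Li[OF t]] by (simp add: terms_integral_negate[abs_def])
  qed
qed

lemma ito_limit_zero: "ito_limit (\<lambda>k r \<omega>. 0) (\<lambda>t \<omega>. 0)"
  unfolding ito_limit_def
  by (auto simp: square_integrable_def l2_tendsto_def valid_def terms_integral_def intro!: exI[of _ "\<lambda>l. []"])

lemma ito_limit_sum:
  assumes "finite I" "\<And>i. i \<in> I \<Longrightarrow> ito_limit (V i) (M i)"
  shows "ito_limit (\<lambda>k r \<omega>. \<Sum>i\<in>I. V i k r \<omega>) (\<lambda>t \<omega>. \<Sum>i\<in>I. M i t \<omega>)"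
  using assms by (induction I rule: finite_induct) (simp_all add: ito_limit_zero ito_limit_add)

text \<open>Fubini's theorem in both orders: second moments of stochastic integrals live on the product of time and
  probability space, whereas the energies in the estimates are integrals over time for a fixed path.\<close>

lemma nn_integral_timespace:
  assumes f: "f \<in> borel_measurable timespace"
  shows "(\<integral>\<^sup>+p. f p \<partial>timespace) = (\<integral>\<^sup>+\<omega>. (\<integral>\<^sup>+s\<in>{0..T}. f (s, \<omega>) \<partial>lborel) \<partial>P)" (is ?g1)
    and "(\<integral>\<^sup>+p. f p \<partial>timespace) = (\<integral>\<^sup>+s\<in>{0..T}. (\<integral>\<^sup>+\<omega>. f (s, \<omega>) \<partial>P) \<partial>lborel)" (is ?g2)
proof -
  note fst_integral = nn_integral_fst
  interpret t: sigma_finite_measure "restrict_space lborel {0..T} :: real measure" by (rule sigma_finite_time)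
  interpret pair_sigma_finite "restrict_space lborel {0..T} :: real measure" P ..
  have f': "case_prod (\<lambda>s \<omega>. f (s, \<omega>)) \<in> borel_measurable (restrict_space lborel {0..T} \<Otimes>\<^sub>M P)"
    using f by (simp add: timespace_def)
  have "(\<integral>\<^sup>+p. f p \<partial>timespace) = (\<integral>\<^sup>+\<omega>. (\<integral>\<^sup>+s. f (s, \<omega>) \<partial>restrict_space lborel {0..T}) \<partial>P)"
    using nn_integral_snd[OF f'] by (simp add: timespace_def)
  then show ?g1
    by (simp add: nn_integral_restrict_space)
  have "(\<integral>\<^sup>+p. f p \<partial>timespace) = (\<integral>\<^sup>+s. (\<integral>\<^sup>+\<omega>. f (s, \<omega>) \<partial>P) \<partial>restrict_space lborel {0..T})"
    using f unfolding timespace_def by (rule fst_integral[symmetric])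
  then show ?g2
    by (simp add: nn_integral_restrict_space)
qed

lemma progressive_measurable_timespace:
  fixes X :: "real \<Rightarrow> 'w \<Rightarrow> 'x::topological_space"
  assumes X: "progressive T G X" and G: "space (G T) = space P" "sets (G T) \<subseteq> sets P"
  shows "(\<lambda>p. X (fst p) (snd p)) \<in> borel_measurable timespace"
proof -
  have "(\<lambda>(s, \<omega>). X s \<omega>) \<in> borel_measurable (restrict_space borel {0..T} \<Otimes>\<^sub>M G T)"
    using X T_pos by (auto simp: progressive_def)
  moreover have "(\<lambda>p. (fst p, snd p)) \<in> measurable timespace (restrict_space borel {0..T} \<Otimes>\<^sub>M G T)"
  proof (rule measurable_Pair)
    have "fst \<in> measurable timespace (restrict_space lborel {0..T})" unfolding timespace_def by simp
    then show "fst \<in> measurable timespace (restrict_space borel {0..T})"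
      by (subst measurable_cong_sets[OF refl, of _ "restrict_space lborel {0..T}"]) (simp_all add: sets_restrict_space)
    have "(\<lambda>x. x) \<in> measurable P (G T)"
      using G by (intro measurableI) (auto dest: sets.sets_into_space)
    then show "snd \<in> measurable timespace (G T)"
      unfolding timespace_def by (rule measurable_compose[OF measurable_snd])
  qed
  ultimately have "(\<lambda>p. (\<lambda>(s, \<omega>). X s \<omega>) (fst p, snd p)) \<in> borel_measurable timespace"
    by (rule measurable_compose[rotated])
  then show ?thesis by (simp add: case_prod_beta')
qed

text \<open>A single integral is a family of integrands that vanishes for the other motions. The filtration \<open>G\<close> of the
  integral may be smaller than \<open>F\<close>: the coupled equations live in the filtration of two motions, but
  they are compared with the particles in the filtration of all motions.\<close>

lemma has_ito_integral_ito_limit: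
  fixes Z :: "real \<Rightarrow> 'w \<Rightarrow> real^'d^'m"
  assumes k: "k \<in> K" and J: "has_ito_integral P T G (B k) Z J" and Z: "in_H2 P T G Z"
    and G: "\<And>t. space (G t) = space P" "\<And>t. sets (G t) \<subseteq> sets (F t)"
  shows "ito_limit (\<lambda>k' r \<omega>. of_bool (k = k') *\<^sub>R Z r \<omega>) J"
proof -
  obtain N \<tau> H where simple: "\<And>l::nat. simple_process P T G (N l) (\<tau> l) (H l)"
    and v: "(\<lambda>l. \<integral>\<^sup>+\<omega>. (\<integral>\<^sup>+s\<in>{0..T}.
             ennreal ((norm (simple_value (N l) (\<tau> l) (H l) s \<omega> - Z s \<omega>))\<^sup>2) \<partial>lborel) \<partial>P) \<longlonglongrightarrow> 0"
    and i: "\<And>t. t\<in>{0..T} \<Longrightarrow> (\<lambda>l. \<integral>\<^sup>+\<omega>.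
             ennreal ((norm (simple_ito_integral (B k) (N l) (\<tau> l) (H l) t \<omega> - J t \<omega>))\<^sup>2) \<partial>P) \<longlonglongrightarrow> 0"
    using J unfolding has_ito_integral_def by blast
  have GF: "f \<in> measurable (F t) N" if "f \<in> measurable (G t) N" for f t and N :: "'z measure"
    by (rule measurable_mono[THEN subsetD, OF order_refl refl _ _ that]) (use G in \<open>auto simp: space_F\<close>)
  define L where "L l = map (\<lambda>j. (k, \<tau> l j, \<tau> l (Suc j), H l j)) [0..<N l]" for l
  have valid: "valid (L l)" for l
  proof -
    note s = simple[of l, unfolded simple_process_def]
    have tau: "0 \<le> \<tau> l j \<and> \<tau> l j \<le> T" if "j \<le> N l" for j
    proof
      have "\<tau> l 0 \<le> \<tau> l j" using s that
        by (induction j) (auto intro: order_trans)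
      then show "0 \<le> \<tau> l j" using s by simp
      have "\<tau> l j \<le> \<tau> l (N l)" using that
      proof (induction rule: inc_induct)
        case (step m) then show ?case using s by (meson order_trans less_le_trans)
      qed simp
      then show "\<tau> l j \<le> T" using s by simp
    qed
    show ?thesis unfolding valid_def
    proof
      fix e assume "e \<in> set (L l)"
      then obtain j where j: "j < N l" "e = (k, \<tau> l j, \<tau> l (Suc j), H l j)" by (auto simp: L_def)
      have "H l j \<in> borel_measurable (F (\<tau> l j))" using s j by (intro GF) auto
      then show "valid_term e"
        using j k s tau[of j] tau[of "Suc j"] by (auto simp: valid_term_def bounded_on_def)
    qed
  qed
  have Li: "terms_integral B (L l) t \<omega> = simple_ito_integral (B k) (N l) (\<tau> l) (H l) t \<omega>" for l t \<omega>
    by (simp add: terms_integral_def L_def simple_ito_integral_def comp_def term_integral_def interv_sum_list_conv_sum_set_nat atLeast0LessThan)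
  have Lv: "terms_value (L l) k' r \<omega> = of_bool (k = k') *\<^sub>R simple_value (N l) (\<tau> l) (H l) r \<omega>" for l k' r \<omega>
    by (simp add: terms_value_def L_def simple_value_def comp_def term_value_def interv_sum_list_conv_sum_set_nat atLeast0LessThan scaleR_sum_right)
  have GP: "sets (G t) \<subseteq> sets P" for t using G(2)[of t] F_sub[of t] by (rule order_trans)
  have Zm: "(\<lambda>p. Z (fst p) (snd p)) \<in> borel_measurable timespace"
    using Z GP by (intro progressive_measurable_timespace[of G]) (auto simp: in_H2_def G(1))
  have Zsq: "square_integrable timespace (\<lambda>p. Z (fst p) (snd p))"
    unfolding square_integrable_def
  proof
    have "(sqnorm timespace (\<lambda>p. Z (fst p) (snd p))) = (\<integral>\<^sup>+\<omega>. energy 0 T (\<lambda>s. Z s \<omega>) \<partial>P)"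
      using Zm by (subst nn_integral_timespace(1)) auto
    then show "(sqnorm timespace (\<lambda>p. Z (fst p) (snd p))) < \<infinity>"
      using Z by (simp add: in_H2_def)
  qed (rule Zm)
  have vl: "l2_tendsto timespace (\<lambda>l p. terms_value (L l) k (fst p) (snd p)) (\<lambda>p. Z (fst p) (snd p))"
  proof -
    have "(sqnorm timespace (\<lambda>p. terms_value (L l) k (fst p) (snd p) - Z (fst p) (snd p))) =
      (\<integral>\<^sup>+\<omega>. energy 0 T (\<lambda>s. simple_value (N l) (\<tau> l) (H l) s \<omega> - Z s \<omega>) \<partial>P)" for l
    proof -
      have [measurable]: "(\<lambda>p. terms_value (L l) k (fst p) (snd p)) \<in> borel_measurable timespace" "(\<lambda>p. Z (fst p) (snd p)) \<in> borel_measurable timespace"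
        by (rule terms_value_measurable[OF valid] Zm)+
      have "(\<lambda>p. ennreal ((norm (terms_value (L l) k (fst p) (snd p) - Z (fst p) (snd p)))\<^sup>2)) \<in> borel_measurable timespace"
        by measurable
      from nn_integral_timespace(1)[OF this] show ?thesis by (simp add: Lv)
    qed
    then show ?thesis using v by (simp add: l2_tendsto_def)
  qed
  have Jm: "J t \<in> borel_measurable (F t)" if "t \<in> {0..T}" for t
    using J that by (intro GF) (auto simp: has_ito_integral_def)
  have il: "l2_tendsto P (\<lambda>l. terms_integral B (L l) t) (J t)" if "t \<in> {0..T}" for t
    using i[OF that] by (simp add: l2_tendsto_def Li)
  show ?thesis unfolding ito_limit_def
  proof (intro conjI ballI exI[of _ L] allI valid il Jm)
    show "square_integrable timespace (\<lambda>p. of_bool (k = k') *\<^sub>R Z (fst p) (snd p))" if "k' \<in> K" for k'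
      using Zsq by (cases "k = k'") (simp_all add: square_integrable_def)
    show "l2_tendsto timespace (\<lambda>l p. terms_value (L l) k' (fst p) (snd p)) (\<lambda>p. of_bool (k = k') *\<^sub>R Z (fst p) (snd p))" if "k' \<in> K" for k'
    proof (cases "k = k'")
      case True then show ?thesis using vl by simp
    next
      case False then show ?thesis by (simp add: Lv l2_tendsto_def)
    qed
    show "square_integrable P (J t)" if t: "t \<in> {0..T}" for t
      using terms_integral_square_integrable[OF valid, of t] t
      by (intro l2_limit_square_integrable[OF il[OF t]] measurable_F_P[OF Jm[OF t]]) auto
  qed
qed

end

section \<open>Backward iteration over short intervals\<close>

lemma real_nat_floor:
  fixes x :: real
  assumes "0 \<le> x"
  shows "real (nat \<lfloor>x\<rfloor>) \<le> x" (is ?g1) "x < real (nat \<lfloor>x\<rfloor>) + 1"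
proof -
  have "real (nat \<lfloor>x\<rfloor>) = of_int \<lfloor>x\<rfloor>" using assms by simp
  then show ?g1 "x < real (nat \<lfloor>x\<rfloor>) + 1" by linarith+
qed

text \<open>Steps of length \<open>h = T / iteration_steps C T\<close> satisfy \<open>h \<le> 1\<close> and \<open>8 C\<^sup>2 h \<le> 1 / 4\<close>, which makes the
  perturbation absorbable.\<close>

definition iteration_steps :: "real \<Rightarrow> real \<Rightarrow> nat" where
  "iteration_steps C T = Suc (nat \<lceil>32 * C\<^sup>2 * T + T\<rceil>)"

text \<open>Each of the \<open>N\<close> steps turns a bound \<open>b\<close> for \<open>f\<close> into \<open>3 b + lam\<close>, and \<open>p\<close> is a sum of \<open>N\<close> pieces, each at most
  \<open>4 \<sqdot> 3\<^sup>N lam\<close>.\<close>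

definition iteration_constant :: "real \<Rightarrow> real \<Rightarrow> real" where
  "iteration_constant C T = 4 * (real (iteration_steps C T) + 1) * 3 ^ iteration_steps C T"

text \<open>Here \<open>f t\<close> stands for \<open>E|U\<^sub>t|\<^sup>2\<close> and \<open>p t u\<close> for the energy of the integrands on \<open>[t, u]\<close>. On a short interval
  the terms on the right with \<open>m\<close> and \<open>p\<close> have small coefficients; \<open>m\<close> is taken to be the supremum of \<open>f\<close> on
  the interval and both are absorbed into the left-hand side. The bound \<open>R\<close> makes this supremum finite; it
  does not enter the constant.\<close>

lemma backward_iteration:
  fixes f :: "real \<Rightarrow> real" and p :: "real \<Rightarrow> real \<Rightarrow> real"
  assumes T: "T > 0"
    and f: "\<And>t. t \<in> {0..T} \<Longrightarrow> 0 \<le> f t" "\<And>t. t \<in> {0..T} \<Longrightarrow> f t \<le> R" and fT: "f T = 0"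
    and p: "\<And>s t. 0 \<le> s \<Longrightarrow> s \<le> t \<Longrightarrow> t \<le> T \<Longrightarrow> 0 \<le> p s t"
      "\<And>s t. 0 \<le> s \<Longrightarrow> s \<le> t \<Longrightarrow> t \<le> T \<Longrightarrow> p s T \<le> p s t + p t T" and pT: "p T T = 0"
    and lam: "0 \<le> lam"
    and step: "\<And>t u m. 0 \<le> t \<Longrightarrow> t \<le> u \<Longrightarrow> u \<le> T \<Longrightarrow> (\<And>r. r \<in> {t..u} \<Longrightarrow> f r \<le> m) \<Longrightarrow>
      f t + p t u \<le> 2 * f u + 8 * C\<^sup>2 * (u - t) * ((u - t) * m + p t u) + 8 * C\<^sup>2 * (u - t)\<^sup>2 * lam"
  shows "\<And>t. t \<in> {0..T} \<Longrightarrow> f t \<le> iteration_constant C T * lam" and "p 0 T \<le> iteration_constant C T * lam" (is ?g2)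
proof -
  define N where "N = iteration_steps C T"
  define \<delta> where "\<delta> = T / real N"
  have N: "N \<ge> 1" and N2: "32 * C\<^sup>2 * T + T \<le> real N"
    unfolding N_def iteration_steps_def by (simp, linarith)
  have NT: "T \<le> real N" "32 * C\<^sup>2 * T \<le> real N"
  proof -
    have "0 \<le> 32 * C\<^sup>2 * T" using T by simp
    then show "T \<le> real N" "32 * C\<^sup>2 * T \<le> real N" using N2 T by linarith+
  qed
  have \<delta>: "0 < \<delta>" "\<delta> \<le> 1" "8 * C\<^sup>2 * \<delta> \<le> 1 / 4" "\<delta> * real N = T"
    using N T NT by (auto simp: \<delta>_def divide_simps)
  have local: "f t \<le> 3 * f u + lam" "p t u \<le> 4 * f u + lam" if tu: "0 \<le> t" "t \<le> u" "u \<le> T" "u - t \<le> \<delta>" for t u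
  proof -
    have uT: "u \<in> {0..T}" using tu by auto
    have est: "f r + 3/4 * p r u \<le> 2 * f u + m / 4 + lam / 4"
      if r: "r \<in> {t..u}" and m: "\<And>r. r \<in> {t..u} \<Longrightarrow> f r \<le> m" for r m
    proof -
      define h where "h = u - r"
      have h: "0 \<le> h" "h \<le> \<delta>" using r tu by (auto simp: h_def)
      have m0: "0 \<le> m" using m[of u] f(1)[OF uT] tu by auto
      have p0: "0 \<le> p r u" using r tu by (intro p) auto
      have a: "8 * C\<^sup>2 * h \<le> 1 / 4"
        using \<delta>(3) mult_left_mono[OF h(2), of "8 * C\<^sup>2"] by simp
      have h1: "h \<le> 1" using h \<delta> by simp
      have "8 * C\<^sup>2 * h * (h * m + p r u) \<le> 1/4 * (h * m + p r u)"
        using a h m0 p0 by (intro mult_right_mono) auto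
      moreover have "h * m \<le> 1 * m" using h1 m0 by (intro mult_right_mono)
      moreover have "8 * C\<^sup>2 * h\<^sup>2 * lam \<le> 1/4 * lam"
      proof (intro mult_right_mono lam)
        have "8 * C\<^sup>2 * h\<^sup>2 = (8 * C\<^sup>2 * h) * h" by (simp add: power2_eq_square)
        also have "\<dots> \<le> (1/4) * 1" using a h1 h by (intro mult_mono) auto
        finally show "8 * C\<^sup>2 * h\<^sup>2 \<le> 1/4" by simp
      qed
      moreover have "f r + p r u \<le> 2 * f u + 8 * C\<^sup>2 * h * (h * m + p r u) + 8 * C\<^sup>2 * h\<^sup>2 * lam"
        unfolding h_def using r tu by (intro step m) auto
      ultimately show ?thesis using m0 by argo
    qed
    (* The bound est holds for every r in the interval with the same m on the right, so it bounds the supremum by a quarter of itself and terms without m. *)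
    define m where "m = (SUP r\<in>{t..u}. f r)"
    have bounded_on: "bdd_above (f ` {t..u})" using tu by (intro bdd_aboveI2[of _ _ R] f) auto
    have mr: "f r \<le> m" if "r \<in> {t..u}" for r unfolding m_def by (rule cSUP_upper[OF that bounded_on])
    have p0: "0 \<le> p r u" if "r \<in> {t..u}" for r using that tu by (intro p) auto
    have "f r \<le> 2 * f u + m / 4 + lam / 4" if "r \<in> {t..u}" for r
      using est[OF that mr] p0[OF that] by linarith
    then have "m \<le> 2 * f u + m / 4 + lam / 4"
      unfolding m_def[symmetric] using tu by (subst m_def) (rule cSUP_least, auto)
    then have m3: "m \<le> 8/3 * f u + 1/3 * lam" by linarith
    have fu: "0 \<le> f u" by (rule f(1)[OF uT])
    have t: "t \<in> {t..u}" using tu by auto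
    show "f t \<le> 3 * f u + lam" using mr[OF t] m3 fu lam by linarith
    show "p t u \<le> 4 * f u + lam" using est[OF t mr] m3 fu lam f(1)[of t] tu by auto
  qed
  (* The grid is traversed backward from T, where f vanishes. *)
  define u where "u j = T - real j * \<delta>" for j :: nat
  have uj: "0 \<le> u j \<and> u j \<le> T" if "j \<le> N" for j
  proof -
    have "real j * \<delta> \<le> real N * \<delta>" using that \<delta> by (intro mult_right_mono) auto
    then show ?thesis using \<delta> by (simp add: u_def mult.commute)
  qed
  have pow: "(1::real) \<le> 3 ^ j" for j :: nat by simp
  have fu: "f (u j) \<le> (3 ^ j - 1) * lam" if "j \<le> N" for j
    using that
  proof (induction j)
    case 0 then show ?case using fT by (simp add: u_def)
  next
    case (Suc j)
    have "f (u (Suc j)) \<le> 3 * f (u j) + lam"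
      using uj[of j] uj[of "Suc j"] Suc.prems \<delta> by (intro local) (auto simp: u_def algebra_simps)
    also have "\<dots> \<le> 3 * ((3 ^ j - 1) * lam) + lam" using Suc by simp
    also have "\<dots> \<le> (3 ^ Suc j - 1) * lam" using lam by (simp add: algebra_simps)
    finally show ?case .
  qed
  have pu: "p (u j) T \<le> 4 * real j * 3 ^ N * lam" if "j \<le> N" for j
    using that
  proof (induction j)
    case 0 then show ?case using pT by (simp add: u_def)
  next
    case (Suc j)
    have le: "u (Suc j) \<le> u j" using \<delta> by (simp add: u_def algebra_simps)
    have b: "0 \<le> u (Suc j)" "u j \<le> T" using uj[of j] uj[of "Suc j"] Suc.prems by auto
    have "p (u (Suc j)) (u j) \<le> 4 * f (u j) + lam"
      using b le \<delta> by (intro local) (auto simp: u_def algebra_simps)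
    also have "\<dots> \<le> 4 * ((3 ^ j - 1) * lam) + lam" using fu[of j] Suc.prems by simp
    also have "\<dots> \<le> 4 * 3 ^ j * lam" using lam by (simp add: algebra_simps)
    also have "\<dots> \<le> 4 * 3 ^ N * lam" using Suc.prems lam by (intro mult_right_mono mult_left_mono power_increasing) auto
    finally have "p (u (Suc j)) (u j) \<le> 4 * 3 ^ N * lam" .
    moreover have "p (u (Suc j)) T \<le> p (u (Suc j)) (u j) + p (u j) T" by (rule p(2)[OF b(1) le b(2)])
    ultimately show ?case using Suc by (simp add: algebra_simps)
  qed
  have c: "3 ^ N * lam \<le> iteration_constant C T * lam" "4 * real N * 3 ^ N * lam \<le> iteration_constant C T * lam"
    unfolding iteration_constant_def N_def[symmetric] using lam
    by (intro mult_right_mono; simp add: algebra_simps)+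
  show "f t \<le> iteration_constant C T * lam" if t: "t \<in> {0..T}" for t
  proof (cases "t = T")
    case True then show ?thesis using fT order_trans[OF mult_nonneg_nonneg[OF _ lam, of "3 ^ N"] c(1)] by simp
  next
    case False
    define j where "j = nat \<lfloor>(T - t) / \<delta>\<rfloor>"
    have q: "0 \<le> (T - t) / \<delta>" using t \<delta> by simp
    have j: "real j \<le> (T - t) / \<delta>" "(T - t) / \<delta> < real j + 1"
      unfolding j_def by (rule real_nat_floor[OF q])+
    have j': "real j * \<delta> \<le> T - t" "T - t < (real j + 1) * \<delta>" using j \<delta> by (simp_all add: field_simps)
    have "real j * \<delta> \<le> real N * \<delta>" using j'(1) t \<delta> by (simp add: mult.commute)
    then have jN: "j \<le> N" using \<delta> by simp
    have "f t \<le> 3 * f (u j) + lam"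
      using uj[OF jN] t j' by (intro local) (auto simp: u_def algebra_simps)
    also have "\<dots> \<le> 3 * ((3 ^ j - 1) * lam) + lam" using fu[OF jN] by simp
    also have "\<dots> \<le> 3 * 3 ^ N * lam"
    proof -
      have "3 ^ j * lam \<le> 3 ^ N * lam" using jN lam by (intro mult_right_mono power_increasing) auto
      then show ?thesis using lam by (simp add: algebra_simps)
    qed
    also have "\<dots> \<le> iteration_constant C T * lam"
      unfolding iteration_constant_def N_def[symmetric] using lam N by (intro mult_right_mono) auto
    finally show ?thesis .
  qed
  have "u N = 0" using \<delta> by (simp add: u_def mult.commute)
  then show ?g2 using pu[of N] c(2) by simp
qed

section \<open>Doob's maximal inequality\<close>

text \<open>Recursion makes the adaptedness of the maximum along a martingale an induction.\<close>

primrec running_max :: "(nat \<Rightarrow> real) \<Rightarrow> nat \<Rightarrow> real" where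
  "running_max X 0 = X 0"
| "running_max X (Suc n) = max (running_max X n) (X (Suc n))"

lemma running_max_ge: "j \<le> n \<Longrightarrow> X j \<le> running_max X n"
  by (induction n) (auto simp: le_Suc_eq intro: max.coboundedI1)

lemma running_max_le_sum:
  assumes "\<And>j. 0 \<le> X j" shows "running_max X n \<le> (\<Sum>j\<le>n. X j)"
proof (induction n)
  case (Suc n)
  have "0 \<le> (\<Sum>j\<le>n. X j)" using assms by (simp add: sum_nonneg)
  then show ?case using Suc assms[of "Suc n"] by simp
qed simp

lemma running_max_nonneg: "(\<And>j. 0 \<le> X j) \<Longrightarrow> 0 \<le> running_max X n"
  using running_max_ge[of 0 n X] by (meson le0 order_trans)

text \<open>Doob's inequality before taking expectations: the sum is the discrete integral of the running maximum against \<open>X\<close>,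
  with nonnegative expectation for a submartingale. The running maximum changes only when
  \<open>X\<close> attains it, so that a discrete chain rule bounds its square by twice its product with \<open>X n\<close>, minus
  twice the sum.\<close>

lemma pathwise_doob:
  fixes X :: "nat \<Rightarrow> real"
  assumes nn: "\<And>j. 0 \<le> X j"
  shows "(running_max X n)\<^sup>2 \<le> 4 * (X n)\<^sup>2 - 4 * (\<Sum>i<n. running_max X i * (X (Suc i) - X i))"
proof -
  have key: "(running_max X n)\<^sup>2 \<le> 2 * running_max X n * X n - 2 * (\<Sum>i<n. running_max X i * (X (Suc i) - X i))"
  proof (induction n)
    case 0 show ?case by (simp add: power2_eq_square)
  next
    case (Suc n)
    define G where "G = running_max X n"
    define S where "S = (\<Sum>i<n. running_max X i * (X (Suc i) - X i))"
    have IH: "G\<^sup>2 \<le> 2 * G * X n - 2 * S" using Suc by (simp add: G_def S_def)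
    have sum: "(\<Sum>i<Suc n. running_max X i * (X (Suc i) - X i)) = S + G * (X (Suc n) - X n)"
      by (simp add: S_def G_def)
    show ?case
    proof (cases "X (Suc n) \<le> G")
      case True
      then have "running_max X (Suc n) = G" by (simp add: G_def)
      then show ?thesis unfolding sum using IH by (simp add: algebra_simps)
    next
      case False
      then have r: "running_max X (Suc n) = X (Suc n)" by (simp add: G_def)
      have "0 \<le> (X (Suc n) - G)\<^sup>2" by simp
      then show ?thesis unfolding sum r using IH by (simp add: algebra_simps power2_eq_square)
    qed
  qed
  (* This bounds the product in the chain rule by half of the square of the maximum, which is absorbed, and a multiple of the square of X n. *)
  have "0 \<le> (running_max X n - 2 * X n)\<^sup>2" by simp
  then have "2 * running_max X n * X n \<le> (running_max X n)\<^sup>2 / 2 + 2 * (X n)\<^sup>2"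
    by (simp add: power2_eq_square algebra_simps)
  then show ?thesis using key by linarith
qed

text \<open>The vector \<open>sgn x\<close> is a subgradient of the norm at \<open>x\<close>. This bounds the increments of the norm of a
  martingale from below by those of a martingale.\<close>

lemma norm_increment_ge:
  fixes x y :: "'v::real_inner"
  shows "sgn x \<bullet> (y - x) \<le> norm y - norm x"
proof -
  have "sgn x \<bullet> y \<le> norm (sgn x) * norm y" by (rule norm_cauchy_schwarz)
  also have "\<dots> \<le> 1 * norm y" by (intro mult_right_mono) (auto simp: norm_sgn)
  finally have "sgn x \<bullet> y \<le> norm y" by simp
  moreover have "sgn x \<bullet> x = norm x"
    by (cases "x = 0") (simp_all add: sgn_div_norm dot_square_norm power2_eq_square)
  ultimately show ?thesis by (simp add: inner_diff_right)
qed

context brownian_basis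
begin

text \<open>Combining \<open>pathwise_doob\<close> with \<open>norm_increment_ge\<close> leaves a sum of products of an adapted vector with a
  martingale increment, and such products have mean \<open>0\<close>.\<close>

lemma discrete_doob:
  fixes M :: "real \<Rightarrow> 'w \<Rightarrow> real^'m"
  assumes V: "ito_limit V M" and \<tau>: "\<And>j. 0 \<le> \<tau> j" "\<And>j. \<tau> j \<le> \<tau> (Suc j)" "\<And>j. \<tau> j \<le> T"
  shows "(\<lambda>\<omega>. running_max (\<lambda>j. norm (M (\<tau> j) \<omega>)) n) \<in> borel_measurable P" (is ?g1)
    and "(\<integral>\<^sup>+\<omega>. ennreal ((running_max (\<lambda>j. norm (M (\<tau> j) \<omega>)) n)\<^sup>2) \<partial>P) \<le> 4 * (sqnorm P (\<lambda>\<omega>. M (\<tau> n) \<omega>))" (is ?g2)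
proof -
  note D = ito_limitD[OF V]
  define X where "X j \<omega> = norm (M (\<tau> j) \<omega>)" for j \<omega>
  define G where "G i \<omega> = running_max (\<lambda>j. X j \<omega>) i" for i \<omega>
  have XF: "X j \<in> borel_measurable (F (\<tau> j))" for j
    unfolding X_def by (rule measurable_compose[OF D(2)[OF \<tau>(1,3)] borel_measurable_norm])
  have GF: "G i \<in> borel_measurable (F (\<tau> i))" for i
  proof (induction i)
    case 0 show ?case using XF[of 0] by (simp add: G_def[abs_def])
  next
    case (Suc i)
    have "(\<lambda>\<omega>. max (G i \<omega>) (X (Suc i) \<omega>)) \<in> borel_measurable (F (\<tau> (Suc i)))"
      by (intro borel_measurable_max XF measurable_F_mono[OF Suc] \<tau>)
    then show ?case by (simp add: G_def[abs_def])
  qed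
  have GP: "G i \<in> borel_measurable P" for i by (rule measurable_F_P[OF GF])
  then show ?g1 by (simp add: G_def[abs_def] X_def)
  have Xsq: "square_integrable P (X j)" for j
    using D(3)[OF \<tau>(1,3), of j] measurable_F_P[OF XF[of j]] by (simp add: square_integrable_def X_def)
  have Gb: "0 \<le> G i \<omega>" "G i \<omega> \<le> (\<Sum>j\<le>i. X j \<omega>)" for i \<omega>
    unfolding G_def by (auto intro!: running_max_nonneg running_max_le_sum simp: X_def)
  have Gsq: "square_integrable P (G i)" for i
  proof -
    have s: "square_integrable P (\<lambda>\<omega>. \<Sum>j\<le>i. X j \<omega>)" by (intro square_integrable_sum Xsq)
    have "(sqnorm P (G i)) \<le> (sqnorm P (\<lambda>\<omega>. \<Sum>j\<le>i. X j \<omega>))"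
    proof (intro nn_integral_mono ennreal_leI power_mono norm_ge_zero)
      fix \<omega> show "norm (G i \<omega>) \<le> norm (\<Sum>j\<le>i. X j \<omega>)"
        using Gb[of i \<omega>] by simp
    qed
    then show ?thesis using s GP by (simp add: square_integrable_def order.strict_trans1)
  qed
  (* The running maximum times the subgradient of the norm: the integrand of the martingale transform that has mean 0. *)
  define U where "U i \<omega> = G i \<omega> *\<^sub>R sgn (M (\<tau> i) \<omega>)" for i \<omega>
  have sgnF: "(\<lambda>\<omega>. sgn (M (\<tau> i) \<omega>)) \<in> borel_measurable (F (\<tau> i))" for i
    unfolding sgn_div_norm
    by (intro borel_measurable_scaleR borel_measurable_inverse measurable_compose[OF D(2)[OF \<tau>(1,3)] borel_measurable_norm] D(2)[OF \<tau>(1,3)])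
  have UF: "U i \<in> borel_measurable (F (\<tau> i))" for i
    unfolding U_def by (intro borel_measurable_scaleR GF sgnF)
  have Usq: "square_integrable P (U i)" for i
  proof -
    have "(sqnorm P (U i)) \<le> (sqnorm P (G i))"
      by (intro nn_integral_mono ennreal_leI power_mono) (auto simp: U_def norm_sgn)
    then show ?thesis using Gsq[of i] measurable_F_P[OF UF[of i]] by (simp add: square_integrable_def order.strict_trans1)
  qed
  have Msq: "square_integrable P (\<lambda>\<omega>. M (\<tau> (Suc i)) \<omega> - M (\<tau> i) \<omega>)" for i
    by (intro square_integrable_diff D(3) \<tau>)
  have Ui: "integrable P (\<lambda>\<omega>. U i \<omega> \<bullet> (M (\<tau> (Suc i)) \<omega> - M (\<tau> i) \<omega>))" for i
    by (rule square_integrable_inner_integrable[OF Usq Msq])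
  have path: "(G n \<omega>)\<^sup>2 + 4 * (\<Sum>i<n. U i \<omega> \<bullet> (M (\<tau> (Suc i)) \<omega> - M (\<tau> i) \<omega>)) \<le> 4 * (X n \<omega>)\<^sup>2" for \<omega>
  proof -
    have "(\<Sum>i<n. U i \<omega> \<bullet> (M (\<tau> (Suc i)) \<omega> - M (\<tau> i) \<omega>)) \<le> (\<Sum>i<n. G i \<omega> * (X (Suc i) \<omega> - X i \<omega>))"
    proof (rule sum_mono)
      fix i
      show "U i \<omega> \<bullet> (M (\<tau> (Suc i)) \<omega> - M (\<tau> i) \<omega>) \<le> G i \<omega> * (X (Suc i) \<omega> - X i \<omega>)"
        unfolding U_def inner_scaleR_left X_def by (rule mult_left_mono[OF norm_increment_ge Gb(1)])
    qed
    moreover have "(G n \<omega>)\<^sup>2 \<le> 4 * (X n \<omega>)\<^sup>2 - 4 * (\<Sum>i<n. G i \<omega> * (X (Suc i) \<omega> - X i \<omega>))"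
      unfolding G_def by (rule pathwise_doob) (simp add: X_def)
    ultimately show ?thesis by linarith
  qed
  have iG: "integrable P (\<lambda>\<omega>. (G n \<omega>)\<^sup>2)" and iX: "integrable P (\<lambda>\<omega>. (X n \<omega>)\<^sup>2)"
    using Gsq[of n] Xsq[of n] by (auto simp: square_integrable_iff)
  have iS: "integrable P (\<lambda>\<omega>. \<Sum>i<n. U i \<omega> \<bullet> (M (\<tau> (Suc i)) \<omega> - M (\<tau> i) \<omega>))"
    by (intro Bochner_Integration.integrable_sum Ui)
  have zero: "(\<integral>\<omega>. (\<Sum>i<n. U i \<omega> \<bullet> (M (\<tau> (Suc i)) \<omega> - M (\<tau> i) \<omega>)) \<partial>P) = 0"
    by (subst Bochner_Integration.integral_sum[OF Ui])
      (intro sum.neutral ballI ito_orthogonality[OF V] \<tau> UF Usq)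
  have "(\<integral>\<omega>. (G n \<omega>)\<^sup>2 \<partial>P) = (\<integral>\<omega>. (G n \<omega>)\<^sup>2 + 4 * (\<Sum>i<n. U i \<omega> \<bullet> (M (\<tau> (Suc i)) \<omega> - M (\<tau> i) \<omega>)) \<partial>P)"
    using iG iS zero by simp
  also have "\<dots> \<le> (\<integral>\<omega>. 4 * (X n \<omega>)\<^sup>2 \<partial>P)"
    using iG iS iX path by (intro integral_mono Bochner_Integration.integrable_add integrable_mult_right) auto
  finally have le: "(\<integral>\<omega>. (G n \<omega>)\<^sup>2 \<partial>P) \<le> 4 * (\<integral>\<omega>. (X n \<omega>)\<^sup>2 \<partial>P)" by simp
  have "(\<integral>\<^sup>+\<omega>. ennreal ((G n \<omega>)\<^sup>2) \<partial>P) = ennreal (\<integral>\<omega>. (G n \<omega>)\<^sup>2 \<partial>P)"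
    by (rule nn_integral_eq_integral[OF iG]) simp
  also have "\<dots> \<le> ennreal (4 * (\<integral>\<omega>. (X n \<omega>)\<^sup>2 \<partial>P))" by (rule ennreal_leI[OF le])
  also have "\<dots> = 4 * ennreal (\<integral>\<omega>. (X n \<omega>)\<^sup>2 \<partial>P)" by (simp add: ennreal_mult)
  also have "ennreal (\<integral>\<omega>. (X n \<omega>)\<^sup>2 \<partial>P) = (\<integral>\<^sup>+\<omega>. ennreal ((X n \<omega>)\<^sup>2) \<partial>P)"
    by (rule nn_integral_eq_integral[OF iX, symmetric]) simp
  finally show ?g2
    by (simp add: G_def X_def)
qed

text \<open>By continuity \<open>|M\<^sub>t|\<^sup>2\<close> is a limit of values on uniform grids and lies below the lower limit of the grid
  maxima, to which Fatou's lemma applies. This lower limit is a measurable majorant, which takes the place of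
  the uncountable supremum.\<close>

lemma doob_maximal:
  fixes M :: "real \<Rightarrow> 'w \<Rightarrow> real^'m"
  assumes V: "ito_limit V M" and cont: "AE \<omega> in P. continuous_on {0..T} (\<lambda>t. M t \<omega>)"
  obtains Q where "Q \<in> borel_measurable P" "AE \<omega> in P. \<forall>t\<in>{0..T}. ennreal ((norm (M t \<omega>))\<^sup>2) \<le> Q \<omega>"
    "(\<integral>\<^sup>+\<omega>. Q \<omega> \<partial>P) \<le> 4 * (sqnorm P (M T))"
proof -
  define \<tau> where "\<tau> m j = min T (T * real j / real (Suc m))" for m j :: nat
  have \<tau>: "0 \<le> \<tau> m j" "\<tau> m j \<le> \<tau> m (Suc j)" "\<tau> m j \<le> T" for m j
  proof -
    show "0 \<le> \<tau> m j" "\<tau> m j \<le> T" using T_pos by (simp_all add: \<tau>_def)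
    have "T * real j / real (Suc m) \<le> T * real (Suc j) / real (Suc m)"
      using T_pos by (intro divide_right_mono mult_left_mono) auto
    then show "\<tau> m j \<le> \<tau> m (Suc j)" unfolding \<tau>_def by (intro min.mono order_refl)
  qed
  have \<tau>T: "\<tau> m (Suc m) = T" for m by (simp add: \<tau>_def)
  define G where "G m \<omega> = ennreal ((running_max (\<lambda>j. norm (M (\<tau> m j) \<omega>)) (Suc m))\<^sup>2)" for m \<omega>
  have Gm: "G m \<in> borel_measurable P" for m
  proof -
    have [measurable]: "(\<lambda>\<omega>. running_max (\<lambda>j. norm (M (\<tau> m j) \<omega>)) (Suc m)) \<in> borel_measurable P"
      by (rule discrete_doob(1)[OF V]) (rule \<tau>)+
    show ?thesis unfolding G_def by measurable
  qed
  have GI: "(\<integral>\<^sup>+\<omega>. G m \<omega> \<partial>P) \<le> 4 * (sqnorm P (M T))" for m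
  proof -
    have "(\<integral>\<^sup>+\<omega>. G m \<omega> \<partial>P) \<le> 4 * (sqnorm P (\<lambda>\<omega>. M (\<tau> m (Suc m)) \<omega>))"
      unfolding G_def by (rule discrete_doob(2)[OF V]) (rule \<tau>)+
    then show ?thesis by (simp only: \<tau>T)
  qed
  define Q where "Q \<omega> = liminf (\<lambda>m. G m \<omega>)" for \<omega>
  show ?thesis
  proof
    show "Q \<in> borel_measurable P" unfolding Q_def using Gm by measurable
    have "(\<integral>\<^sup>+\<omega>. Q \<omega> \<partial>P) \<le> liminf (\<lambda>m. \<integral>\<^sup>+\<omega>. G m \<omega> \<partial>P)"
      unfolding Q_def by (rule nn_integral_liminf[OF Gm])
    also have "\<dots> \<le> liminf (\<lambda>m. 4 * (sqnorm P (M T)))"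
      by (intro Liminf_mono always_eventually allI GI)
    also have "\<dots> = 4 * (sqnorm P (M T))" by (simp add: Liminf_const)
    finally show "(\<integral>\<^sup>+\<omega>. Q \<omega> \<partial>P) \<le> 4 * (sqnorm P (M T))" .
    show "AE \<omega> in P. \<forall>t\<in>{0..T}. ennreal ((norm (M t \<omega>))\<^sup>2) \<le> Q \<omega>"
      using cont
    proof (rule AE_mp, intro AE_I2 impI ballI)
      fix \<omega> t assume c: "continuous_on {0..T} (\<lambda>t. M t \<omega>)" and t: "t \<in> {0..T}"
      (* The index of the last point of the grid that is not after t. *)
      define j where "j m = nat \<lfloor>t / T * real (Suc m)\<rfloor>" for m
      have q: "0 \<le> t / T * real (Suc m)" for m using t T_pos by simp
      have j: "real (j m) \<le> t / T * real (Suc m)" "t / T * real (Suc m) < real (j m) + 1" for m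
        unfolding j_def by (rule real_nat_floor[OF q])+
      have "t / T * real (Suc m) \<le> 1 * real (Suc m)" for m
        using t T_pos by (intro mult_right_mono) auto
      then have jm: "j m \<le> Suc m" for m using j(1)[of m] by (metis mult_1 of_nat_le_iff order_trans)
      have jle: "T * real (j m) / real (Suc m) \<le> t" and jge: "t - T / real (Suc m) \<le> T * real (j m) / real (Suc m)"
        for m
      proof -
        define n where "n = real (Suc m)"
        have n: "n > 0" by (simp add: n_def)
        have "T * real (j m) \<le> t * n" "t * n < T * real (j m) + T"
          using j[of m, folded n_def] T_pos by (simp_all add: field_simps)
        then have "T * real (j m) / n \<le> t" "t \<le> (T * real (j m) + T) / n"
          using n by (simp_all add: pos_divide_le_eq pos_le_divide_eq)
        then show "T * real (j m) / real (Suc m) \<le> t" "t - T / real (Suc m) \<le> T * real (j m) / real (Suc m)"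
          unfolding n_def[symmetric] by (simp_all add: add_divide_distrib)
      qed
      have tau: "\<tau> m (j m) = T * real (j m) / real (Suc m)" for m
        using jle[of m] t by (simp add: \<tau>_def min_def)
      have lim: "(\<lambda>m. \<tau> m (j m)) \<longlonglongrightarrow> t"
      proof (rule tendsto_sandwich[of "\<lambda>m. t - T / real (Suc m)" _ _ "\<lambda>_. t"])
        have "(\<lambda>m. t - T * inverse (real (Suc m))) \<longlonglongrightarrow> t - T * 0"
          by (intro tendsto_intros LIMSEQ_inverse_real_of_nat)
        then show "(\<lambda>m. t - T / real (Suc m)) \<longlonglongrightarrow> t" by (simp add: divide_inverse)
      qed (use jle jge tau in auto)
      have "(\<lambda>m. M (\<tau> m (j m)) \<omega>) \<longlonglongrightarrow> M t \<omega>"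
        using c t \<tau> by (intro continuous_on_tendsto_compose[OF c lim]) auto
      then have "(\<lambda>m. ennreal ((norm (M (\<tau> m (j m)) \<omega>))\<^sup>2)) \<longlonglongrightarrow> ennreal ((norm (M t \<omega>))\<^sup>2)"
        by (intro tendsto_intros)
      then have "ennreal ((norm (M t \<omega>))\<^sup>2) = liminf (\<lambda>m. ennreal ((norm (M (\<tau> m (j m)) \<omega>))\<^sup>2))"
        by (intro lim_imp_Liminf[symmetric]) auto
      also have "\<dots> \<le> Q \<omega>" unfolding Q_def G_def
        by (intro Liminf_mono always_eventually allI ennreal_leI power_mono running_max_ge[OF jm, of "\<lambda>j. norm (M (\<tau> _ j) \<omega>)"]) auto
      finally show "ennreal ((norm (M t \<omega>))\<^sup>2) \<le> Q \<omega>" .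
    qed
  qed
qed

end

section \<open>Stability of backward equations\<close>

lemma nn_integral_square_le:
  fixes f :: "'a \<Rightarrow> real"
  assumes [measurable]: "f \<in> borel_measurable M" and nn: "\<And>x. 0 \<le> f x" and L: "emeasure M (space M) = ennreal L" "0 \<le> L"
  shows "(\<integral>\<^sup>+x. ennreal (f x) \<partial>M)\<^sup>2 \<le> ennreal L * (\<integral>\<^sup>+x. ennreal ((f x)\<^sup>2) \<partial>M)"
proof (cases "L = 0")
  case True
  then have "AE x in M. False" using L by (intro AE_I[where N="space M"]) auto
  then have "(\<integral>\<^sup>+x. ennreal (f x) \<partial>M) = (\<integral>\<^sup>+x. 0 \<partial>M)" by (intro nn_integral_cong_AE) auto
  then show ?thesis by simp
next
  case False
  show ?thesis
  proof (cases "(\<integral>\<^sup>+x. ennreal ((f x)\<^sup>2) \<partial>M) < \<infinity>")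
    case True
    have f: "square_integrable M f" using True by (simp add: square_integrable_def)
    have one: "square_integrable M (\<lambda>x. 1 :: real)" using L by (simp add: square_integrable_def)
    have i: "integrable M f" using square_integrable_inner_integrable[OF f one] by simp
    have m: "measure M (space M) = L" using L by (simp add: measure_def)
    have "(\<integral>x. norm (f x) * norm (1::real) \<partial>M) \<le> sqrt (\<integral>x. (norm (f x))\<^sup>2 \<partial>M) * sqrt (\<integral>x. (norm (1::real))\<^sup>2 \<partial>M)"
      by (rule integral_norm_mult_le[OF f one])
    then have "(\<integral>x. f x \<partial>M) \<le> sqrt (\<integral>x. (f x)\<^sup>2 \<partial>M) * sqrt L" using nn m by simp
    then have "(\<integral>x. f x \<partial>M)\<^sup>2 \<le> (sqrt (\<integral>x. (f x)\<^sup>2 \<partial>M) * sqrt L)\<^sup>2"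
      using nn by (intro power_mono) auto
    also have "\<dots> = L * (\<integral>x. (f x)\<^sup>2 \<partial>M)" using L by (simp add: power_mult_distrib)
    finally have "ennreal ((\<integral>x. f x \<partial>M)\<^sup>2) \<le> ennreal (L * (\<integral>x. (f x)\<^sup>2 \<partial>M))" by (rule ennreal_leI)
    moreover have "(\<integral>\<^sup>+x. ennreal (f x) \<partial>M) = ennreal (\<integral>x. f x \<partial>M)" using i nn by (intro nn_integral_eq_integral) auto
    moreover have "(\<integral>\<^sup>+x. ennreal ((f x)\<^sup>2) \<partial>M) = ennreal (\<integral>x. (f x)\<^sup>2 \<partial>M)"
      using square_integrable_nn_integral[OF f] by simp
    ultimately show ?thesis using L nn by (simp add: ennreal_mult ennreal_power)
  next
    case inf: False
    then have "(\<integral>\<^sup>+x. ennreal ((f x)\<^sup>2) \<partial>M) = \<infinity>" by (simp add: less_top[symmetric])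
    then show ?thesis using False L by (simp add: ennreal_mult_top)
  qed
qed

lemma sum4_square_le:
  fixes a b c d :: real
  shows "(a + b + c + d)\<^sup>2 \<le> 4 * (a\<^sup>2 + b\<^sup>2 + c\<^sup>2 + d\<^sup>2)"
proof -
  have "0 \<le> (a - b)\<^sup>2 + (a - c)\<^sup>2 + (a - d)\<^sup>2 + (b - c)\<^sup>2 + (b - d)\<^sup>2 + (c - d)\<^sup>2" by simp
  then show ?thesis by (simp add: power2_eq_square algebra_simps)
qed

text \<open>The Cauchy-Schwarz inequality in time. The forcing \<open>w\<close>, of which no regularity in time is known, enters through its
  supremum.\<close>

lemma driver_integral_bound:
  fixes G :: "real \<Rightarrow> real^'m" and a1 a2 a3 w :: "real \<Rightarrow> real"
  assumes tu: "0 \<le> t" "t \<le> u" "u \<le> T" and C: "0 \<le> C"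
    and G: "set_integrable lborel {0..T} G"
    and a: "a1 \<in> borel_measurable (restrict_space lborel {0..T})" "a2 \<in> borel_measurable (restrict_space lborel {0..T})"
      "a3 \<in> borel_measurable (restrict_space lborel {0..T})"
    and le: "\<And>s. s \<in> {0..T} \<Longrightarrow> norm (G s) \<le> C * (a1 s + a2 s + a3 s + w s)"
  shows "ennreal ((norm (LINT s:{t..u}|lborel. G s))\<^sup>2) \<le>
    ennreal (4 * C\<^sup>2 * (u - t)) * (\<integral>\<^sup>+s\<in>{t..u}. ennreal ((a1 s)\<^sup>2) + ennreal ((a2 s)\<^sup>2) + ennreal ((a3 s)\<^sup>2) \<partial>lborel)
    + ennreal (4 * C\<^sup>2 * (u - t)\<^sup>2) * (SUP s\<in>{0..T}. ennreal ((w s)\<^sup>2))"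
proof -
  let ?M = "restrict_space lborel {t..u}" and ?S = "SUP s\<in>{0..T}. ennreal ((w s)\<^sup>2)"
  have sub: "{t..u} \<subseteq> {0..T}" using tu by auto
  have Gi: "set_integrable lborel {t..u} G" by (rule set_integrable_subset[OF G]) (use sub in auto)
  then have Gm: "G \<in> borel_measurable ?M"
    by (subst borel_measurable_restrict_space_iff) (auto simp: set_integrable_def)
  have am: "f \<in> borel_measurable ?M" if "f \<in> borel_measurable (restrict_space lborel {0..T})" for f :: "real \<Rightarrow> real"
  proof -
    have "f \<in> borel_measurable (restrict_space (restrict_space lborel {0..T}) {t..u})"
      using that by (rule measurable_restrict_space1)
    moreover have "restrict_space (restrict_space lborel {0..T}) {t..u} = restrict_space lborel ({0..T} \<inter> {t..u})"
      by (rule restrict_restrict_space) auto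
    moreover have "{0..T} \<inter> {t..u} = {t..u}" using sub by blast
    ultimately show ?thesis by metis
  qed
  note [measurable] = am[OF a(1)] am[OF a(2)] am[OF a(3)] Gm
  have L: "emeasure ?M (space ?M) = ennreal (u - t)" using tu by (simp add: emeasure_restrict_space space_restrict_space)
  let ?v = "\<lambda>s. ennreal ((a1 s)\<^sup>2) + ennreal ((a2 s)\<^sup>2) + ennreal ((a3 s)\<^sup>2)"
  have "ennreal (norm (LINT s:{t..u}|lborel. G s)) \<le> (\<integral>\<^sup>+s. ennreal (norm (indicator {t..u} s *\<^sub>R G s)) \<partial>lborel)"
    unfolding set_lebesgue_integral_def
    by (rule integral_norm_bound_ennreal) (use Gi in \<open>simp add: set_integrable_def\<close>)
  also have "\<dots> = (\<integral>\<^sup>+s. ennreal (norm (G s)) \<partial>?M)"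
    by (subst nn_integral_restrict_space) (auto intro!: nn_integral_cong simp: indicator_def)
  finally have "(ennreal (norm (LINT s:{t..u}|lborel. G s)))\<^sup>2 \<le> (\<integral>\<^sup>+s. ennreal (norm (G s)) \<partial>?M)\<^sup>2"
    by (rule power_mono) simp
  also have "\<dots> \<le> ennreal (u - t) * (\<integral>\<^sup>+s. ennreal ((norm (G s))\<^sup>2) \<partial>?M)"
    using L tu by (intro nn_integral_square_le) auto
  also have "(\<integral>\<^sup>+s. ennreal ((norm (G s))\<^sup>2) \<partial>?M) \<le> (\<integral>\<^sup>+s. ennreal (4 * C\<^sup>2) * ?v s + ennreal (4 * C\<^sup>2) * ?S \<partial>?M)"
  proof (rule nn_integral_mono)
    fix s assume "s \<in> space ?M"
    then have s: "s \<in> {0..T}" using sub by (auto simp: space_restrict_space)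
    have "(norm (G s))\<^sup>2 \<le> (C * (a1 s + a2 s + a3 s + w s))\<^sup>2" using le[OF s] by (intro power_mono) auto
    also have "\<dots> \<le> C\<^sup>2 * (4 * ((a1 s)\<^sup>2 + (a2 s)\<^sup>2 + (a3 s)\<^sup>2 + (w s)\<^sup>2))"
      unfolding power_mult_distrib by (intro mult_left_mono sum4_square_le) auto
    finally have "ennreal ((norm (G s))\<^sup>2) \<le> ennreal (4 * C\<^sup>2 * ((a1 s)\<^sup>2 + (a2 s)\<^sup>2 + (a3 s)\<^sup>2) + 4 * C\<^sup>2 * (w s)\<^sup>2)"
      by (intro ennreal_leI) (simp add: algebra_simps)
    also have "\<dots> = ennreal (4 * C\<^sup>2) * ?v s + ennreal (4 * C\<^sup>2) * ennreal ((w s)\<^sup>2)"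
      by (simp add: ennreal_mult[symmetric] ennreal_plus[symmetric] del: ennreal_plus)
    also have "\<dots> \<le> ennreal (4 * C\<^sup>2) * ?v s + ennreal (4 * C\<^sup>2) * ?S"
      using s by (intro add_left_mono mult_left_mono SUP_upper) auto
    finally show "ennreal ((norm (G s))\<^sup>2) \<le> ennreal (4 * C\<^sup>2) * ?v s + ennreal (4 * C\<^sup>2) * ?S" .
  qed
  also have "\<dots> = ennreal (4 * C\<^sup>2) * (\<integral>\<^sup>+s. ?v s \<partial>?M) + ennreal (4 * C\<^sup>2) * ?S * ennreal (u - t)"
    using L by (subst nn_integral_add) (auto simp: nn_integral_cmult)
  also have "(\<integral>\<^sup>+s. ?v s \<partial>?M) = (\<integral>\<^sup>+s\<in>{t..u}. ?v s \<partial>lborel)"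
    by (rule nn_integral_restrict_space) simp
  finally have "(ennreal (norm (LINT s:{t..u}|lborel. G s)))\<^sup>2 \<le>
    ennreal (u - t) * (ennreal (4 * C\<^sup>2) * (\<integral>\<^sup>+s\<in>{t..u}. ?v s \<partial>lborel) + ennreal (4 * C\<^sup>2) * ?S * ennreal (u - t))"
    by (simp add: mult_left_mono)
  also have "\<dots> = (ennreal (4 * C\<^sup>2) * ennreal (u - t)) * (\<integral>\<^sup>+s\<in>{t..u}. ?v s \<partial>lborel) + (ennreal (4 * C\<^sup>2) * (ennreal (u - t) * ennreal (u - t))) * ?S"
    by (simp only: distrib_left mult_ac)
  also have "\<dots> = ennreal (4 * C\<^sup>2 * (u - t)) * (\<integral>\<^sup>+s\<in>{t..u}. ?v s \<partial>lborel) + ennreal (4 * C\<^sup>2 * (u - t)\<^sup>2) * ?S"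
    using tu by (simp add: ennreal_mult power2_eq_square)
  finally show ?thesis by (simp add: ennreal_power)
qed

lemma set_integral_split_at:
  fixes G :: "real \<Rightarrow> real^'m"
  assumes tu: "0 \<le> t" "t \<le> u" "u \<le> T" and G: "set_integrable lborel {0..T} G"
  shows "(LINT s:{t..T}|lborel. G s) = (LINT s:{t..u}|lborel. G s) + (LINT s:{u..T}|lborel. G s)"
proof -
  have "{t..T} = {t..u} \<union> {u..T}" using tu by auto
  moreover have "(LINT s:{t..u} \<union> {u..T}|lborel. G s) = (LINT s:{t..u}|lborel. G s) + (LINT s:{u..T}|lborel. G s)"
  proof (rule set_integral_Un_AE)
    have "AE s in lborel. s \<noteq> u" by (rule AE_lborel_singleton)
    then show "AE s in lborel. \<not> (s \<in> {t..u} \<and> s \<in> {u..T})" by eventually_elim auto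
  qed (use tu in \<open>auto intro: set_integrable_subset[OF G]\<close>)
  ultimately show ?thesis by simp
qed

text \<open>The summands come from the driver, from Doob's inequality (\<open>8 \<sqdot> 4\<close>) and from the energies of the
  integrands (\<open>1\<close>).\<close>

definition stability_constant :: "real \<Rightarrow> real \<Rightarrow> real" where
  "stability_constant C T = (8 * C\<^sup>2 * T * (T + 1) + 33) * iteration_constant C T"

context brownian_basis
begin

lemma measurable_time_indicator:
  fixes X :: "real \<times> 'w \<Rightarrow> ennreal"
  assumes "X \<in> borel_measurable timespace"
  shows "(\<lambda>p. X p * indicator {t..u} (fst p)) \<in> borel_measurable timespace"
proof -
  have "(\<lambda>p. X p * indicator ({p. fst p \<in> {t..u}} \<inter> space timespace) p) \<in> borel_measurable timespace"
    by (intro borel_measurable_times_ennreal assms borel_measurable_indicator measurable_fst_timespace) simp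
  then show ?thesis by (rule measurable_cong[THEN iffD1, rotated]) (auto simp: indicator_def)
qed

lemma time_integral:
  fixes X :: "real \<times> 'w \<Rightarrow> ennreal"
  assumes X: "X \<in> borel_measurable timespace" and tu: "0 \<le> t" "u \<le> T"
  shows "(\<lambda>\<omega>. \<integral>\<^sup>+s\<in>{t..u}. X (s, \<omega>) \<partial>lborel) \<in> borel_measurable P" (is ?g1)
    and "(\<integral>\<^sup>+\<omega>. (\<integral>\<^sup>+s\<in>{t..u}. X (s, \<omega>) \<partial>lborel) \<partial>P) = (\<integral>\<^sup>+p. X p * indicator {t..u} (fst p) \<partial>timespace)" (is ?g2)
    and "(\<integral>\<^sup>+\<omega>. (\<integral>\<^sup>+s\<in>{t..u}. X (s, \<omega>) \<partial>lborel) \<partial>P) = (\<integral>\<^sup>+s\<in>{t..u}. (\<integral>\<^sup>+\<omega>. X (s, \<omega>) \<partial>P) \<partial>lborel)" (is ?g3)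
proof -
  have sub: "{t..u} \<subseteq> {0..T}" using tu by auto
  have ind: "(x * indicator {t..u} s) * indicator {0..T} s = x * indicator {t..u} s" for s and x :: ennreal
    using sub by (auto simp: indicator_def)
  note m = measurable_time_indicator[OF X, of t u]
  show e: ?g2
    using nn_integral_timespace(1)[OF m] by (simp add: ind)
  have "(\<integral>\<^sup>+\<omega>. X (s, \<omega>) * indicator {t..u} s \<partial>P) = (\<integral>\<^sup>+\<omega>. X (s, \<omega>) \<partial>P) * indicator {t..u} s" for s
    by (auto simp: indicator_def)
  then show ?g3
    unfolding e using nn_integral_timespace(2)[OF m] by (simp add: ind)
  have "(\<lambda>(\<omega>, s). X (s, \<omega>) * indicator {t..u} s) \<in> borel_measurable (P \<Otimes>\<^sub>M restrict_space lborel {0..T})"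
    using measurable_pair_swap[OF m[unfolded timespace_def]] by (simp add: case_prod_beta')
  then have "(\<lambda>\<omega>. \<integral>\<^sup>+s. X (s, \<omega>) * indicator {t..u} s \<partial>restrict_space lborel {0..T}) \<in> borel_measurable P"
    by (rule sigma_finite_measure.borel_measurable_nn_integral[OF sigma_finite_time])
  then show ?g1
    by (simp add: nn_integral_restrict_space ind)
qed

lemma ito_limit_at_zero:
  assumes V: "ito_limit V M"
  shows "AE \<omega> in P. M 0 \<omega> = 0"
proof -
  obtain L where L: "\<And>l. valid (L l)"
    and Li: "\<And>t. t \<in> {0..T} \<Longrightarrow> l2_tendsto P (\<lambda>l. terms_integral B (L l) t) (M t)"
    using V unfolding ito_limit_def by blast
  have z: "terms_integral B (L l) 0 \<omega> = 0" for l \<omega> using terms_integral_at_zero[OF L] by simp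
  have "(\<lambda>l::nat. \<integral>\<^sup>+\<omega>. ennreal ((norm (M 0 \<omega>))\<^sup>2) \<partial>P) \<longlonglongrightarrow> 0"
    using Li[of 0] T_pos by (simp add: l2_tendsto_def z)
  then have "(sqnorm P (M 0)) = 0" by (simp add: LIMSEQ_const_iff)
  moreover have "M 0 \<in> borel_measurable P" using ito_limitD(3)[OF V, of 0] T_pos by auto
  ultimately have "AE \<omega> in P. ennreal ((norm (M 0 \<omega>))\<^sup>2) = 0" by (subst (asm) nn_integral_0_iff_AE) auto
  then show ?thesis by eventually_elim (simp add: ennreal_eq_0_iff)
qed

lemma energy_eq:
  assumes V: "ito_limit V M" and k: "k \<in> K" and tu: "0 \<le> t" "u \<le> T"
  shows "(\<integral>\<^sup>+\<omega>. energy t u (\<lambda>s. V k s \<omega>) \<partial>P) =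
    ennreal (\<integral>p. indicator {t..u} (fst p) * (norm (V k (fst p) (snd p)))\<^sup>2 \<partial>timespace)"
proof -
  note sq = ito_limitD(1)[OF V k]
  have m: "(\<lambda>p. ennreal ((norm (V k (fst p) (snd p)))\<^sup>2)) \<in> borel_measurable timespace"
    using sq by (auto simp: square_integrable_def)
  have "(\<integral>\<^sup>+\<omega>. energy t u (\<lambda>s. V k s \<omega>) \<partial>P) =
      (\<integral>\<^sup>+p. ennreal ((norm (V k (fst p) (snd p)))\<^sup>2) * indicator {t..u} (fst p) \<partial>timespace)"
    using time_integral(2)[OF m tu] by simp
  also have "\<dots> = (sqnorm timespace (\<lambda>p. indicator {t..u} (fst p) *\<^sub>R V k (fst p) (snd p)))"
    by (intro nn_integral_cong) (auto simp: indicator_def)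
  also have "\<dots> = ennreal (\<integral>p. (norm (indicator {t..u} (fst p) *\<^sub>R V k (fst p) (snd p)))\<^sup>2 \<partial>timespace)"
    by (rule square_integrable_nn_integral[OF indicator_timespace[OF sq]])
  finally show ?thesis unfolding norm_indicator_square .
qed

text \<open>The square of \<open>U\<^sub>t + (M\<^sub>u - M\<^sub>t) = U\<^sub>u + \<integral>\<^sub>t\<^sup>u G\<^sub>s ds\<close> is integrated: orthogonality and isometry on the left, the
  Lipschitz bound on the right give the hypothesis of \<open>backward_iteration\<close>. The resulting bounds on
  \<open>E|U\<^sub>t|\<^sup>2\<close> for each \<open>t\<close> and on the energies control the driver in mean, and Doob's inequality controls \<open>M\<close>
  uniformly in time. The conclusion is a pathwise bound with a measurable part \<open>g\<close> and a multiple of \<open>S\<close>, a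
  form that is preserved by averages over several equations with the same forcing.\<close>

lemma bsde_stability:
  fixes U G :: "real \<Rightarrow> 'w \<Rightarrow> real^'m" and V :: "'k \<Rightarrow> real \<Rightarrow> 'w \<Rightarrow> real^'d^'m" and w :: "real \<Rightarrow> 'w \<Rightarrow> real"
  assumes C: "0 \<le> C"
    and V: "ito_limit V M" and cont: "AE \<omega> in P. continuous_on {0..T} (\<lambda>t. M t \<omega>)"
    and UF: "\<And>t. t \<in> {0..T} \<Longrightarrow> U t \<in> borel_measurable (F t)"
    and Um: "(\<lambda>p. U (fst p) (snd p)) \<in> borel_measurable timespace"
    and UR: "\<And>t. t \<in> {0..T} \<Longrightarrow> (sqnorm P (U t)) \<le> ennreal R"
    and eq: "AE \<omega> in P. set_integrable lborel {0..T} (\<lambda>s. G s \<omega>) \<and>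
      (\<forall>t\<in>{0..T}. U t \<omega> = (LINT s:{t..T}|lborel. G s \<omega>) - (M T \<omega> - M t \<omega>))"
    and lip: "AE \<omega> in P. \<forall>s\<in>{0..T}. norm (G s \<omega>) \<le> C * (norm (U s \<omega>) + norm (V k1 s \<omega>) + norm (V k2 s \<omega>) + w s \<omega>)"
    and k12: "k1 \<in> K" "k2 \<in> K" "k1 \<noteq> k2"
  defines "S \<equiv> (\<lambda>\<omega>. SUP s\<in>{0..T}. ennreal ((w s \<omega>)\<^sup>2))"
  shows "\<exists>g\<in>borel_measurable P.
    (AE \<omega> in P. \<forall>t\<in>{0..T}. ennreal ((norm (U t \<omega>))\<^sup>2) + (\<Sum>k\<in>K. \<integral>\<^sup>+s\<in>{t..T}. ennreal ((norm (V k s \<omega>))\<^sup>2) \<partial>lborel)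
       \<le> g \<omega> + ennreal (8 * C\<^sup>2 * T\<^sup>2) * S \<omega>) \<and>
    (\<integral>\<^sup>+\<omega>. g \<omega> \<partial>P) \<le> ennreal (stability_constant C T) * (\<integral>\<^sup>+\<omega>. S \<omega> \<partial>P)"
proof -
  have T0: "0 \<le> T" using T_pos by simp
  have ic: "0 < iteration_constant C T" by (simp add: iteration_constant_def add_pos_nonneg)
  have sc: "0 < stability_constant C T"
    unfolding stability_constant_def using ic T_pos by (intro mult_pos_pos add_nonneg_pos) auto
  show ?thesis
  proof (cases "(\<integral>\<^sup>+\<omega>. S \<omega> \<partial>P) = \<infinity>")
    case True
    (* If the right-hand side is infinite, so may be the majorant. *)
    then show ?thesis using sc
      by (intro bexI[of _ "\<lambda>_. \<infinity>"]) (auto simp: ennreal_mult_top)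
  next
    case False
    then obtain lam where lam: "(\<integral>\<^sup>+\<omega>. S \<omega> \<partial>P) = ennreal lam" "0 \<le> lam"
      by (cases "\<integral>\<^sup>+\<omega>. S \<omega> \<partial>P") auto
    note D = ito_limitD[OF V]
    have Usq: "square_integrable P (U t)" if "t \<in> {0..T}" for t
      using UR[OF that] measurable_F_P[OF UF[OF that]] by (auto simp: square_integrable_def intro: order.strict_trans1)
    define f where "f t = (\<integral>\<omega>. (norm (U t \<omega>))\<^sup>2 \<partial>P)" for t
    have f_nn: "(sqnorm P (U t)) = ennreal (f t)" if "t \<in> {0..T}" for t
      unfolding f_def by (rule square_integrable_nn_integral[OF Usq[OF that]])
    have f0: "0 \<le> f t" for t by (simp add: f_def)
    have fR: "f t \<le> max 0 R" if "t \<in> {0..T}" for t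
      using UR[OF that] f0[of t] unfolding f_nn[OF that] by (cases "0 \<le> R") (auto simp: ennreal_neg)
    define p where "p t u = (\<Sum>k\<in>K. \<integral>x. indicator {t..u} (fst x) * (norm (V k (fst x) (snd x)))\<^sup>2 \<partial>timespace)" for t u
    have p_iso: "p t u = (\<integral>\<omega>. (norm (M u \<omega> - M t \<omega>))\<^sup>2 \<partial>P)" if "0 \<le> t" "t \<le> u" "u \<le> T" for t u
      unfolding p_def using ito_isometry[OF V that] by simp
    have p_nn: "(\<Sum>k\<in>K. \<integral>\<^sup>+\<omega>. energy t u (\<lambda>s. V k s \<omega>) \<partial>P) = ennreal (p t u)" if "0 \<le> t" "u \<le> T" for t u
      unfolding p_def using energy_eq[OF V _ that] by (simp add: sum_nonneg)
    have Vm: "(\<lambda>p. ennreal ((norm (V k (fst p) (snd p)))\<^sup>2)) \<in> borel_measurable timespace" if "k \<in> K" for k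
      using D(1)[OF that] by (auto simp: square_integrable_def)
    have Um2: "(\<lambda>p. ennreal ((norm (U (fst p) (snd p)))\<^sup>2)) \<in> borel_measurable timespace" using Um by measurable
    (* The part of the Lipschitz bound that the left-hand side controls. *)
    define X where "X p = ennreal ((norm (U (fst p) (snd p)))\<^sup>2) + ennreal ((norm (V k1 (fst p) (snd p)))\<^sup>2) + ennreal ((norm (V k2 (fst p) (snd p)))\<^sup>2)" for p
    have Xm: "X \<in> borel_measurable timespace"
      unfolding X_def by (intro borel_measurable_add Um2 Vm k12)
    have X_int: "(\<integral>\<^sup>+\<omega>. (\<integral>\<^sup>+s\<in>{t..u}. X (s, \<omega>) \<partial>lborel) \<partial>P) \<le> ennreal ((u - t) * m + p t u)"
      if tu: "0 \<le> t" "t \<le> u" "u \<le> T" and m: "\<And>r. r \<in> {t..u} \<Longrightarrow> f r \<le> m" for t u m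
    proof -
      have m0: "0 \<le> m" using m[of u] f0[of u] tu by auto
      have Ui: "(\<integral>\<^sup>+\<omega>. energy t u (\<lambda>s. U s \<omega>) \<partial>P) \<le> ennreal ((u - t) * m)"
      proof -
        have "(\<integral>\<^sup>+\<omega>. energy t u (\<lambda>s. U s \<omega>) \<partial>P) = (\<integral>\<^sup>+s\<in>{t..u}. (sqnorm P (U s)) \<partial>lborel)"
          using time_integral(3)[OF Um2 tu(1,3)] by simp
        also have "\<dots> \<le> (\<integral>\<^sup>+s. ennreal m * indicator {t..u} s \<partial>lborel)"
        proof (rule nn_integral_mono)
          fix s :: real
          show "(sqnorm P (U s)) * indicator {t..u} s \<le> ennreal m * indicator {t..u} s"
            using f_nn[of s] m[of s] tu by (cases "s \<in> {t..u}") (auto intro: ennreal_leI)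
        qed
        also have "\<dots> = ennreal m * ennreal (u - t)" using tu by (simp add: nn_integral_cmult_indicator)
        also have "\<dots> = ennreal ((u - t) * m)" using tu m0 by (simp add: ennreal_mult mult.commute)
        finally show ?thesis .
      qed
      have "(\<integral>\<^sup>+\<omega>. (\<integral>\<^sup>+s\<in>{t..u}. X (s, \<omega>) \<partial>lborel) \<partial>P) = (\<integral>\<^sup>+p. X p * indicator {t..u} (fst p) \<partial>timespace)"
        by (rule time_integral(2)[OF Xm tu(1,3)])
      also have "\<dots> = (\<integral>\<^sup>+p. ennreal ((norm (U (fst p) (snd p)))\<^sup>2) * indicator {t..u} (fst p) \<partial>timespace) +
         (\<integral>\<^sup>+p. ennreal ((norm (V k1 (fst p) (snd p)))\<^sup>2) * indicator {t..u} (fst p) \<partial>timespace) +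
         (\<integral>\<^sup>+p. ennreal ((norm (V k2 (fst p) (snd p)))\<^sup>2) * indicator {t..u} (fst p) \<partial>timespace)"
      proof -
        note i = measurable_time_indicator
        show ?thesis unfolding X_def distrib_right
          by (subst nn_integral_add, intro borel_measurable_add i Um2 Vm k12, intro i Vm k12,
              subst nn_integral_add, intro i Um2, intro i Vm k12, rule refl)
      qed
      also have "\<dots> = (\<integral>\<^sup>+\<omega>. energy t u (\<lambda>s. U s \<omega>) \<partial>P) +
          ((\<integral>\<^sup>+\<omega>. energy t u (\<lambda>s. V k1 s \<omega>) \<partial>P) +
          (\<integral>\<^sup>+\<omega>. energy t u (\<lambda>s. V k2 s \<omega>) \<partial>P))"
        using time_integral(2)[OF Um2 tu(1,3)] time_integral(2)[OF Vm[OF k12(1)] tu(1,3)] time_integral(2)[OF Vm[OF k12(2)] tu(1,3)]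
        by (simp add: add.assoc)
      also have "(\<integral>\<^sup>+\<omega>. energy t u (\<lambda>s. V k1 s \<omega>) \<partial>P) +
          (\<integral>\<^sup>+\<omega>. energy t u (\<lambda>s. V k2 s \<omega>) \<partial>P) =
          (\<Sum>k\<in>{k1, k2}. \<integral>\<^sup>+\<omega>. energy t u (\<lambda>s. V k s \<omega>) \<partial>P)"
        using k12 by simp
      also have "\<dots> \<le> (\<Sum>k\<in>K. \<integral>\<^sup>+\<omega>. energy t u (\<lambda>s. V k s \<omega>) \<partial>P)"
        using k12 finite_K by (intro sum_mono2) auto
      also have "\<dots> = ennreal (p t u)" by (rule p_nn[OF tu(1,3)])
      finally have "(\<integral>\<^sup>+\<omega>. (\<integral>\<^sup>+s\<in>{t..u}. X (s, \<omega>) \<partial>lborel) \<partial>P) \<le>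
        (\<integral>\<^sup>+\<omega>. energy t u (\<lambda>s. U s \<omega>) \<partial>P) + ennreal (p t u)" by (simp add: add_left_mono)
      also have "\<dots> \<le> ennreal ((u - t) * m) + ennreal (p t u)" by (rule add_right_mono[OF Ui])
      also have "\<dots> = ennreal ((u - t) * m + p t u)"
        using tu m0 p_iso[OF tu] by (intro ennreal_plus[symmetric]) auto
      finally show ?thesis .
    qed
    have sections: "\<omega> \<in> space P \<Longrightarrow> (\<lambda>s. norm (h (s, \<omega>))) \<in> borel_measurable (restrict_space lborel {0..T})"
      if "h \<in> borel_measurable timespace" for h :: "real \<times> 'w \<Rightarrow> 'z::euclidean_space" and \<omega>
    proof -
      assume \<omega>: "\<omega> \<in> space P"
      have "(\<lambda>s. (s, \<omega>)) \<in> measurable (restrict_space lborel {0..T}) timespace"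
        unfolding timespace_def using \<omega> by (intro measurable_Pair2') simp
      from measurable_compose[OF this that] show "(\<lambda>s. norm (h (s, \<omega>))) \<in> borel_measurable (restrict_space lborel {0..T})"
        by (rule measurable_compose[OF _ borel_measurable_norm])
    qed
    have Vm1: "(\<lambda>p. V k (fst p) (snd p)) \<in> borel_measurable timespace" if "k \<in> K" for k
      using D(1)[OF that] by auto
    have bound: "AE \<omega> in P. \<forall>t u. 0 \<le> t \<longrightarrow> t \<le> u \<longrightarrow> u \<le> T \<longrightarrow>
       ennreal ((norm (LINT s:{t..u}|lborel. G s \<omega>))\<^sup>2) \<le>
         ennreal (4 * C\<^sup>2 * (u - t)) * (\<integral>\<^sup>+s\<in>{t..u}. X (s, \<omega>) \<partial>lborel) + ennreal (4 * C\<^sup>2 * (u - t)\<^sup>2) * S \<omega>"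
      using eq lip AE_space
    proof eventually_elim
      case (elim \<omega>)
      show ?case
      proof (intro allI impI)
        fix t u assume tu: "0 \<le> t" "t \<le> u" "u \<le> T"
        have "ennreal ((norm (LINT s:{t..u}|lborel. G s \<omega>))\<^sup>2) \<le>
          ennreal (4 * C\<^sup>2 * (u - t)) * (\<integral>\<^sup>+s\<in>{t..u}. ennreal ((norm (U s \<omega>))\<^sup>2) + ennreal ((norm (V k1 s \<omega>))\<^sup>2) + ennreal ((norm (V k2 s \<omega>))\<^sup>2) \<partial>lborel)
            + ennreal (4 * C\<^sup>2 * (u - t)\<^sup>2) * (SUP s\<in>{0..T}. ennreal ((w s \<omega>)\<^sup>2))"
          using elim sections[OF Um, of \<omega>] sections[OF Vm1[OF k12(1)], of \<omega>] sections[OF Vm1[OF k12(2)], of \<omega>]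
          by (intro driver_integral_bound tu C) auto
        then show "ennreal ((norm (LINT s:{t..u}|lborel. G s \<omega>))\<^sup>2) \<le>
         ennreal (4 * C\<^sup>2 * (u - t)) * (\<integral>\<^sup>+s\<in>{t..u}. X (s, \<omega>) \<partial>lborel) + ennreal (4 * C\<^sup>2 * (u - t)\<^sup>2) * S \<omega>"
          by (simp add: X_def S_def)
      qed
    qed
    have fT: "f T = 0"
    proof -
      have "AE \<omega> in P. U T \<omega> = 0"
        using eq bound
      proof eventually_elim
        case (elim \<omega>)
        have "U T \<omega> = (LINT s:{T..T}|lborel. G s \<omega>)" using elim(1) T0 by auto
        moreover have "ennreal ((norm (LINT s:{T..T}|lborel. G s \<omega>))\<^sup>2) \<le> 0"
          using elim(2)[rule_format, of T T] T0 by simp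
        ultimately show ?case by (simp add: ennreal_eq_0_iff)
      qed
      then have "(sqnorm P (U T)) = (\<integral>\<^sup>+\<omega>. 0 \<partial>P)"
        by (intro nn_integral_cong_AE) auto
      then show ?thesis using f_nn[of T] f0[of T] T0 by (simp add: ennreal_eq_0_iff)
    qed
    have step: "f t + p t u \<le> 2 * f u + 8 * C\<^sup>2 * (u - t) * ((u - t) * m + p t u) + 8 * C\<^sup>2 * (u - t)\<^sup>2 * lam"
      if tu: "0 \<le> t" "t \<le> u" "u \<le> T" and m: "\<And>r. r \<in> {t..u} \<Longrightarrow> f r \<le> m" for t u m
    proof -
      have tT: "t \<in> {0..T}" "u \<in> {0..T}" using tu by auto
      have m0: "0 \<le> m" using m[of u] f0[of u] tu by auto
      have p0: "0 \<le> p t u" using p_iso[OF tu] by simp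
      have dM: "square_integrable P (\<lambda>\<omega>. M u \<omega> - M t \<omega>)" using tu by (intro square_integrable_diff D(3)) auto
      (* The decisive step: the square of the left-hand side of the equation has no mixed term in the mean. *)
      have orth: "(\<integral>\<omega>. U t \<omega> \<bullet> (M u \<omega> - M t \<omega>) \<partial>P) = 0"
        by (rule ito_orthogonality[OF V tu UF[OF tT(1)] Usq[OF tT(1)]])
      have sum_sq: "square_integrable P (\<lambda>\<omega>. U t \<omega> + (M u \<omega> - M t \<omega>))" by (rule square_integrable_add[OF Usq[OF tT(1)] dM])
      have "(\<integral>\<omega>. (norm (U t \<omega> + (M u \<omega> - M t \<omega>)))\<^sup>2 \<partial>P) =
        (\<integral>\<omega>. (norm (U t \<omega>))\<^sup>2 + 2 * (U t \<omega> \<bullet> (M u \<omega> - M t \<omega>)) + (norm (M u \<omega> - M t \<omega>))\<^sup>2 \<partial>P)"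
        by (intro Bochner_Integration.integral_cong refl) (simp add: power2_norm_eq_inner inner_add_left inner_add_right inner_commute algebra_simps)
      also have "\<dots> = f t + p t u"
      proof -
        have i: "integrable P (\<lambda>\<omega>. (norm (U t \<omega>))\<^sup>2)" "integrable P (\<lambda>\<omega>. U t \<omega> \<bullet> (M u \<omega> - M t \<omega>))" "integrable P (\<lambda>\<omega>. (norm (M u \<omega> - M t \<omega>))\<^sup>2)"
          using Usq[OF tT(1)] dM square_integrable_inner_integrable[OF Usq[OF tT(1)] dM] by (simp_all add: square_integrable_iff)
        show ?thesis unfolding f_def p_iso[OF tu] using i orth by simp
      qed
      finally have "ennreal (f t + p t u) = (sqnorm P (\<lambda>\<omega>. U t \<omega> + (M u \<omega> - M t \<omega>)))"
        by (simp add: square_integrable_nn_integral[OF sum_sq])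
      also have "\<dots> \<le> (\<integral>\<^sup>+\<omega>. 2 * ennreal ((norm (U u \<omega>))\<^sup>2) + ennreal (8 * C\<^sup>2 * (u - t)) * (\<integral>\<^sup>+s\<in>{t..u}. X (s, \<omega>) \<partial>lborel) \<partial>P)
          + (\<integral>\<^sup>+\<omega>. ennreal (8 * C\<^sup>2 * (u - t)\<^sup>2) * S \<omega> \<partial>P)"
      proof (rule nn_integral_le_add_arbitrary)
        have [measurable]: "(\<lambda>\<omega>. \<integral>\<^sup>+s\<in>{t..u}. X (s, \<omega>) \<partial>lborel) \<in> borel_measurable P" by (rule time_integral(1)[OF Xm tu(1,3)])
        have [measurable]: "U u \<in> borel_measurable P" by (rule measurable_F_P[OF UF[OF tT(2)]])
        show "(\<lambda>\<omega>. 2 * ennreal ((norm (U u \<omega>))\<^sup>2) + ennreal (8 * C\<^sup>2 * (u - t)) * (\<integral>\<^sup>+s\<in>{t..u}. X (s, \<omega>) \<partial>lborel)) \<in> borel_measurable P"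
          by (intro borel_measurable_add borel_measurable_times_ennreal borel_measurable_const) measurable
        show "AE \<omega> in P. ennreal ((norm (U t \<omega> + (M u \<omega> - M t \<omega>)))\<^sup>2) \<le>
          2 * ennreal ((norm (U u \<omega>))\<^sup>2) + ennreal (8 * C\<^sup>2 * (u - t)) * (\<integral>\<^sup>+s\<in>{t..u}. X (s, \<omega>) \<partial>lborel) + ennreal (8 * C\<^sup>2 * (u - t)\<^sup>2) * S \<omega>"
          using eq bound
        proof eventually_elim
          case (elim \<omega>)
          have "(LINT s:{t..T}|lborel. G s \<omega>) = (LINT s:{t..u}|lborel. G s \<omega>) + (LINT s:{u..T}|lborel. G s \<omega>)"
            by (rule set_integral_split_at[OF tu]) (use elim in auto)
          then have "U t \<omega> + (M u \<omega> - M t \<omega>) = U u \<omega> + (LINT s:{t..u}|lborel. G s \<omega>)"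
            using elim(1) tT by simp
          then have "ennreal ((norm (U t \<omega> + (M u \<omega> - M t \<omega>)))\<^sup>2) \<le> 2 * ennreal ((norm (U u \<omega>))\<^sup>2) + 2 * ennreal ((norm (LINT s:{t..u}|lborel. G s \<omega>))\<^sup>2)"
            by (simp only: ennreal_norm_add_square_le)
          also have "\<dots> \<le> 2 * ennreal ((norm (U u \<omega>))\<^sup>2) + 2 * (ennreal (4 * C\<^sup>2 * (u - t)) * (\<integral>\<^sup>+s\<in>{t..u}. X (s, \<omega>) \<partial>lborel) + ennreal (4 * C\<^sup>2 * (u - t)\<^sup>2) * S \<omega>)"
            by (intro add_left_mono mult_left_mono elim(2)[rule_format] tu) simp
          also have "\<dots> = 2 * ennreal ((norm (U u \<omega>))\<^sup>2) + (2 * ennreal (4 * C\<^sup>2 * (u - t))) * (\<integral>\<^sup>+s\<in>{t..u}. X (s, \<omega>) \<partial>lborel) + (2 * ennreal (4 * C\<^sup>2 * (u - t)\<^sup>2)) * S \<omega>"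
            by (simp only: distrib_left mult.assoc add.assoc)
          also have "2 * ennreal (4 * C\<^sup>2 * (u - t)) = ennreal (8 * C\<^sup>2 * (u - t))"
            using tu by (simp add: ennreal_mult[symmetric] mult_2[symmetric] flip: ennreal_numeral)
          also have "2 * ennreal (4 * C\<^sup>2 * (u - t)\<^sup>2) = ennreal (8 * C\<^sup>2 * (u - t)\<^sup>2)"
            by (simp add: ennreal_mult[symmetric] flip: ennreal_numeral)
          finally show ?case .
        qed
      qed
      also have "(\<integral>\<^sup>+\<omega>. ennreal (8 * C\<^sup>2 * (u - t)\<^sup>2) * S \<omega> \<partial>P) \<le> ennreal (8 * C\<^sup>2 * (u - t)\<^sup>2) * ennreal lam"
      proof (cases "8 * C\<^sup>2 * (u - t)\<^sup>2 = 0")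
        case True then show ?thesis by (simp only: True ennreal_0 mult_zero_left nn_integral_0_iff_AE) simp
      next
        case False
        then have "0 < 8 * C\<^sup>2 * (u - t)\<^sup>2" by (simp add: less_le)
        from nn_integral_cmult_le_arbitrary[OF this, where M=P and h=S] show ?thesis unfolding lam(1) .
      qed
      also have "(\<integral>\<^sup>+\<omega>. 2 * ennreal ((norm (U u \<omega>))\<^sup>2) + ennreal (8 * C\<^sup>2 * (u - t)) * (\<integral>\<^sup>+s\<in>{t..u}. X (s, \<omega>) \<partial>lborel) \<partial>P) =
         2 * ennreal (f u) + ennreal (8 * C\<^sup>2 * (u - t)) * (\<integral>\<^sup>+\<omega>. (\<integral>\<^sup>+s\<in>{t..u}. X (s, \<omega>) \<partial>lborel) \<partial>P)"
      proof -
        have m1: "(\<lambda>\<omega>. \<integral>\<^sup>+s\<in>{t..u}. X (s, \<omega>) \<partial>lborel) \<in> borel_measurable P" by (rule time_integral(1)[OF Xm tu(1,3)])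
        have [measurable]: "U u \<in> borel_measurable P" by (rule measurable_F_P[OF UF[OF tT(2)]])
        have m2: "(\<lambda>\<omega>. ennreal ((norm (U u \<omega>))\<^sup>2)) \<in> borel_measurable P" by measurable
        show ?thesis
          using m1 m2 by (subst nn_integral_add) (auto simp: nn_integral_cmult f_nn[OF tT(2)])
      qed
      finally have "ennreal (f t + p t u) \<le> 2 * ennreal (f u) + ennreal (8 * C\<^sup>2 * (u - t)) * (\<integral>\<^sup>+\<omega>. (\<integral>\<^sup>+s\<in>{t..u}. X (s, \<omega>) \<partial>lborel) \<partial>P) + ennreal (8 * C\<^sup>2 * (u - t)\<^sup>2) * ennreal lam"
        by (simp add: add_left_mono)
      also have "\<dots> \<le> 2 * ennreal (f u) + ennreal (8 * C\<^sup>2 * (u - t)) * ennreal ((u - t) * m + p t u) + ennreal (8 * C\<^sup>2 * (u - t)\<^sup>2) * ennreal lam"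
        by (intro add_mono mult_left_mono X_int tu m order_refl) auto
      also have "\<dots> = ennreal (2 * f u + 8 * C\<^sup>2 * (u - t) * ((u - t) * m + p t u) + 8 * C\<^sup>2 * (u - t)\<^sup>2 * lam)"
      proof -
        have "0 \<le> (u - t) * m + p t u" using tu m0 p0 by simp
        then show ?thesis using tu f0[of u] lam(2)
          by (simp add: ennreal_plus[symmetric] ennreal_mult[symmetric] del: ennreal_plus flip: ennreal_numeral)
      qed
      finally show ?thesis
        using f0[of u] tu m0 p0 lam(2) by (subst (asm) ennreal_le_iff) auto
    qed
    have p_split: "p s T \<le> p s t + p t T" if st: "0 \<le> s" "s \<le> t" "t \<le> T" for s t
      unfolding p_def sum.distrib[symmetric]
    proof (rule sum_mono)
      fix k assume k: "k \<in> K"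
      have I: "integrable timespace (\<lambda>x. indicator {a..b} (fst x) * (norm (V k (fst x) (snd x)))\<^sup>2)" for a b
        using indicator_timespace[OF D(1)[OF k], of a b] unfolding square_integrable_iff norm_indicator_square by (rule conjunct2)
      have "(\<integral>x. indicator {s..T} (fst x) * (norm (V k (fst x) (snd x)))\<^sup>2 \<partial>timespace) \<le>
        (\<integral>x. indicator {s..t} (fst x) * (norm (V k (fst x) (snd x)))\<^sup>2 + indicator {t..T} (fst x) * (norm (V k (fst x) (snd x)))\<^sup>2 \<partial>timespace)"
        by (intro integral_mono Bochner_Integration.integrable_add I) (auto simp: indicator_def)
      then show "(\<integral>x. indicator {s..T} (fst x) * (norm (V k (fst x) (snd x)))\<^sup>2 \<partial>timespace) \<le>
        (\<integral>x. indicator {s..t} (fst x) * (norm (V k (fst x) (snd x)))\<^sup>2 \<partial>timespace) + (\<integral>x. indicator {t..T} (fst x) * (norm (V k (fst x) (snd x)))\<^sup>2 \<partial>timespace)"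
        by (simp only: Bochner_Integration.integral_add[OF I I])
    qed
    have pTT: "p T T = 0" using p_iso[of T T] T0 by simp
    have p0: "0 \<le> p s t" if "0 \<le> s" "s \<le> t" "t \<le> T" for s t using p_iso[OF that] by simp
    note iter = backward_iteration[where f=f and p=p and R="max 0 R" and lam=lam and C=C, OF T_pos f0 fR fT p0 p_split pTT lam(2) step]
    define c where "c = iteration_constant C T"
    have fc: "f t \<le> c * lam" if "t \<in> {0..T}" for t unfolding c_def by (rule iter(1)) (use that in blast)+
    have pc: "p 0 T \<le> c * lam" unfolding c_def by (rule iter(2)) blast+
    have cl: "0 \<le> c * lam" using ic lam by (simp add: c_def)
    obtain Q where Q: "Q \<in> borel_measurable P" "AE \<omega> in P. \<forall>t\<in>{0..T}. ennreal ((norm (M t \<omega>))\<^sup>2) \<le> Q \<omega>"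
      "(\<integral>\<^sup>+\<omega>. Q \<omega> \<partial>P) \<le> 4 * (sqnorm P (M T))"
      using doob_maximal[OF V cont] .
    have MT: "(sqnorm P (M T)) = ennreal (p 0 T)"
    proof -
      have "(sqnorm P (M T)) = (sqnorm P (\<lambda>\<omega>. M T \<omega> - M 0 \<omega>))"
        using ito_limit_at_zero[OF V] by (intro nn_integral_cong_AE) auto
      also have "\<dots> = ennreal (\<integral>\<omega>. (norm (M T \<omega> - M 0 \<omega>))\<^sup>2 \<partial>P)"
        using T0 by (intro square_integrable_nn_integral square_integrable_diff D(3)) auto
      finally show ?thesis using p_iso[of 0 T] T0 by simp
    qed
    define E where "E k \<omega> = energy 0 T (\<lambda>s. V k s \<omega>)" for k \<omega>
    define I where "I \<omega> = (\<integral>\<^sup>+s\<in>{0..T}. X (s, \<omega>) \<partial>lborel)" for \<omega>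
    (* The measurable parts of the bounds for the driver, the martingale increment from t to T and the energies. *)
    define g where "g \<omega> = ennreal (8 * C\<^sup>2 * T) * I \<omega> + 8 * Q \<omega> + (\<Sum>k\<in>K. E k \<omega>)" for \<omega>
    have Em: "E k \<in> borel_measurable P" if "k \<in> K" for k
      unfolding E_def using time_integral(1)[OF Vm[OF that] order_refl order_refl] by simp
    have Im: "I \<in> borel_measurable P" unfolding I_def by (rule time_integral(1)[OF Xm order_refl order_refl])
    have gm: "g \<in> borel_measurable P"
      unfolding g_def by (intro borel_measurable_add borel_measurable_times_ennreal borel_measurable_sum borel_measurable_const Im Em Q(1))
    have gint: "(\<integral>\<^sup>+\<omega>. g \<omega> \<partial>P) \<le> ennreal (stability_constant C T) * (\<integral>\<^sup>+\<omega>. S \<omega> \<partial>P)"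
    proof -
      have "(\<integral>\<^sup>+\<omega>. g \<omega> \<partial>P) = ennreal (8 * C\<^sup>2 * T) * (\<integral>\<^sup>+\<omega>. I \<omega> \<partial>P) + 8 * (\<integral>\<^sup>+\<omega>. Q \<omega> \<partial>P) + (\<Sum>k\<in>K. \<integral>\<^sup>+\<omega>. E k \<omega> \<partial>P)"
      proof -
        have a: "(\<lambda>\<omega>. ennreal (8 * C\<^sup>2 * T) * I \<omega>) \<in> borel_measurable P" "(\<lambda>\<omega>. 8 * Q \<omega>) \<in> borel_measurable P"
          "(\<lambda>\<omega>. \<Sum>k\<in>K. E k \<omega>) \<in> borel_measurable P"
          by (intro borel_measurable_times_ennreal borel_measurable_sum borel_measurable_const Im Em Q(1), assumption?)+
        show ?thesis
          unfolding g_def nn_integral_add[OF borel_measurable_add[OF a(1,2)] a(3)] nn_integral_add[OF a(1,2)]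
            nn_integral_cmult[OF Im] nn_integral_cmult[OF Q(1)]
          by (intro arg_cong2[where f="(+)"] refl nn_integral_sum Em)
      qed
      also have "\<dots> \<le> ennreal (8 * C\<^sup>2 * T) * ennreal (T * (c * lam) + c * lam) + 8 * (4 * ennreal (c * lam)) + ennreal (c * lam)"
      proof (intro add_mono mult_left_mono)
        have "(\<integral>\<^sup>+\<omega>. I \<omega> \<partial>P) \<le> ennreal ((T - 0) * (c * lam) + p 0 T)"
          unfolding I_def using T0 by (intro X_int fc) auto
        also have "\<dots> \<le> ennreal (T * (c * lam) + c * lam)" using pc by (intro ennreal_leI) simp
        finally show "(\<integral>\<^sup>+\<omega>. I \<omega> \<partial>P) \<le> ennreal (T * (c * lam) + c * lam)" .
        have "(\<integral>\<^sup>+\<omega>. Q \<omega> \<partial>P) \<le> 4 * ennreal (p 0 T)" using Q(3) unfolding MT .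
        also have "\<dots> \<le> 4 * ennreal (c * lam)" by (intro mult_left_mono ennreal_leI pc) simp
        finally show "(\<integral>\<^sup>+\<omega>. Q \<omega> \<partial>P) \<le> 4 * ennreal (c * lam)" .
        show "(\<Sum>k\<in>K. \<integral>\<^sup>+\<omega>. E k \<omega> \<partial>P) \<le> ennreal (c * lam)"
          unfolding E_def p_nn[OF order_refl order_refl] by (rule ennreal_leI[OF pc])
      qed auto
      also have "\<dots> = ennreal (8 * C\<^sup>2 * T * (T * (c * lam) + c * lam) + 8 * (4 * (c * lam)) + c * lam)"
      proof -
        have "0 \<le> T * (c * lam) + c * lam" using mult_nonneg_nonneg[OF T0 cl] cl by linarith
        moreover have "0 \<le> c" using ic by (simp add: c_def)
        ultimately show ?thesis using T0 lam(2)
          by (simp add: ennreal_plus[symmetric] ennreal_mult[symmetric] del: ennreal_plus flip: ennreal_numeral)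
      qed
      also have "\<dots> \<le> ennreal (stability_constant C T * lam)"
        using cl unfolding stability_constant_def c_def by (intro ennreal_leI) (simp add: algebra_simps)
      also have "\<dots> = ennreal (stability_constant C T) * (\<integral>\<^sup>+\<omega>. S \<omega> \<partial>P)"
        using lam sc by (simp add: ennreal_mult)
      finally show ?thesis .
    qed
    have gAE: "AE \<omega> in P. \<forall>t\<in>{0..T}. ennreal ((norm (U t \<omega>))\<^sup>2) + (\<Sum>k\<in>K. \<integral>\<^sup>+s\<in>{t..T}. ennreal ((norm (V k s \<omega>))\<^sup>2) \<partial>lborel)
       \<le> g \<omega> + ennreal (8 * C\<^sup>2 * T\<^sup>2) * S \<omega>"
      using eq bound Q(2)
    proof eventually_elim
      case (elim \<omega>)
      show ?case
      proof
        fix t assume t: "t \<in> {0..T}"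
        have tT: "0 \<le> t" "t \<le> T" using t by auto
        have mono: "(\<integral>\<^sup>+s\<in>{t..T}. h s \<partial>lborel) \<le> (\<integral>\<^sup>+s\<in>{0..T}. h s \<partial>lborel)" for h :: "real \<Rightarrow> ennreal"
          using tT by (intro nn_integral_mono) (auto simp: indicator_def)
        have "U t \<omega> = (LINT s:{t..T}|lborel. G s \<omega>) - (M T \<omega> - M t \<omega>)" using elim(1) t by auto
        then have "(norm (U t \<omega>))\<^sup>2 \<le> 2 * (norm (LINT s:{t..T}|lborel. G s \<omega>))\<^sup>2 + 2 * (norm (M T \<omega> - M t \<omega>))\<^sup>2"
          by (simp add: norm_diff_square_le)
        also have "\<dots> \<le> 2 * (norm (LINT s:{t..T}|lborel. G s \<omega>))\<^sup>2 + 2 * (2 * (norm (M T \<omega>))\<^sup>2 + 2 * (norm (M t \<omega>))\<^sup>2)"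
          by (intro add_left_mono mult_left_mono norm_diff_square_le) auto
        finally have "ennreal ((norm (U t \<omega>))\<^sup>2) \<le> ennreal (2 * (norm (LINT s:{t..T}|lborel. G s \<omega>))\<^sup>2 + (4 * (norm (M T \<omega>))\<^sup>2 + 4 * (norm (M t \<omega>))\<^sup>2))"
          by (intro ennreal_leI) simp
        also have "\<dots> = 2 * ennreal ((norm (LINT s:{t..T}|lborel. G s \<omega>))\<^sup>2) + (4 * ennreal ((norm (M T \<omega>))\<^sup>2) + 4 * ennreal ((norm (M t \<omega>))\<^sup>2))"
          by (simp add: ennreal_plus[symmetric] ennreal_mult[symmetric] del: ennreal_plus flip: ennreal_numeral)
        also have "\<dots> \<le> 2 * (ennreal (4 * C\<^sup>2 * T) * I \<omega> + ennreal (4 * C\<^sup>2 * T\<^sup>2) * S \<omega>) + (4 * Q \<omega> + 4 * Q \<omega>)"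
        proof (intro add_mono mult_left_mono)
          have "ennreal ((norm (LINT s:{t..T}|lborel. G s \<omega>))\<^sup>2) \<le>
            ennreal (4 * C\<^sup>2 * (T - t)) * (\<integral>\<^sup>+s\<in>{t..T}. X (s, \<omega>) \<partial>lborel) + ennreal (4 * C\<^sup>2 * (T - t)\<^sup>2) * S \<omega>"
            using elim(2) tT by simp
          also have "\<dots> \<le> ennreal (4 * C\<^sup>2 * T) * I \<omega> + ennreal (4 * C\<^sup>2 * T\<^sup>2) * S \<omega>"
            unfolding I_def using tT by (intro add_mono mult_mono mono ennreal_leI mult_left_mono power_mono) auto
          finally show "ennreal ((norm (LINT s:{t..T}|lborel. G s \<omega>))\<^sup>2) \<le> ennreal (4 * C\<^sup>2 * T) * I \<omega> + ennreal (4 * C\<^sup>2 * T\<^sup>2) * S \<omega>" .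
        qed (use elim(3) t T0 in auto)
        also have "\<dots> = (2 * ennreal (4 * C\<^sup>2 * T)) * I \<omega> + 8 * Q \<omega> + (2 * ennreal (4 * C\<^sup>2 * T\<^sup>2)) * S \<omega>"
        proof -
          have "4 * Q \<omega> + 4 * Q \<omega> = 8 * Q \<omega>" by (simp only: distrib_right[symmetric]) simp
          then show ?thesis by (simp only: distrib_left mult.assoc add_ac)
        qed
        also have "2 * ennreal (4 * C\<^sup>2 * T) = ennreal (8 * C\<^sup>2 * T)"
          using T0 by (simp add: ennreal_mult[symmetric] flip: ennreal_numeral)
        also have "2 * ennreal (4 * C\<^sup>2 * T\<^sup>2) = ennreal (8 * C\<^sup>2 * T\<^sup>2)"
          by (simp add: ennreal_mult[symmetric] flip: ennreal_numeral)
        finally have "ennreal ((norm (U t \<omega>))\<^sup>2) \<le> ennreal (8 * C\<^sup>2 * T) * I \<omega> + 8 * Q \<omega> + ennreal (8 * C\<^sup>2 * T\<^sup>2) * S \<omega>" .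
        moreover have "(\<Sum>k\<in>K. \<integral>\<^sup>+s\<in>{t..T}. ennreal ((norm (V k s \<omega>))\<^sup>2) \<partial>lborel) \<le> (\<Sum>k\<in>K. E k \<omega>)"
          unfolding E_def by (intro sum_mono mono)
        ultimately have "ennreal ((norm (U t \<omega>))\<^sup>2) + (\<Sum>k\<in>K. \<integral>\<^sup>+s\<in>{t..T}. ennreal ((norm (V k s \<omega>))\<^sup>2) \<partial>lborel) \<le>
          (ennreal (8 * C\<^sup>2 * T) * I \<omega> + 8 * Q \<omega> + ennreal (8 * C\<^sup>2 * T\<^sup>2) * S \<omega>) + (\<Sum>k\<in>K. E k \<omega>)"
          by (rule add_mono)
        then show "ennreal ((norm (U t \<omega>))\<^sup>2) + (\<Sum>k\<in>K. \<integral>\<^sup>+s\<in>{t..T}. ennreal ((norm (V k s \<omega>))\<^sup>2) \<partial>lborel)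
           \<le> g \<omega> + ennreal (8 * C\<^sup>2 * T\<^sup>2) * S \<omega>"
          unfolding g_def by (simp only: add_ac)
      qed
    qed
    show ?thesis using gm gAE gint by blast
  qed
qed

end

section \<open>Measures with finite second moment\<close>

lemma (in complete_measure) measurable_AE_eq:
  assumes g: "g \<in> measurable M N" and eq: "AE x in M. f x = g x" and f: "f \<in> space M \<rightarrow> space N"
  shows "f \<in> measurable M N"
proof (rule measurableI)
  show "f x \<in> space N" if "x \<in> space M" for x using f that by auto
  fix A assume A: "A \<in> sets N"
  show "f -` A \<inter> space M \<in> sets M"
  proof (rule in_sets_AE)
    show "g -` A \<inter> space M \<in> sets M" using g A by (rule measurable_sets)
    show "AE x in M. x \<in> g -` A \<inter> space M \<longleftrightarrow> x \<in> f -` A \<inter> space M" using eq by eventually_elim auto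
  qed auto
qed

text \<open>The empirical measure is the image of the uniform distribution on \<open>{1..n}\<close> under \<open>x\<close>.\<close>

lemma empirical_measure_in_P2:
  fixes x :: "nat \<Rightarrow> 'x::{real_normed_vector, second_countable_topology}"
  assumes n: "n \<ge> 1"
  shows "empirical_measure n x \<in> P2"
proof -
  define U where "U = uniform_count_measure {1..n}"
  have U: "prob_space U" unfolding U_def using n by (intro prob_space_uniform_count_measure) auto
  then interpret U: prob_space U .
  have xm: "x \<in> measurable U borel" unfolding U_def uniform_count_measure_def by simp
  define \<nu> where "\<nu> = distr U borel x"
  have \<nu>A: "emeasure \<nu> A = (\<Sum>j=1..n. emeasure (return borel (x j)) A) / of_nat n" if A: "A \<in> sets borel" for A
  proof -
    have "emeasure \<nu> A = (\<integral>\<^sup>+y. indicator A y \<partial>\<nu>)" using A by (simp add: \<nu>_def)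
    also have "\<dots> = (\<integral>\<^sup>+j. indicator A (x j) \<partial>U)"
      unfolding \<nu>_def using A by (intro nn_integral_distr[OF xm]) auto
    also have "\<dots> = (\<Sum>j\<in>{1..n}. ennreal (1 / real (card {1..n})) * indicator A (x j))"
      unfolding U_def uniform_count_measure_def by (subst nn_integral_point_measure_finite) (auto simp: mult.commute)
    also have "\<dots> = (\<Sum>j\<in>{1..n}. emeasure (return borel (x j)) A) * ennreal (1 / real n)"
      using A by (simp add: sum_distrib_left mult.commute)
    also have "\<dots> = (\<Sum>j=1..n. emeasure (return borel (x j)) A) / of_nat n"
      using n by (simp add: divide_ennreal_def ennreal_of_nat_eq_real_of_nat inverse_ennreal inverse_eq_divide)
    finally show ?thesis .
  qed
  have "empirical_measure n x = measure_of UNIV (sets borel) (emeasure \<nu>)"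
    unfolding empirical_measure_def
  proof (rule measure_of_eq)
    fix a assume "a \<in> sigma_sets UNIV (sets (borel :: 'x measure))"
    then have "a \<in> sets borel" using sets.sigma_sets_eq[of "borel :: 'x measure"] by simp
    then show "(\<Sum>j=1..n. emeasure (return borel (x j)) a) / of_nat n = emeasure \<nu> a" by (simp add: \<nu>A)
  qed auto
  also have "\<dots> = \<nu>"
    using measure_of_of_measure[of \<nu>] by (simp add: \<nu>_def)
  finally have e: "empirical_measure n x = \<nu>" .
  have "(\<integral>\<^sup>+y. ennreal ((norm y)\<^sup>2) \<partial>\<nu>) = (\<integral>\<^sup>+j. ennreal ((norm (x j))\<^sup>2) \<partial>U)"
    unfolding \<nu>_def by (rule nn_integral_distr[OF xm]) measurable
  also have "\<dots> = (\<Sum>j\<in>{1..n}. ennreal (1 / real (card {1..n})) * ennreal ((norm (x j))\<^sup>2))"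
    unfolding U_def uniform_count_measure_def by (subst nn_integral_point_measure_finite) (auto simp: mult.commute)
  also have "\<dots> < \<infinity>" by (simp add: ennreal_mult_less_top)
  finally have "(\<integral>\<^sup>+y. ennreal ((norm y)\<^sup>2) \<partial>\<nu>) < \<infinity>" .
  moreover have "\<nu> \<in> space (prob_algebra borel)"
    using U.prob_space_distr[OF xm] by (simp add: space_prob_algebra \<nu>_def)
  ultimately show ?thesis unfolding e P2_def by simp
qed

lemma completion_ex_borel_measurable_vec:
  fixes g :: "'a \<Rightarrow> real^'m"
  assumes g: "g \<in> borel_measurable (completion M)"
  shows "\<exists>g'\<in>borel_measurable M. (AE x in M. g x = g' x)"
proof -
  have "\<exists>h. h \<in> borel_measurable M \<and> (AE x in M. g x $ i = h x)" for i
    using completion_ex_borel_measurable_real[OF measurable_vec_nth_comp[OF g, of i]] by blast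
  then obtain h where h: "\<And>i. h i \<in> borel_measurable M" "\<And>i. AE x in M. g x $ i = h i x" by metis
  have "AE x in M. \<forall>i\<in>UNIV. g x $ i = h i x" by (subst AE_finite_all) (auto intro: h)
  then have "AE x in M. g x = (\<chi> i. h i x)" by eventually_elim (simp add: vec_eq_iff)
  moreover have "(\<lambda>x. \<chi> i. h i x) \<in> borel_measurable M" by (rule measurable_vecI) (simp add: h)
  ultimately show ?thesis by (rule bexI)
qed

lemma AE_product_space_fst:
  assumes M0: "prob_space M0" and M1: "prob_space M1" and Q: "AE x in M0. Q x"
  shows "AE \<omega> in product_space M0 M1. Q (fst \<omega>)"
proof -
  interpret M0: prob_space M0 by fact
  interpret M1: prob_space M1 by fact
  interpret pair_prob_space M0 M1 ..
  obtain N where N: "N \<in> null_sets M0" "{x \<in> space M0. \<not> Q x} \<subseteq> N" using Q by (auto elim!: AE_E simp: null_sets_def)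
  have "N \<times> space M1 \<in> null_sets (M0 \<Otimes>\<^sub>M M1)"
    using N(1) by (auto simp: null_sets_def M1.emeasure_pair_measure_Times)
  then have "AE \<omega> in M0 \<Otimes>\<^sub>M M1. Q (fst \<omega>)"
    using N(2) by (intro AE_I'[of "N \<times> space M1"]) (auto simp: space_pair_measure)
  then show ?thesis unfolding product_space_def by (rule AE_completion)
qed

text \<open>For a single time this is Fubini's theorem. To have one null set for all times, continuity reduces the
  supremum of the squares to a countable dense set of times, on which \<open>Y\<close> has versions that are measurable for the
  uncompleted product. Almost every section of \<open>Y t\<close> is an almost sure limit of sections of these
  versions, so it is measurable as \<open>M1\<close> is complete, and its second moment is at most the integral of the
  section of the countable supremum.\<close>

lemma conditional_law_in_P2:
  fixes Y :: "real \<Rightarrow> 'a \<times> 'b \<Rightarrow> real^'m"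
  assumes M0: "prob_space M0" and M1: "prob_space M1" and cM1: "complete_measure M1" and T: "0 \<le> T"
    and Ym: "\<And>t. t \<in> {0..T} \<Longrightarrow> Y t \<in> borel_measurable (product_space M0 M1)"
    and cont: "AE \<omega> in product_space M0 M1. continuous_on {0..T} (\<lambda>t. Y t \<omega>)"
    and fin: "(\<integral>\<^sup>+\<omega>. (SUP t\<in>{0..T}. ennreal ((norm (Y t \<omega>))\<^sup>2)) \<partial>product_space M0 M1) < \<infinity>"
  shows "AE \<omega> in product_space M0 M1. \<forall>t\<in>{0..T}. conditional_law M1 (Y t) (fst \<omega>) \<in> P2"
proof -
  interpret M0: prob_space M0 by fact
  interpret M1: prob_space M1 by fact
  interpret C1: complete_measure M1 by fact
  interpret pp: pair_prob_space M0 M1 ..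
  let ?M = "M0 \<Otimes>\<^sub>M M1"
  (* A countable set of times that determines a continuous path. *)
  obtain D where D: "countable D" "D \<subseteq> {0..T}" "{0..T} \<subseteq> closure D"
    using separable[of "{0..T}"] by blast
  have "\<exists>y. y \<in> borel_measurable ?M \<and> (AE p in ?M. Y q p = y p)" if "q \<in> D" for q
    using completion_ex_borel_measurable_vec[of "Y q" ?M] Ym[of q] D(2) that unfolding product_space_def by blast
  then obtain y where y: "\<And>q. q \<in> D \<Longrightarrow> y q \<in> borel_measurable ?M" "\<And>q. q \<in> D \<Longrightarrow> AE p in ?M. Y q p = y q p"
    by metis
  have yeq: "AE p in ?M. \<forall>q\<in>D. Y q p = y q p" using y(2) D(1) by (subst AE_ball_countable) auto
  define g where "g p = (SUP q\<in>D. ennreal ((norm (y q p))\<^sup>2))" for p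
  have gm: "g \<in> borel_measurable ?M"
    unfolding g_def using D(1) y(1) by (intro borel_measurable_SUP) (auto intro!: measurable_compose[OF y(1)])
  have "(\<integral>\<^sup>+p. g p \<partial>?M) \<le> (\<integral>\<^sup>+p. (SUP t\<in>{0..T}. ennreal ((norm (Y t p))\<^sup>2)) \<partial>?M)"
  proof (rule nn_integral_mono_AE)
    show "AE p in ?M. g p \<le> (SUP t\<in>{0..T}. ennreal ((norm (Y t p))\<^sup>2))"
      using yeq
    proof eventually_elim
      case (elim p)
      have "g p = (SUP q\<in>D. ennreal ((norm (Y q p))\<^sup>2))" unfolding g_def using elim by (intro SUP_cong) auto
      also have "\<dots> \<le> (SUP t\<in>{0..T}. ennreal ((norm (Y t p))\<^sup>2))" using D(2) by (intro SUP_subset_mono) auto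
      finally show ?case .
    qed
  qed
  also have "\<dots> < \<infinity>" using fin by (simp add: product_space_def nn_integral_completion)
  finally have gfin: "(\<integral>\<^sup>+p. g p \<partial>?M) < \<infinity>" .
  have gx: "AE x in M0. (\<integral>\<^sup>+z. g (x, z) \<partial>M1) \<noteq> \<infinity>"
  proof (rule nn_integral_PInf_AE)
    show "(\<lambda>x. \<integral>\<^sup>+z. g (x, z) \<partial>M1) \<in> borel_measurable M0" by (rule M1.borel_measurable_nn_integral_fst[OF gm])
    show "(\<integral>\<^sup>+x. (\<integral>\<^sup>+z. g (x, z) \<partial>M1) \<partial>M0) \<noteq> \<infinity>" unfolding M1.nn_integral_fst[OF gm] using gfin by simp
  qed
  have cont': "AE p in ?M. continuous_on {0..T} (\<lambda>t. Y t p)" using cont unfolding product_space_def AE_completion_iff .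
  have good: "AE x in M0. AE z in M1. (\<forall>q\<in>D. Y q (x, z) = y q (x, z)) \<and> continuous_on {0..T} (\<lambda>t. Y t (x, z))"
    by (rule pp.AE_pair) (use yeq cont' in eventually_elim, blast)
  have "AE x in M0. \<forall>t\<in>{0..T}. conditional_law M1 (Y t) x \<in> P2"
    using good gx AE_space
  proof eventually_elim
    case (elim x)
    show ?case
    proof
      fix t assume t: "t \<in> {0..T}"
      have ysec: "(\<lambda>z. y q (x, z)) \<in> borel_measurable M1" if "q \<in> D" for q
        using y(1)[OF that] elim(3) by (rule measurable_compose_Pair1[rotated])
      obtain s where s: "\<And>n::nat. s n \<in> D" "s \<longlonglongrightarrow> t" using D(3) t closure_sequential[of t D] by auto
      have sT: "\<forall>\<^sub>F n in sequentially. s n \<in> {0..T}"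
        by (rule always_eventually, rule allI, rule subsetD[OF D(2) s(1)])
      have lim: "AE z in M1. (\<lambda>n. y (s n) (x, z)) \<longlonglongrightarrow> Y t (x, z)"
        using elim(1)
      proof eventually_elim
        case (elim z)
        have "(\<lambda>n. Y (s n) (x, z)) \<longlonglongrightarrow> Y t (x, z)"
          using conjunct2[OF elim] s(2) t sT by (rule continuous_on_tendsto_compose)
        then show ?case using elim s(1) by simp
      qed
      have Ysec: "(\<lambda>z. Y t (x, z)) \<in> borel_measurable M1"
      proof (rule C1.measurable_AE_eq)
        show "(\<lambda>z. lim (\<lambda>n. y (s n) (x, z))) \<in> borel_measurable M1"
          using ysec[OF s(1)] by (rule borel_measurable_lim_metric)
        show "AE z in M1. Y t (x, z) = lim (\<lambda>n. y (s n) (x, z))" using lim by eventually_elim (simp add: limI)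
      qed auto
      have "(\<integral>\<^sup>+v. ennreal ((norm v)\<^sup>2) \<partial>conditional_law M1 (Y t) x) = (sqnorm M1 (\<lambda>z. Y t (x, z)))"
        unfolding conditional_law_def by (rule nn_integral_distr[OF Ysec]) measurable
      also have "\<dots> \<le> (\<integral>\<^sup>+z. g (x, z) \<partial>M1)"
      proof (rule nn_integral_mono_AE)
        show "AE z in M1. ennreal ((norm (Y t (x, z)))\<^sup>2) \<le> g (x, z)"
          using lim
        proof eventually_elim
          case (elim z)
          have "(\<lambda>n. ennreal ((norm (y (s n) (x, z)))\<^sup>2)) \<longlonglongrightarrow> ennreal ((norm (Y t (x, z)))\<^sup>2)"
            by (intro tendsto_intros elim)
          then show ?case
            by (rule LIMSEQ_le_const2) (auto simp: g_def intro!: SUP_upper s)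
        qed
      qed
      also have "\<dots> < \<infinity>" using elim(2) by (simp add: less_top)
      finally show "conditional_law M1 (Y t) x \<in> P2"
        using M1.prob_space_distr[OF Ysec] by (simp add: P2_def space_prob_algebra conditional_law_def)
    qed
  qed
  then show ?thesis by (rule AE_product_space_fst[OF M0 M1])
qed

lemma bsde_solution_continuous:
  assumes "bsde_solution M T F \<xi> g K B B0 Y Z Z0" and "finite K"
  shows "AE \<omega> in M. continuous_on {0..T} (\<lambda>t. Y t \<omega>)"
proof -
  from assms obtain J J0 where J: "\<forall>k\<in>K. has_ito_integral M T F (B k) (Z k) (J k)" "has_ito_integral M T F B0 Z0 J0"
    and eq: "AE \<omega> in M. set_integrable lborel {0..T} (\<lambda>s. g s \<omega>) \<and>
           (\<forall>t\<in>{0..T}. Y t \<omega> = \<xi> \<omega> + (LINT s:{t..T}|lborel. g s \<omega>)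
              - (\<Sum>k\<in>K. J k T \<omega> - J k t \<omega>) - (J0 T \<omega> - J0 t \<omega>))"
    unfolding bsde_solution_def by blast
  have c: "AE \<omega> in M. \<forall>k\<in>K. continuous_on {0..T} (\<lambda>t. J k t \<omega>)"
    using J(1) assms(2) by (subst AE_finite_all) (auto simp: has_ito_integral_def)
  have c0: "AE \<omega> in M. continuous_on {0..T} (\<lambda>t. J0 t \<omega>)" using J(2) by (simp add: has_ito_integral_def)
  show ?thesis using eq c c0
  proof eventually_elim
    case (elim \<omega>)
    have sub: "set_integrable lborel {t..T} (\<lambda>s. g s \<omega>)" if "t \<in> {0..T}" for t
      using elim(1) that by (auto intro: set_integrable_subset)
    have "continuous_on {0..T} (\<lambda>t. integral {t..T} (\<lambda>s. g s \<omega>))"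
      using elim(1) by (intro indefinite_integral_continuous_1' set_borel_integral_eq_integral(1)) auto
    then have "continuous_on {0..T} (\<lambda>t. LINT s:{t..T}|lborel. g s \<omega>)"
      by (rule continuous_on_cong[THEN iffD1, OF refl, rotated]) (simp add: set_borel_integral_eq_integral(2)[OF sub])
    then have "continuous_on {0..T} (\<lambda>t. \<xi> \<omega> + (LINT s:{t..T}|lborel. g s \<omega>) - (\<Sum>k\<in>K. J k T \<omega> - J k t \<omega>) - (J0 T \<omega> - J0 t \<omega>))"
      using elim by (intro continuous_intros) auto
    then show ?case
      by (rule continuous_on_cong[THEN iffD1, OF refl, rotated]) (use elim(1) in auto)
  qed
qed

section \<open>The particle system and the coupled system\<close>

lemma (in brownian_basis) ito_limit_cong:
  assumes "\<And>k. k \<in> K \<Longrightarrow> V k = V' k" and "ito_limit V M"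
  shows "ito_limit V' M"
  using assms unfolding ito_limit_def by simp

text \<open>The difference of the two equations has terminal value \<open>0\<close>. Its martingale part is written as one family of
  integrands over \<open>{..n}\<close>, with the integrands \<open>Z'\<close> and \<open>Z0'\<close> of the second equation placed at the indices
  \<open>i\<close> and \<open>0\<close>; these are also the two indices that occur in the Lipschitz bound.\<close>

lemma coupled_bsde_estimate:
  fixes B Bi :: "nat \<Rightarrow> real \<Rightarrow> 'w \<Rightarrow> real^'d" and Y Y' :: "real \<Rightarrow> 'w \<Rightarrow> real^'m"
    and Z :: "nat \<Rightarrow> real \<Rightarrow> 'w \<Rightarrow> real^'d^'m" and Z0 Z' Z0' :: "real \<Rightarrow> 'w \<Rightarrow> real^'d^'m"
    and w :: "real \<Rightarrow> 'w \<Rightarrow> real"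
  assumes basis: "brownian_basis P T F {..n} B" and B: "\<And>k. k \<in> {1..n} \<Longrightarrow> Bi k = B k" and i: "i \<in> {1..n}"
    and F': "\<And>t. space (F' t) = space P" "\<And>t. sets (F' t) \<subseteq> sets (F t)"
    and sol: "bsde_solution P T F \<xi> g {1..n} Bi (B 0) Y Z Z0"
    and sol': "bsde_solution P T F' \<xi> g' {()} (\<lambda>_. Bi i) (B 0) Y' (\<lambda>_. Z') Z0'"
    and C: "0 \<le> C"
    and lip: "AE \<omega> in P. \<forall>s\<in>{0..T}. norm (g s \<omega> - g' s \<omega>) \<le>
      C * (norm (Y s \<omega> - Y' s \<omega>) + norm (Z i s \<omega> - Z' s \<omega>) + norm (Z0 s \<omega> - Z0' s \<omega>) + w s \<omega>)"
  defines "S \<equiv> (\<lambda>\<omega>. SUP s\<in>{0..T}. ennreal ((w s \<omega>)\<^sup>2))"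
  shows "\<exists>q\<in>borel_measurable P.
    (AE \<omega> in P. \<forall>t\<in>{0..T}. ennreal ((norm (Y t \<omega> - Y' t \<omega>))\<^sup>2)
        + energy t T (\<lambda>s. Z0 s \<omega> - Z0' s \<omega>)
        + (\<integral>\<^sup>+s\<in>{t..T}. (\<Sum>k=1..n. ennreal ((norm (Z k s \<omega> - of_bool (i = k) *\<^sub>R Z' s \<omega>))\<^sup>2)) \<partial>lborel)
       \<le> q \<omega> + ennreal (8 * C\<^sup>2 * T\<^sup>2) * S \<omega>) \<and>
    (\<integral>\<^sup>+\<omega>. q \<omega> \<partial>P) \<le> ennreal (stability_constant C T) * (\<integral>\<^sup>+\<omega>. S \<omega> \<partial>P)"
proof -
  interpret brownian_basis P T F "{..n}" B by (rule basis)
  obtain J J0 where JB: "\<forall>k\<in>{1..n}. has_ito_integral P T F (Bi k) (Z k) (J k)" and J0: "has_ito_integral P T F (B 0) Z0 J0"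
    and eq: "AE \<omega> in P. set_integrable lborel {0..T} (\<lambda>s. g s \<omega>) \<and>
           (\<forall>t\<in>{0..T}. Y t \<omega> = \<xi> \<omega> + (LINT s:{t..T}|lborel. g s \<omega>)
              - (\<Sum>k\<in>{1..n}. J k T \<omega> - J k t \<omega>) - (J0 T \<omega> - J0 t \<omega>))"
    using sol unfolding bsde_solution_def by blast
  have J: "has_ito_integral P T F (B k) (Z k) (J k)" if "k \<in> {1..n}" for k
    using bspec[OF JB that] unfolding B[OF that] .
  obtain J' J0' where J': "has_ito_integral P T F' (B i) Z' J'" and J0': "has_ito_integral P T F' (B 0) Z0' J0'"
    and eq': "AE \<omega> in P. set_integrable lborel {0..T} (\<lambda>s. g' s \<omega>) \<and>
           (\<forall>t\<in>{0..T}. Y' t \<omega> = \<xi> \<omega> + (LINT s:{t..T}|lborel. g' s \<omega>)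
              - (J' T \<omega> - J' t \<omega>) - (J0' T \<omega> - J0' t \<omega>))"
    using sol' B[OF i] unfolding bsde_solution_def by auto
  have YS: "in_S2 P T F Y" "\<And>k. k \<in> {1..n} \<Longrightarrow> in_H2 P T F (Z k)" "in_H2 P T F Z0"
    and YS': "in_S2 P T F' Y'" "in_H2 P T F' Z'" "in_H2 P T F' Z0'"
    using sol sol' by (auto simp: bsde_solution_def)
  have F'P: "sets (F' t) \<subseteq> sets P" for t using F'(2) F_sub by (rule order_trans)
  have F'F: "h \<in> measurable (F t) N" if "h \<in> measurable (F' t) N" for h t and N :: "'z measure"
    by (rule measurable_mono[THEN subsetD, OF order_refl refl _ _ that]) (use F' in \<open>auto simp: space_F\<close>)
  define V where "V k = (if k = 0 then (\<lambda>s \<omega>. Z0 s \<omega> - Z0' s \<omega>) else (\<lambda>s \<omega>. Z k s \<omega> - of_bool (i = k) *\<^sub>R Z' s \<omega>))" for k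
  define M where "M t \<omega> = (\<Sum>k\<in>{1..n}. J k t \<omega>) + J0 t \<omega> + - J' t \<omega> + - J0' t \<omega>" for t \<omega>
  have lims: "\<And>k. k \<in> {1..n} \<Longrightarrow> ito_limit (\<lambda>k' r \<omega>. of_bool (k = k') *\<^sub>R Z k r \<omega>) (J k)"
    "ito_limit (\<lambda>k' r \<omega>. of_bool (0 = k') *\<^sub>R Z0 r \<omega>) J0"
    "ito_limit (\<lambda>k' r \<omega>. of_bool (i = k') *\<^sub>R Z' r \<omega>) J'"
    "ito_limit (\<lambda>k' r \<omega>. of_bool (0 = k') *\<^sub>R Z0' r \<omega>) J0'"
  proof -
    have iK: "i \<in> {..n}" "0 \<in> {..n}" using i by auto
    show "ito_limit (\<lambda>k' r \<omega>. of_bool (k = k') *\<^sub>R Z k r \<omega>) (J k)" if k: "k \<in> {1..n}" for k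
      by (rule has_ito_integral_ito_limit[OF _ J[OF k] YS(2)[OF k] space_F order_refl]) (use k in simp)
    show "ito_limit (\<lambda>k' r \<omega>. of_bool (0 = k') *\<^sub>R Z0 r \<omega>) J0"
      by (rule has_ito_integral_ito_limit[OF iK(2) J0 YS(3) space_F order_refl])
    show "ito_limit (\<lambda>k' r \<omega>. of_bool (i = k') *\<^sub>R Z' r \<omega>) J'"
      by (rule has_ito_integral_ito_limit[OF iK(1) J' YS'(2) F'])
    show "ito_limit (\<lambda>k' r \<omega>. of_bool (0 = k') *\<^sub>R Z0' r \<omega>) J0'"
      by (rule has_ito_integral_ito_limit[OF iK(2) J0' YS'(3) F'])
  qed
  have VM: "ito_limit V M"
  proof (rule ito_limit_cong)
    show "ito_limit (\<lambda>k' r \<omega>. (\<Sum>k\<in>{1..n}. of_bool (k = k') *\<^sub>R Z k r \<omega>) + of_bool (0 = k') *\<^sub>R Z0 r \<omega>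
        + - (of_bool (i = k') *\<^sub>R Z' r \<omega>) + - (of_bool (0 = k') *\<^sub>R Z0' r \<omega>)) M"
      unfolding M_def by (intro ito_limit_add ito_limit_uminus ito_limit_sum lims) auto
    fix k' assume k': "k' \<in> {..n}"
    have sum: "(\<Sum>k\<in>{1..n}. of_bool (k = k') *\<^sub>R Z k r \<omega>) = (if k' = 0 then 0 else Z k' r \<omega>)" for r \<omega>
    proof -
      have "(\<Sum>k\<in>{1..n}. of_bool (k = k') *\<^sub>R Z k r \<omega>) = (\<Sum>k\<in>{1..n}. if k = k' then Z k r \<omega> else 0)"
        by (intro sum.cong) auto
      then show ?thesis using k' by auto
    qed
    show "(\<lambda>r \<omega>. (\<Sum>k\<in>{1..n}. of_bool (k = k') *\<^sub>R Z k r \<omega>) + of_bool (0 = k') *\<^sub>R Z0 r \<omega>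
        + - (of_bool (i = k') *\<^sub>R Z' r \<omega>) + - (of_bool (0 = k') *\<^sub>R Z0' r \<omega>)) = V k'"
      unfolding sum using i by (auto simp: V_def fun_eq_iff)
  qed
  have cont: "AE \<omega> in P. continuous_on {0..T} (\<lambda>t. M t \<omega>)"
  proof -
    have "AE \<omega> in P. \<forall>k\<in>{1..n}. continuous_on {0..T} (\<lambda>t. J k t \<omega>)"
      using J by (subst AE_finite_all) (auto simp: has_ito_integral_def)
    moreover have "AE \<omega> in P. continuous_on {0..T} (\<lambda>t. J0 t \<omega>)" "AE \<omega> in P. continuous_on {0..T} (\<lambda>t. J' t \<omega>)"
      "AE \<omega> in P. continuous_on {0..T} (\<lambda>t. J0' t \<omega>)" using J0 J' J0' by (auto simp: has_ito_integral_def)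
    ultimately show ?thesis unfolding M_def by eventually_elim (intro continuous_intros, auto)
  qed
  define U where "U t \<omega> = Y t \<omega> - Y' t \<omega>" for t \<omega>
  define G where "G s \<omega> = g s \<omega> - g' s \<omega>" for s \<omega>
  have YF: "Y t \<in> borel_measurable (F t)" "Y' t \<in> borel_measurable (F t)" if "t \<in> {0..T}" for t
  proof -
    have p: "progressive T F Y" "progressive T F' Y'" using YS(1) YS'(1) by (simp_all add: in_S2_def)
    show "Y t \<in> borel_measurable (F t)" using p(1) that by (intro progressive_adapted) auto
    show "Y' t \<in> borel_measurable (F t)" using p(2) that by (intro F'F progressive_adapted) auto
  qed
  have UF: "U t \<in> borel_measurable (F t)" if "t \<in> {0..T}" for t
    unfolding U_def by (intro borel_measurable_diff YF that)
  have Um: "(\<lambda>p. U (fst p) (snd p)) \<in> borel_measurable timespace"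
  proof -
    have p: "progressive T F Y" "progressive T F' Y'" using YS(1) YS'(1) by (simp_all add: in_S2_def)
    show ?thesis unfolding U_def
      by (intro borel_measurable_diff progressive_measurable_timespace[OF p(1) space_F F_sub]
          progressive_measurable_timespace[OF p(2) F'(1) F'P])
  qed
  define R where "R = 2 * (\<integral>\<^sup>+\<omega>. (SUP t\<in>{0..T}. ennreal ((norm (Y t \<omega>))\<^sup>2)) \<partial>P) + 2 * (\<integral>\<^sup>+\<omega>. (SUP t\<in>{0..T}. ennreal ((norm (Y' t \<omega>))\<^sup>2)) \<partial>P)"
  have Rfin: "R < \<infinity>" using YS(1) YS'(1) by (simp add: R_def in_S2_def ennreal_mult_less_top)
  have UR: "(sqnorm P (U t)) \<le> ennreal (enn2real R)" if t: "t \<in> {0..T}" for t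
  proof -
    have "(sqnorm P (\<lambda>\<omega>. Y t \<omega> + - Y' t \<omega>)) \<le> 2 * (sqnorm P (Y t)) + 2 * (sqnorm P (\<lambda>\<omega>. - Y' t \<omega>))"
      by (intro nn_integral_norm_add_square_le borel_measurable_uminus measurable_F_P[OF YF(1)[OF t]] measurable_F_P[OF YF(2)[OF t]])
    also have "\<dots> \<le> R"
      unfolding R_def norm_minus_cancel using t by (intro add_mono mult_left_mono nn_integral_mono SUP_upper) auto
    finally show ?thesis using Rfin by (simp add: U_def less_top)
  qed
  have eqU: "AE \<omega> in P. set_integrable lborel {0..T} (\<lambda>s. G s \<omega>) \<and>
      (\<forall>t\<in>{0..T}. U t \<omega> = (LINT s:{t..T}|lborel. G s \<omega>) - (M T \<omega> - M t \<omega>))"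
    using eq eq'
  proof eventually_elim
    case (elim \<omega>)
    show ?case
    proof (intro conjI ballI)
      show "set_integrable lborel {0..T} (\<lambda>s. G s \<omega>)" unfolding G_def using elim by (intro set_integral_diff(1)) auto
      fix t assume t: "t \<in> {0..T}"
      have "set_integrable lborel {t..T} (\<lambda>s. g s \<omega>)" "set_integrable lborel {t..T} (\<lambda>s. g' s \<omega>)"
        using elim t by (auto intro: set_integrable_subset)
      from set_integral_diff(2)[OF this] have L: "(LINT s:{t..T}|lborel. G s \<omega>) = (LINT s:{t..T}|lborel. g s \<omega>) - (LINT s:{t..T}|lborel. g' s \<omega>)"
        by (simp add: G_def)
      have "U t \<omega> = (\<xi> \<omega> + (LINT s:{t..T}|lborel. g s \<omega>) - (\<Sum>k\<in>{1..n}. J k T \<omega> - J k t \<omega>) - (J0 T \<omega> - J0 t \<omega>))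
         - (\<xi> \<omega> + (LINT s:{t..T}|lborel. g' s \<omega>) - (J' T \<omega> - J' t \<omega>) - (J0' T \<omega> - J0' t \<omega>))"
        unfolding U_def using elim t by simp
      then show "U t \<omega> = (LINT s:{t..T}|lborel. G s \<omega>) - (M T \<omega> - M t \<omega>)"
        unfolding L M_def sum_subtractf by (simp add: algebra_simps)
    qed
  qed
  have lipU: "AE \<omega> in P. \<forall>s\<in>{0..T}. norm (G s \<omega>) \<le> C * (norm (U s \<omega>) + norm (V i s \<omega>) + norm (V 0 s \<omega>) + w s \<omega>)"
    using lip i by (simp add: G_def U_def V_def)
  have "\<exists>q\<in>borel_measurable P.
    (AE \<omega> in P. \<forall>t\<in>{0..T}. ennreal ((norm (U t \<omega>))\<^sup>2) + (\<Sum>k\<in>{..n}. \<integral>\<^sup>+s\<in>{t..T}. ennreal ((norm (V k s \<omega>))\<^sup>2) \<partial>lborel)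
       \<le> q \<omega> + ennreal (8 * C\<^sup>2 * T\<^sup>2) * S \<omega>) \<and>
    (\<integral>\<^sup>+\<omega>. q \<omega> \<partial>P) \<le> ennreal (stability_constant C T) * (\<integral>\<^sup>+\<omega>. S \<omega> \<partial>P)"
    unfolding S_def by (rule bsde_stability[OF C VM cont UF Um UR eqU lipU]) (use i in auto)
  then obtain q where q: "q \<in> borel_measurable P"
    "AE \<omega> in P. \<forall>t\<in>{0..T}. ennreal ((norm (U t \<omega>))\<^sup>2) + (\<Sum>k\<in>{..n}. \<integral>\<^sup>+s\<in>{t..T}. ennreal ((norm (V k s \<omega>))\<^sup>2) \<partial>lborel)
       \<le> q \<omega> + ennreal (8 * C\<^sup>2 * T\<^sup>2) * S \<omega>"
    "(\<integral>\<^sup>+\<omega>. q \<omega> \<partial>P) \<le> ennreal (stability_constant C T) * (\<integral>\<^sup>+\<omega>. S \<omega> \<partial>P)"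
    by blast
  have conv: "(\<Sum>k\<in>{..n}. \<integral>\<^sup>+s\<in>{t..T}. ennreal ((norm (V k s \<omega>))\<^sup>2) \<partial>lborel) =
      energy t T (\<lambda>s. Z0 s \<omega> - Z0' s \<omega>)
      + (\<integral>\<^sup>+s\<in>{t..T}. (\<Sum>k=1..n. ennreal ((norm (Z k s \<omega> - of_bool (i = k) *\<^sub>R Z' s \<omega>))\<^sup>2)) \<partial>lborel)"
    if \<omega>: "\<omega> \<in> space P" and t: "t \<in> {0..T}" for \<omega> t
  proof -
    have m: "(\<lambda>s. ennreal ((norm (V k s \<omega>))\<^sup>2) * indicator {t..T} s) \<in> borel_measurable lborel" if k: "k \<in> {..n}" for k
    proof -
      have Vt: "(\<lambda>p. V k (fst p) (snd p)) \<in> borel_measurable timespace" using ito_limitD(1)[OF VM k] by auto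
      have "(\<lambda>s. (s, \<omega>)) \<in> measurable (restrict_space lborel {0..T}) timespace"
        unfolding timespace_def using \<omega> by (intro measurable_Pair2') simp
      from measurable_compose[OF this Vt] have "(\<lambda>s. V k s \<omega>) \<in> borel_measurable (restrict_space lborel {0..T})" by simp
      then have "(\<lambda>s. ennreal ((norm (V k s \<omega>))\<^sup>2)) \<in> borel_measurable (restrict_space lborel {0..T})" by measurable
      then have "(\<lambda>s. ennreal ((norm (V k s \<omega>))\<^sup>2) * indicator {0..T} s) \<in> borel_measurable lborel"
        by (subst (asm) borel_measurable_restrict_space_iff_ennreal) auto
      then have "(\<lambda>s. (ennreal ((norm (V k s \<omega>))\<^sup>2) * indicator {0..T} s) * indicator {t..T} s) \<in> borel_measurable lborel"
        by (rule borel_measurable_times_ennreal) simp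
      moreover have "(ennreal ((norm (V k s \<omega>))\<^sup>2) * indicator {0..T} s) * indicator {t..T} s = ennreal ((norm (V k s \<omega>))\<^sup>2) * indicator {t..T} s" for s
        using t by (simp add: indicator_def)
      ultimately show ?thesis by (simp only:)
    qed
    have split: "{..n} = insert 0 {1..n}" by auto
    have "(\<Sum>k\<in>{..n}. \<integral>\<^sup>+s\<in>{t..T}. ennreal ((norm (V k s \<omega>))\<^sup>2) \<partial>lborel) =
      energy t T (\<lambda>s. V 0 s \<omega>) + (\<Sum>k\<in>{1..n}. \<integral>\<^sup>+s\<in>{t..T}. ennreal ((norm (V k s \<omega>))\<^sup>2) \<partial>lborel)"
      unfolding split by (subst sum.insert) auto
    also have "(\<Sum>k\<in>{1..n}. \<integral>\<^sup>+s\<in>{t..T}. ennreal ((norm (V k s \<omega>))\<^sup>2) \<partial>lborel) =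
      (\<integral>\<^sup>+s. (\<Sum>k\<in>{1..n}. ennreal ((norm (V k s \<omega>))\<^sup>2) * indicator {t..T} s) \<partial>lborel)"
      by (rule nn_integral_sum[symmetric]) (rule m, auto)
    also have "\<dots> = (\<integral>\<^sup>+s\<in>{t..T}. (\<Sum>k=1..n. ennreal ((norm (Z k s \<omega> - of_bool (i = k) *\<^sub>R Z' s \<omega>))\<^sup>2)) \<partial>lborel)"
      unfolding sum_distrib_right by (intro nn_integral_cong sum.cong refl) (auto simp: V_def)
    finally show ?thesis by (simp add: V_def)
  qed
  have "AE \<omega> in P. \<forall>t\<in>{0..T}. ennreal ((norm (Y t \<omega> - Y' t \<omega>))\<^sup>2)
        + energy t T (\<lambda>s. Z0 s \<omega> - Z0' s \<omega>)
        + (\<integral>\<^sup>+s\<in>{t..T}. (\<Sum>k=1..n. ennreal ((norm (Z k s \<omega> - of_bool (i = k) *\<^sub>R Z' s \<omega>))\<^sup>2)) \<partial>lborel)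
       \<le> q \<omega> + ennreal (8 * C\<^sup>2 * T\<^sup>2) * S \<omega>"
    using q(2) AE_space
  proof eventually_elim
    case (elim \<omega>)
    show ?case
    proof
      fix t assume t: "t \<in> {0..T}"
      have "ennreal ((norm (U t \<omega>))\<^sup>2) + (\<Sum>k\<in>{..n}. \<integral>\<^sup>+s\<in>{t..T}. ennreal ((norm (V k s \<omega>))\<^sup>2) \<partial>lborel)
       \<le> q \<omega> + ennreal (8 * C\<^sup>2 * T\<^sup>2) * S \<omega>" using elim(1) t by (rule bspec)
      then show "ennreal ((norm (Y t \<omega> - Y' t \<omega>))\<^sup>2)
        + energy t T (\<lambda>s. Z0 s \<omega> - Z0' s \<omega>)
        + (\<integral>\<^sup>+s\<in>{t..T}. (\<Sum>k=1..n. ennreal ((norm (Z k s \<omega> - of_bool (i = k) *\<^sub>R Z' s \<omega>))\<^sup>2)) \<partial>lborel)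
       \<le> q \<omega> + ennreal (8 * C\<^sup>2 * T\<^sup>2) * S \<omega>"
        unfolding conv[OF elim(2) t] U_def by (simp only: add.assoc)
    qed
  qed
  then show ?thesis using q(1,3) by blast
qed

lemma lifted_brownian_basis:
  fixes M0 :: "'a measure" and M1 :: "'b measure"
    and W0 :: "real \<Rightarrow> 'a \<Rightarrow> real^'d" and Wi :: "nat \<Rightarrow> real \<Rightarrow> 'b \<Rightarrow> real^'d"
  defines "B \<equiv> lifted_motion W0 Wi" and "P \<equiv> product_space M0 M1"
  assumes M0: "prob_space M0" and M1: "prob_space M1" and T: "T > 0"
    and ind: "prob_space.indep_vars M1 (\<lambda>_. PiM {0..T} (\<lambda>_. borel)) (\<lambda>k. trajectory T (Wi k)) {1..n}"
    and W0: "brownian_motion M0 T W0" and Wi: "\<And>k. k \<in> {1..n} \<Longrightarrow> brownian_motion M1 T (Wi k)"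
  shows "brownian_basis P T (augmented_filtration P T (B ` {..n})) {..n} B"
proof -
  interpret P: prob_space P unfolding P_def by (rule prob_space_product_space[OF M0 M1])
  have Bm: "B k t \<in> borel_measurable P" if "k \<le> n" "0 \<le> t" "t \<le> T" for k t
    unfolding B_def P_def using W0 Wi that by (rule lifted_motion_measurable)
  note mom = filtration_increment_moments[OF M0 M1 ind W0 Wi, folded B_def P_def]
  show ?thesis
  proof
    show "sets (augmented_filtration P T (B ` {..n}) t) \<subseteq> sets P" for t
      by (rule augmented_filtration_sub) (auto intro!: Bm)
    show "sets (augmented_filtration P T (B ` {..n}) s) \<subseteq> sets (augmented_filtration P T (B ` {..n}) t)" if "s \<le> t" for s t
      by (rule augmented_filtration_mono[OF that order_refl])
    show "B k t \<in> borel_measurable (augmented_filtration P T (B ` {..n}) t)" if "k \<in> {..n}" "0 \<le> t" "t \<le> T" for k t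
      using that by (intro measurable_augmented_filtration) auto
  qed (use T mom in auto)
qed

theorem theorem11:
  fixes T :: real
    and M0 :: "'a measure" and M1 :: "'b measure" and P :: "('a \<times> 'b) measure"
    and W0 :: "real \<Rightarrow> 'a \<Rightarrow> real^'d"
    and W :: "real \<Rightarrow> 'b \<Rightarrow> real^'d"
    and Wi :: "nat \<Rightarrow> real \<Rightarrow> 'b \<Rightarrow> real^'d"
    and B0 B :: "real \<Rightarrow> 'a \<times> 'b \<Rightarrow> real^'d"
    and Bi :: "nat \<Rightarrow> real \<Rightarrow> 'a \<times> 'b \<Rightarrow> real^'d"
    and F :: "real \<Rightarrow> ('a \<times> 'b) measure"
    and Fi Fn :: "nat \<Rightarrow> real \<Rightarrow> ('a \<times> 'b) measure"
    and f :: "'a \<times> 'b \<Rightarrow> real \<Rightarrow> real^'m \<Rightarrow> real^'d^'m \<Rightarrow> real^'d^'m \<Rightarrow> (real^'m) measure \<Rightarrow> real^'m"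
    and \<Psi> :: "(real \<Rightarrow> real^'d) \<times> (real \<Rightarrow> real^'d) \<Rightarrow> real^'m"
    and \<xi> :: "'a \<times> 'b \<Rightarrow> real^'m"
    and \<xi>i :: "nat \<Rightarrow> 'a \<times> 'b \<Rightarrow> real^'m"
    and C\<^sub>f :: real
    and Y :: "real \<Rightarrow> 'a \<times> 'b \<Rightarrow> real^'m" and Z Z0 :: "real \<Rightarrow> 'a \<times> 'b \<Rightarrow> real^'d^'m"
    and Yn :: "nat \<Rightarrow> nat \<Rightarrow> real \<Rightarrow> 'a \<times> 'b \<Rightarrow> real^'m"
    and Zn :: "nat \<Rightarrow> nat \<Rightarrow> nat \<Rightarrow> real \<Rightarrow> 'a \<times> 'b \<Rightarrow> real^'d^'m"
    and Z0n :: "nat \<Rightarrow> nat \<Rightarrow> real \<Rightarrow> 'a \<times> 'b \<Rightarrow> real^'d^'m"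
    and Yt :: "nat \<Rightarrow> real \<Rightarrow> 'a \<times> 'b \<Rightarrow> real^'m"
    and Zt Z0t :: "nat \<Rightarrow> real \<Rightarrow> 'a \<times> 'b \<Rightarrow> real^'d^'m"
    and \<mu> :: "real \<Rightarrow> 'a \<times> 'b \<Rightarrow> (real^'m) measure"
    and \<mu>n :: "nat \<Rightarrow> real \<Rightarrow> 'a \<times> 'b \<Rightarrow> (real^'m) measure"
  defines "P \<equiv> product_space M0 M1"
    and "B0 \<equiv> (\<lambda>t \<omega>. W0 t (fst \<omega>))"
    and "B \<equiv> (\<lambda>t \<omega>. W t (snd \<omega>))"
    and "Bi \<equiv> (\<lambda>i t \<omega>. Wi i t (snd \<omega>))"
    and "F \<equiv> augmented_filtration P T {B0, B}"
    and "Fi \<equiv> (\<lambda>i. augmented_filtration P T {B0, Bi i})"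
    and "Fn \<equiv> (\<lambda>n. augmented_filtration P T (insert B0 (Bi ` {1..n})))"
    and "\<xi> \<equiv> (\<lambda>\<omega>. \<Psi> (trajectory T B0 \<omega>, trajectory T B \<omega>))"
    and "\<xi>i \<equiv> (\<lambda>i \<omega>. \<Psi> (trajectory T B0 \<omega>, trajectory T (Bi i) \<omega>))"
    and "\<mu> \<equiv> (\<lambda>s \<omega>. conditional_law M1 (Y s) (fst \<omega>))"
    and "\<mu>n \<equiv> (\<lambda>n s \<omega>. empirical_measure n (\<lambda>j. Yn n j s \<omega>))"
  assumes horizon: "T > 0"
    and spaces: "prob_space M0" "complete_measure M0" "prob_space M1" "complete_measure M1"
    and common_noise: "brownian_motion M0 T W0"
    and idiosyncratic_noise: "brownian_motion M1 T W" "\<And>i. i \<ge> 1 \<Longrightarrow> brownian_motion M1 T (Wi i)"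
    and independence: "prob_space.indep_vars M1 (\<lambda>_. PiM {0..T} (\<lambda>_. borel))
          (\<lambda>k. trajectory T (if k = 0 then W else Wi k)) (UNIV :: nat set)"
    and driver_progressive: "progressive_driver T F f"
    and driver_common: "\<And>\<omega>0 \<omega>1 \<omega>1' s y z z0 \<nu>.
          \<omega>0 \<in> space M0 \<Longrightarrow> \<omega>1 \<in> space M1 \<Longrightarrow> \<omega>1' \<in> space M1 \<Longrightarrow> s \<in> {0..T} \<Longrightarrow> \<nu> \<in> P2 \<Longrightarrow>
          f (\<omega>0, \<omega>1) s y z z0 \<nu> = f (\<omega>0, \<omega>1') s y z z0 \<nu>"
    and terminal_map: "\<Psi> \<in> borel_measurable (PiM {0..T} (\<lambda>_. borel) \<Otimes>\<^sub>M PiM {0..T} (\<lambda>_. borel))"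
    and terminal_L2: "in_L2 P \<xi>"
    and lipschitz: "AE \<omega> in P. \<forall>t\<in>{0..T}. \<forall>y y' z z' z0 z0'. \<forall>\<nu>\<in>P2. \<forall>\<nu>'\<in>P2.
          norm (f \<omega> t y z z0 \<nu> - f \<omega> t y' z' z0' \<nu>')
            \<le> C\<^sub>f * (norm (y - y') + norm (z - z') + norm (z0 - z0') + W2 \<nu> \<nu>')"
    and driver_at_zero:
          "(\<integral>\<^sup>+\<omega>. (\<integral>\<^sup>+s\<in>{0..T}. ennreal ((norm (f \<omega> s 0 0 0 (return borel 0)))\<^sup>2) \<partial>lborel) \<partial>P) < \<infinity>"
    and limit_equation:
          "bsde_solution P T F \<xi> (\<lambda>s \<omega>. f \<omega> s (Y s \<omega>) (Z s \<omega>) (Z0 s \<omega>) (\<mu> s \<omega>))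
             {()} (\<lambda>_. B) B0 Y (\<lambda>_. Z) Z0"
    and particle_system: "\<And>n i. 1 \<le> i \<Longrightarrow> i \<le> n \<Longrightarrow>
          bsde_solution P T (Fn n) (\<xi>i i)
             (\<lambda>s \<omega>. f \<omega> s (Yn n i s \<omega>) (Zn n i i s \<omega>) (Z0n n i s \<omega>) (\<mu>n n s \<omega>))
             {1..n} Bi B0 (Yn n i) (Zn n i) (Z0n n i)"
    and coupled_system: "\<And>i. 1 \<le> i \<Longrightarrow>
          bsde_solution P T (Fi i) (\<xi>i i)
             (\<lambda>s \<omega>. f \<omega> s (Yt i s \<omega>) (Zt i s \<omega>) (Z0t i s \<omega>) (\<mu> s \<omega>))
             {()} (\<lambda>_. Bi i) B0 (Yt i) (\<lambda>_. Zt i) (Z0t i)"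
  shows "\<exists>C\<^sub>T::real. C\<^sub>T > 0 \<and> (\<forall>n\<ge>1.
    (\<integral>\<^sup>+\<omega>. (SUP t\<in>{0..T}. (\<Sum>i=1..n.
         ennreal ((norm (Yn n i t \<omega> - Yt i t \<omega>))\<^sup>2)
         + (\<integral>\<^sup>+s\<in>{t..T}. ennreal ((norm (Z0n n i s \<omega> - Z0t i s \<omega>))\<^sup>2) \<partial>lborel)
         + (\<integral>\<^sup>+s\<in>{t..T}. (\<Sum>k=1..n.
              ennreal ((norm (Zn n i k s \<omega> - of_bool (i = k) *\<^sub>R Zt i s \<omega>))\<^sup>2)) \<partial>lborel)) / of_nat n) \<partial>P)
      \<le> ennreal C\<^sub>T * (\<integral>\<^sup>+\<omega>. (SUP s\<in>{0..T}. ennreal ((W2 (\<mu>n n s \<omega>) (\<mu> s \<omega>))\<^sup>2)) \<partial>P)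
    \<and> (\<forall>i\<in>{1..n}.
        (\<integral>\<^sup>+\<omega>. (SUP t\<in>{0..T}.
           ennreal ((norm (Yn n i t \<omega> - Yt i t \<omega>))\<^sup>2)
           + (\<integral>\<^sup>+s\<in>{t..T}. ennreal ((norm (Z0n n i s \<omega> - Z0t i s \<omega>))\<^sup>2) \<partial>lborel)
           + (\<integral>\<^sup>+s\<in>{t..T}. (\<Sum>k=1..n.
                ennreal ((norm (Zn n i k s \<omega> - of_bool (i = k) *\<^sub>R Zt i s \<omega>))\<^sup>2)) \<partial>lborel)) \<partial>P)
          \<le> ennreal C\<^sub>T * (\<integral>\<^sup>+\<omega>. (SUP s\<in>{0..T}. ennreal ((W2 (\<mu>n n s \<omega>) (\<mu> s \<omega>))\<^sup>2)) \<partial>P)))"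
proof -
  have M0: "prob_space M0" and M1: "prob_space M1" and cM1: "complete_measure M1" using spaces by auto
  interpret P: prob_space P unfolding P_def by (rule prob_space_product_space[OF M0 M1])
  have T0: "0 \<le> T" using horizon by simp
  define L where "L = lifted_motion W0 Wi"
  have L0: "L 0 = B0" by (auto simp: L_def lifted_motion_def B0_def fun_eq_iff)
  have Lk: "Bi k = L k" if "k \<in> {1..n}" for k n :: nat
    using that by (auto simp: L_def lifted_motion_def Bi_def fun_eq_iff)
  have Lset: "insert B0 (Bi ` {1..n}) = L ` {..n}" for n
  proof -
    have "{..n} = insert 0 {1..n}" by auto
    moreover have "Bi ` {1..n} = L ` {1..n}" by (rule image_cong[OF refl Lk])
    ultimately show ?thesis by (simp only: L0[symmetric] image_insert)
  qed
  have Fn: "Fn n = augmented_filtration P T (L ` {..n})" for n unfolding Fn_def Lset ..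
  have ind: "prob_space.indep_vars M1 (\<lambda>_. PiM {0..T} (\<lambda>_. borel)) (\<lambda>k. trajectory T (Wi k)) {1..n}" for n :: nat
  proof -
    interpret M1: prob_space M1 by (rule M1)
    have "M1.indep_vars (\<lambda>_. PiM {0..T} (\<lambda>_. borel)) (\<lambda>k. trajectory T (if k = 0 then W else Wi k)) {1..n}"
      by (rule M1.indep_vars_subset[OF independence]) simp
    then show ?thesis by (rule M1.indep_vars_cong[THEN iffD1, rotated -1]) auto
  qed
  have basis: "brownian_basis P T (Fn n) {..n} L" for n
    unfolding Fn L_def P_def
    by (rule lifted_brownian_basis[OF M0 M1 horizon ind common_noise]) (auto intro: idiosyncratic_noise)
  have sub: "sets (Fi i t) \<subseteq> sets (Fn n t)" if "i \<in> {1..n}" for i n t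
    unfolding Fi_def Fn_def using that by (intro augmented_filtration_mono) auto
  have law: "AE \<omega> in P. \<forall>s\<in>{0..T}. \<mu> s \<omega> \<in> P2"
  proof -
    have S2: "in_S2 P T F Y" using limit_equation by (simp add: bsde_solution_def)
    have Fsub: "sets (F t) \<subseteq> sets P" for t
      unfolding F_def
    proof (rule augmented_filtration_sub)
      fix X s assume "X \<in> {B0, B}" "0 \<le> s" "s \<le> T"
      then show "X s \<in> borel_measurable P"
        using brownian_measurable[OF common_noise, of s] brownian_measurable[OF idiosyncratic_noise(1), of s]
        unfolding P_def B0_def B_def by (auto intro: measurable_product_space)
    qed
    have Ym: "Y t \<in> borel_measurable P" if t: "t \<in> {0..T}" for t
    proof -
      have m: "Y t \<in> borel_measurable (F t)" using S2 t by (intro progressive_adapted) (auto simp: in_S2_def)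
      show ?thesis
        by (rule measurable_mono[THEN subsetD, OF order_refl refl _ _ m]) (use Fsub in \<open>auto simp: F_def\<close>)
    qed
    have "AE \<omega> in P. continuous_on {0..T} (\<lambda>t. Y t \<omega>)"
      by (rule bsde_solution_continuous[OF limit_equation]) simp
    moreover have "(\<integral>\<^sup>+\<omega>. (SUP t\<in>{0..T}. ennreal ((norm (Y t \<omega>))\<^sup>2)) \<partial>P) < \<infinity>" using S2 by (simp add: in_S2_def)
    ultimately show ?thesis
      using conditional_law_in_P2[OF M0 M1 cM1 T0, of Y] Ym unfolding P_def \<mu>_def by blast
  qed
  (* The sign of the given Lipschitz constant is arbitrary. *)
  define C where "C = \<bar>C\<^sub>f\<bar>"
  define S where "S n \<omega> = (SUP s\<in>{0..T}. ennreal ((W2 (\<mu>n n s \<omega>) (\<mu> s \<omega>))\<^sup>2))" for n \<omega>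
  define c where "c = 8 * C\<^sup>2 * T\<^sup>2"
  define e where "e n i t \<omega> = ennreal ((norm (Yn n i t \<omega> - Yt i t \<omega>))\<^sup>2)
         + energy t T (\<lambda>s. Z0n n i s \<omega> - Z0t i s \<omega>)
         + (\<integral>\<^sup>+s\<in>{t..T}. (\<Sum>k=1..n.
              ennreal ((norm (Zn n i k s \<omega> - of_bool (i = k) *\<^sub>R Zt i s \<omega>))\<^sup>2)) \<partial>lborel)" for n i t \<omega>
  have main: "\<exists>q\<in>borel_measurable P. (AE \<omega> in P. \<forall>t\<in>{0..T}. e n i t \<omega> \<le> q \<omega> + ennreal c * S n \<omega>) \<and>
     (\<integral>\<^sup>+\<omega>. q \<omega> \<partial>P) \<le> ennreal (stability_constant C T) * (\<integral>\<^sup>+\<omega>. S n \<omega> \<partial>P)" if i: "i \<in> {1..n}" for n i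
  proof -
    have n: "n \<ge> 1" and i1: "1 \<le> i" "i \<le> n" using i by auto
    have \<mu>n: "\<mu>n n s \<omega> \<in> P2" for s \<omega> unfolding \<mu>n_def by (rule empirical_measure_in_P2[OF n])
    have lip: "AE \<omega> in P. \<forall>s\<in>{0..T}.
        norm (f \<omega> s (Yn n i s \<omega>) (Zn n i i s \<omega>) (Z0n n i s \<omega>) (\<mu>n n s \<omega>) - f \<omega> s (Yt i s \<omega>) (Zt i s \<omega>) (Z0t i s \<omega>) (\<mu> s \<omega>)) \<le>
        C * (norm (Yn n i s \<omega> - Yt i s \<omega>) + norm (Zn n i i s \<omega> - Zt i s \<omega>) + norm (Z0n n i s \<omega> - Z0t i s \<omega>) + W2 (\<mu>n n s \<omega>) (\<mu> s \<omega>))"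
      using lipschitz law
    proof eventually_elim
      case (elim \<omega>)
      show ?case
      proof
        fix s assume s: "s \<in> {0..T}"
        let ?d = "norm (Yn n i s \<omega> - Yt i s \<omega>) + norm (Zn n i i s \<omega> - Zt i s \<omega>) + norm (Z0n n i s \<omega> - Z0t i s \<omega>) + W2 (\<mu>n n s \<omega>) (\<mu> s \<omega>)"
        have "norm (f \<omega> s (Yn n i s \<omega>) (Zn n i i s \<omega>) (Z0n n i s \<omega>) (\<mu>n n s \<omega>) - f \<omega> s (Yt i s \<omega>) (Zt i s \<omega>) (Z0t i s \<omega>) (\<mu> s \<omega>)) \<le> C\<^sub>f * ?d"
          using elim s \<mu>n by blast
        also have "\<dots> \<le> C * ?d" unfolding C_def by (intro mult_right_mono) (auto simp: W2_def)
        finally show "norm (f \<omega> s (Yn n i s \<omega>) (Zn n i i s \<omega>) (Z0n n i s \<omega>) (\<mu>n n s \<omega>) - f \<omega> s (Yt i s \<omega>) (Zt i s \<omega>) (Z0t i s \<omega>) (\<mu> s \<omega>)) \<le> C * ?d" .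
      qed
    qed
    show ?thesis unfolding e_def S_def c_def
      by (rule coupled_bsde_estimate[OF basis Lk i _ sub[OF i] particle_system[OF i1, folded L0] coupled_system[OF i1(1), folded L0] _ lip])
        (auto simp: Fi_def C_def)
  qed
  define CT where "CT = stability_constant C T + c + 1"
  have sc: "0 \<le> stability_constant C T"
    unfolding stability_constant_def iteration_constant_def using T0 by (intro mult_nonneg_nonneg add_nonneg_nonneg) auto
  have c0: "0 \<le> c" by (simp add: c_def)
  have cS: "(\<integral>\<^sup>+\<omega>. ennreal c * S n \<omega> \<partial>P) \<le> ennreal c * (\<integral>\<^sup>+\<omega>. S n \<omega> \<partial>P)" for n
  proof (cases "c = 0")
    case False
    then show ?thesis using c0 by (intro nn_integral_cmult_le_arbitrary) simp
  qed simp
  have total: "(\<integral>\<^sup>+\<omega>. h \<omega> \<partial>P) \<le> ennreal CT * (\<integral>\<^sup>+\<omega>. S n \<omega> \<partial>P)"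
    if q: "q \<in> borel_measurable P" and le: "AE \<omega> in P. h \<omega> \<le> q \<omega> + ennreal c * S n \<omega>"
      and qi: "(\<integral>\<^sup>+\<omega>. q \<omega> \<partial>P) \<le> ennreal (stability_constant C T) * (\<integral>\<^sup>+\<omega>. S n \<omega> \<partial>P)" for q h n
  proof -
    have "(\<integral>\<^sup>+\<omega>. h \<omega> \<partial>P) \<le> (\<integral>\<^sup>+\<omega>. q \<omega> \<partial>P) + (\<integral>\<^sup>+\<omega>. ennreal c * S n \<omega> \<partial>P)" by (rule nn_integral_le_add_arbitrary[OF q le])
    also have "\<dots> \<le> ennreal (stability_constant C T) * (\<integral>\<^sup>+\<omega>. S n \<omega> \<partial>P) + ennreal c * (\<integral>\<^sup>+\<omega>. S n \<omega> \<partial>P)"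
      by (rule add_mono[OF qi cS])
    also have "\<dots> = ennreal (stability_constant C T + c) * (\<integral>\<^sup>+\<omega>. S n \<omega> \<partial>P)"
      using sc c0 by (simp add: distrib_right)
    also have "\<dots> \<le> ennreal CT * (\<integral>\<^sup>+\<omega>. S n \<omega> \<partial>P)" unfolding CT_def by (intro mult_right_mono ennreal_leI) auto
    finally show ?thesis .
  qed
  have single: "(\<integral>\<^sup>+\<omega>. (SUP t\<in>{0..T}. e n i t \<omega>) \<partial>P) \<le> ennreal CT * (\<integral>\<^sup>+\<omega>. S n \<omega> \<partial>P)" if i: "i \<in> {1..n}" for n i
  proof -
    obtain q where q: "q \<in> borel_measurable P" "AE \<omega> in P. \<forall>t\<in>{0..T}. e n i t \<omega> \<le> q \<omega> + ennreal c * S n \<omega>"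
      "(\<integral>\<^sup>+\<omega>. q \<omega> \<partial>P) \<le> ennreal (stability_constant C T) * (\<integral>\<^sup>+\<omega>. S n \<omega> \<partial>P)" using main[OF i] by blast
    have "AE \<omega> in P. (SUP t\<in>{0..T}. e n i t \<omega>) \<le> q \<omega> + ennreal c * S n \<omega>"
      using q(2) by eventually_elim (intro SUP_least, auto)
    then show ?thesis by (rule total[OF q(1) _ q(3)])
  qed
  have average: "(\<integral>\<^sup>+\<omega>. (SUP t\<in>{0..T}. (\<Sum>i=1..n. e n i t \<omega>) / of_nat n) \<partial>P) \<le> ennreal CT * (\<integral>\<^sup>+\<omega>. S n \<omega> \<partial>P)" if n: "n \<ge> 1" for n
  proof -
    have "\<forall>i\<in>{1..n}. \<exists>q. q \<in> borel_measurable P \<and> (AE \<omega> in P. \<forall>t\<in>{0..T}. e n i t \<omega> \<le> q \<omega> + ennreal c * S n \<omega>) \<and>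
       (\<integral>\<^sup>+\<omega>. q \<omega> \<partial>P) \<le> ennreal (stability_constant C T) * (\<integral>\<^sup>+\<omega>. S n \<omega> \<partial>P)"
      using main by (simp only: Bex_def) blast
    from bchoice[OF this] obtain q where qq: "\<forall>i\<in>{1..n}. q i \<in> borel_measurable P \<and> (AE \<omega> in P. \<forall>t\<in>{0..T}. e n i t \<omega> \<le> q i \<omega> + ennreal c * S n \<omega>) \<and>
       (\<integral>\<^sup>+\<omega>. q i \<omega> \<partial>P) \<le> ennreal (stability_constant C T) * (\<integral>\<^sup>+\<omega>. S n \<omega> \<partial>P)" ..
    have q: "q i \<in> borel_measurable P"
      "AE \<omega> in P. \<forall>t\<in>{0..T}. e n i t \<omega> \<le> q i \<omega> + ennreal c * S n \<omega>"
      "(\<integral>\<^sup>+\<omega>. q i \<omega> \<partial>P) \<le> ennreal (stability_constant C T) * (\<integral>\<^sup>+\<omega>. S n \<omega> \<partial>P)" if "i \<in> {1..n}" for i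
      using bspec[OF qq that] by simp_all
    have nn: "(of_nat n :: ennreal) \<noteq> 0" "(of_nat n :: ennreal) \<noteq> \<infinity>" using n by (auto simp: of_nat_eq_0_iff)
    (* Averaging the pathwise bounds leaves the term with S unchanged, as it is the same for all particles. *)
    have mean_const: "(of_nat n * x) / of_nat n = x" for x :: ennreal
      using nn by (simp add: mult_divide_eq_ennreal mult.commute)
    define Q where "Q \<omega> = (\<Sum>i=1..n. q i \<omega>) / of_nat n" for \<omega>
    have Qm: "Q \<in> borel_measurable P"
      unfolding Q_def by (intro borel_measurable_divide_ennreal borel_measurable_sum q(1) borel_measurable_const)
    have all: "AE \<omega> in P. \<forall>i\<in>{1..n}. \<forall>t\<in>{0..T}. e n i t \<omega> \<le> q i \<omega> + ennreal c * S n \<omega>"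
      using q(2) by (subst AE_finite_all) auto
    have le: "AE \<omega> in P. (SUP t\<in>{0..T}. (\<Sum>i=1..n. e n i t \<omega>) / of_nat n) \<le> Q \<omega> + ennreal c * S n \<omega>"
      using all
    proof eventually_elim
      case (elim \<omega>)
      show ?case
      proof (rule SUP_least)
        fix t assume t: "t \<in> {0..T}"
        have "(\<Sum>i=1..n. e n i t \<omega>) \<le> (\<Sum>i=1..n. q i \<omega> + ennreal c * S n \<omega>)" using elim t by (intro sum_mono) auto
        also have "\<dots> = (\<Sum>i=1..n. q i \<omega>) + of_nat n * (ennreal c * S n \<omega>)" by (simp add: sum.distrib)
        finally have "(\<Sum>i=1..n. e n i t \<omega>) / of_nat n \<le> ((\<Sum>i=1..n. q i \<omega>) + of_nat n * (ennreal c * S n \<omega>)) / of_nat n"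
          by (rule divide_right_mono_ennreal)
        also have "\<dots> = Q \<omega> + ennreal c * S n \<omega>" unfolding Q_def add_divide_distrib_ennreal mean_const ..
        finally show "(\<Sum>i=1..n. e n i t \<omega>) / of_nat n \<le> Q \<omega> + ennreal c * S n \<omega>" .
      qed
    qed
    have "(\<integral>\<^sup>+\<omega>. Q \<omega> \<partial>P) = (\<Sum>i=1..n. \<integral>\<^sup>+\<omega>. q i \<omega> \<partial>P) / of_nat n"
      unfolding Q_def
      by (subst nn_integral_divide, intro borel_measurable_sum q(1), assumption, subst nn_integral_sum, rule q(1), assumption, rule refl)
    also have "\<dots> \<le> (\<Sum>i=1..n. ennreal (stability_constant C T) * (\<integral>\<^sup>+\<omega>. S n \<omega> \<partial>P)) / of_nat n"
      by (intro divide_right_mono_ennreal sum_mono q(3))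
    also have "\<dots> = (of_nat n * (ennreal (stability_constant C T) * (\<integral>\<^sup>+\<omega>. S n \<omega> \<partial>P))) / of_nat n" by simp
    also have "\<dots> = ennreal (stability_constant C T) * (\<integral>\<^sup>+\<omega>. S n \<omega> \<partial>P)" by (rule mean_const)
    finally have Qi: "(\<integral>\<^sup>+\<omega>. Q \<omega> \<partial>P) \<le> ennreal (stability_constant C T) * (\<integral>\<^sup>+\<omega>. S n \<omega> \<partial>P)" .
    show ?thesis by (rule total[OF Qm le Qi])
  qed
  have "CT > 0" using sc c0 by (simp add: CT_def)
  then show ?thesis using average single unfolding e_def S_def by blast
qed

end
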